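(* Let $(\mathcal A,(\mathcal A_t)_{t\ge 0},\mathbb E_{\mathcal A})$ and $(\mathcal B,(\mathcal B_t)_{t\ge 0},\mathbb E_{\mathcal B})$ be filtered $\mathrm W^*$-probability spaces, and let $\mathcal A_\beta$ be a fixed choice of $\mathcal A$ or $\mathcal A_{\mathrm{sa}}$. If $\mathcal U\subseteq\mathcal A_\beta$ is an open set, $F:\mathcal U\to\mathcal B$ is an adapted $C^2$ map, and $X:\mathbb R_+\to\mathcal A$ is an $L^\infty$-decomposable process such that $X(t)\in\mathcal U$ for all $t\ge0$, then for all $t\ge 0$ $$F(X(t))=F(X(0))+\int_0^tDF(X(s))[dX(s)]+\frac12\int_0^tD^2F(X(s))[dX(s),dX(s)].$$
   Context: A $\mathrm W^*$-probability space $(\mathcal A,\mathbb E)$ is a von Neumann algebra $\mathcal A$ with a faithful normal tracial state $\mathbb E$. $\mathcal A_{\mathrm{sa}}$ is the set of self-adjoint elements. For $p\in[1,\infty)$, $\|a\|_p=\mathbb E[|a|^p]^{1/p}$, and $L^p(\mathbb E)=L^p(\mathcal A,\mathbb E)$ is the $\|\cdot\|_p$-completion of $\mathcal A$; $L^\infty(\mathbb E)=\mathcal A$ with the operator norm. A filtration is an increasing family $(\mathcal A_t)_{t\ge0}$ of $\mathrm W^*$-subalgebras; $\mathbb E[\,\cdot\mid\mathcal A_t]$ is the trace-preserving conditional expectation. Processes. $X:\mathbb R_+\to\mathcal A$ is $L^\infty$-decomposable if $X$ is adapted ($X(t)\in\mathcal A_t$ for all $t$) and $X=X(0)+M+A$,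 where $M:\mathbb R_+\to\mathcal A$ is an operator-norm-continuous martingale ($M(t)\in\mathcal A_t$, $\mathbb E[M(t)\mid\mathcal A_s]=M(s)$ for $s\le t$), $A:\mathbb R_+\to\mathcal A$ is adapted, operator-norm-continuous and of locally bounded variation in operator norm, and $M(0)=A(0)=0$. Multilinear maps. "$k$-linear" means real-$k$-linear; a real-$k$-linear map $\mathcal A_{\mathrm{sa}}^k\to\mathcal B$ is identified with its complex-$k$-linear extension $\mathcal A^k\to\mathcal B$. For a $k$-linear $\Lambda:\mathcal A^k\to\mathcal B$ let $$\|\Lambda\|_{p_1,\dots,p_k;p}=\sup\{\|\Lambda[a_1,\dots,a_k]\|_p:a_i\in\mathcal A,\ \|a_i\|_{p_i}\le1\},\quad |||\Lambda|||_k=\sup\Big\{\|\Lambda\|_{p_1,\dots,p_k;p}:p_i,p\in[1,\infty],\ \tfrac1{p_1}+\cdots+\tfrac1{p_k}=\tfrac1p\Big\},$$ and $\mathbb B_k(\mathcal A^k;\mathcal B)=\{\Lambda:|||\Lambda|||_k<\infty\}$; $\mathbb B_0:=\mathcal B$ with its norm. Each $\Lambda\in\mathbb B_k(\mathcal A^k;\mathcal B)$ extends uniquely to a bounded $k$-linear map $L^{p_1}(\mathbb E_{\mathcal A})\times\cdots\times L^{p_k}(\mathbb E_{\mathcal A})\to L^p(\mathbb E_{\mathcal B})$ when $\sum 1/p_i\le1/p$. For $t\ge0$ and $k\geq 1$, $\mathcal F_{k,t}$ is the set of $\Lambda\in\mathbb B_k(\mathcal A^k;\mathcal B)$ such that for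 all $u\ge t$, $i\in\{1,\dots,k\}$, $a_1,\dots,a_k\in\mathcal A_u$ and $b\in\mathcal A$, $$\mathbb E_{\mathcal B}[\Lambda[a_1,\dots,a_{i-1},b,a_{i+1},\dots,a_k]\mid\mathcal B_u]=\Lambda[a_1,\dots,a_{i-1},\mathbb E_{\mathcal A}[b\mid\mathcal A_u],a_{i+1},\dots,a_k];$$ $\mathcal F_{0,t}:=\mathcal B_t$. Adapted $C^k$ maps. $F:\mathcal U\to\mathcal B$ is adapted $C^k$ if (i) $F$ is $k$ times continuously Fréchet differentiable ($\mathcal A_\beta,\mathcal B$ regarded as real Banach spaces; $D^iF(a)[h_1,\dots,h_i]=\partial_{h_i}\cdots\partial_{h_1}F(a)$, $D^0F=F$); (ii) for $i=0,\dots,k$, $D^iF(a)\in\mathbb B_i(\mathcal A^i;\mathcal B)$ for $a\in\mathcal U$ and $a\mapsto D^iF(a)$ is continuous with respect to $|||\cdot|||_i$; (iii) for $i=0,\dots,k$, $t\ge0$, and $a\in\mathcal U\cap\mathcal A_t$, $D^iF(a)\in\mathcal F_{i,t}$. Integrals. With partitions $\Pi=\{0=t_0<\cdots<t_n=t\}$ of $[0,t]$, $s_-$ the left neighbour of $s\in\Pi$ ($0_-:=0$), $\Delta_sX=X(s)-X(s_-)$, $|\Pi|=\max_s(s-s_-)$, $$\int_0^tDF(X(s))[dX(s)]=L^2\text{-}\lim_{|\Pi|\to0}\sum_{s\in\Pi}DF(X(s_-))[\Delta_sX],\qquad \int_0^tD^2F(X(s))[dX(s),dX(s)]=L^1\text{-}\lim_{|\Pi|\to0}\sum_{s\in\Pi}D^2F(X(s_-))[\Delta_sX,\Delta_sX];$$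 these limits exist under the stated hypotheses. *)

theory Defs
  imports "HOL-Analysis.Analysis"
begin

section \<open>Bounded operators on a complex Hilbert space\<close>

text \<open>
  The complex inner product is conjugate-linear in its first argument; its real part is the
  underlying real inner product, so norm, topology and completeness are those of the real space.
\<close>

class complex_hilbert = real_inner + complete_space +
  fixes scaleC :: "complex \<Rightarrow> 'a \<Rightarrow> 'a" (infixr "*\<^sub>C" 75)
    and cinner :: "'a \<Rightarrow> 'a \<Rightarrow> complex"
  assumes scaleC_add_right: "c *\<^sub>C (x + y) = c *\<^sub>C x + c *\<^sub>C y"
    and scaleC_add_left: "(c + d) *\<^sub>C x = c *\<^sub>C x + d *\<^sub>C x"
    and scaleC_scaleC: "c *\<^sub>C (d *\<^sub>C x) = (c * d) *\<^sub>C x"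
    and scaleC_of_real: "complex_of_real r *\<^sub>C x = r *\<^sub>R x"
    and cinner_commute: "cinner x y = cnj (cinner y x)"
    and cinner_add_right: "cinner x (y + z) = cinner x y + cinner x z"
    and cinner_scaleC_right: "cinner x (c *\<^sub>C y) = c * cinner x y"
    and Re_cinner: "Re (cinner x y) = inner x y"
begin

lemma cinner_self: "cinner x x = complex_of_real ((norm x)\<^sup>2)"
proof (rule complex_eqI)
  show "Re (cinner x x) = Re (complex_of_real ((norm x)\<^sup>2))"
    by (simp add: Re_cinner power2_norm_eq_inner)
  have "Im (cinner x x) = - Im (cinner x x)"
    using arg_cong[OF cinner_commute[of x x], of Im] by simp
  then show "Im (cinner x x) = Im (complex_of_real ((norm x)\<^sup>2))"
    by simp
qed

lemma norm_scaleC: "norm (c *\<^sub>C x) = cmod c * norm x"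
proof -
  have "complex_of_real ((norm (c *\<^sub>C x))\<^sup>2) = c * cinner (c *\<^sub>C x) x"
    unfolding cinner_self[symmetric] by (rule cinner_scaleC_right)
  also have "cinner (c *\<^sub>C x) x = cnj (c * cinner x x)"
    by (subst cinner_commute) (simp add: cinner_scaleC_right)
  also have "c * cnj (c * cinner x x) = complex_of_real ((cmod c * norm x)\<^sup>2)"
    by (simp only: cinner_self complex_cnj_mult complex_cnj_power complex_cnj_complex_of_real mult.assoc[symmetric]
        complex_norm_square[symmetric] power_mult_distrib of_real_mult of_real_power)
  finally have "(norm (c *\<^sub>C x))\<^sup>2 = (cmod c * norm x)\<^sup>2"
    by (simp only: of_real_eq_iff)
  then show ?thesis
    by (rule power2_eq_imp_eq) simp_all
qed

end

type_synonym 'h operator = "'h \<Rightarrow>\<^sub>L 'h"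

text \<open>
  The library's bounded linear functions are real-linear; the bounded operators in the
  complex sense are those in the following set.
\<close>

definition bounded_ops :: "'h::complex_hilbert operator set" where
  "bounded_ops = {T. \<forall>c x. blinfun_apply T (c *\<^sub>C x) = c *\<^sub>C blinfun_apply T x}"

lift_definition scale_op :: "complex \<Rightarrow> 'h::complex_hilbert operator \<Rightarrow> 'h operator"
  is "\<lambda>c T x. c *\<^sub>C T x"
proof -
  fix c :: complex and T :: "'h \<Rightarrow> 'h"
  assume T: "bounded_linear T"
  have "bounded_linear (\<lambda>x::'h. c *\<^sub>C x)"
  proof (rule bounded_linear_intro[where K = "cmod c"])
    fix x y :: 'h and r :: real
    show "c *\<^sub>C (x + y) = c *\<^sub>C x + c *\<^sub>C y"
      by (rule scaleC_add_right)
    show "c *\<^sub>C (r *\<^sub>R x) = r *\<^sub>R (c *\<^sub>C x)"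
      by (simp add: scaleC_of_real[symmetric] scaleC_scaleC mult.commute)
    show "norm (c *\<^sub>C x) \<le> norm x * cmod c"
      by (simp add: norm_scaleC mult.commute)
  qed
  then show "bounded_linear (\<lambda>x. c *\<^sub>C T x)"
    using T by (rule bounded_linear_compose)
qed

definition adj :: "'h::complex_hilbert operator \<Rightarrow> 'h operator" where
  "adj T = (THE S. \<forall>x y. cinner (blinfun_apply T x) y = cinner x (blinfun_apply S y))"

definition op_nonneg :: "'h::complex_hilbert operator \<Rightarrow> bool" where
  "op_nonneg T \<longleftrightarrow> T \<in> bounded_ops \<and> (\<forall>x. cinner x (blinfun_apply T x) \<in> \<real>\<^sub>\<ge>\<^sub>0)"

definition op_le :: "'h::complex_hilbert operator \<Rightarrow> 'h operator \<Rightarrow> bool" where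
  "op_le S T \<longleftrightarrow> op_nonneg (T - S)"

definition op_re :: "'h::complex_hilbert operator \<Rightarrow> 'h operator" where
  "op_re T = (1/2) *\<^sub>R (T + adj T)"

definition op_im :: "'h::complex_hilbert operator \<Rightarrow> 'h operator" where
  "op_im T = scale_op (- \<i>/2) (T - adj T)"

definition op_power :: "'h::complex_hilbert operator \<Rightarrow> nat \<Rightarrow> 'h operator" where
  "op_power T n = ((\<lambda>S. T o\<^sub>L S) ^^ n) id_blinfun"

definition op_poly :: "real poly \<Rightarrow> 'h::complex_hilbert operator \<Rightarrow> 'h operator" where
  "op_poly P T = (\<Sum>i\<le>degree P. coeff P i *\<^sub>R op_power T i)"

text \<open>
  Continuous functional calculus \<open>f(T)\<close> of a self-adjoint \<open>T\<close>: the norm limit of \<open>P(T)\<close> as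
  polynomials \<open>P\<close> tend to \<open>f\<close> uniformly on \<open>[-\<parallel>T\<parallel>, \<parallel>T\<parallel>]\<close>, an interval containing the spectrum.
  It is only used for \<open>f\<close> continuous on all of \<open>\<real>\<close>.
\<close>

definition fun_calc :: "(real \<Rightarrow> real) \<Rightarrow> 'h::complex_hilbert operator \<Rightarrow> 'h operator" where
  "fun_calc f T = (THE S. \<forall>\<epsilon>>0. \<exists>\<delta>>0. \<forall>P.
     (\<forall>x\<in>{- norm T..norm T}. \<bar>poly P x - f x\<bar> < \<delta>) \<longrightarrow> norm (op_poly P T - S) < \<epsilon>)"

definition op_abs :: "'h::complex_hilbert operator \<Rightarrow> 'h operator" where
  "op_abs T = fun_calc sqrt (adj T o\<^sub>L T)"

section \<open>\<open>W\<^sup>*\<close>-probability spaces\<close>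

definition commutant :: "'h::complex_hilbert operator set \<Rightarrow> 'h operator set" where
  "commutant S = {T \<in> bounded_ops. \<forall>R\<in>S. T o\<^sub>L R = R o\<^sub>L T}"

definition von_neumann_algebra :: "'h::complex_hilbert operator set \<Rightarrow> bool" where
  "von_neumann_algebra A \<longleftrightarrow>
     A \<subseteq> bounded_ops \<and> adj ` A \<subseteq> A \<and> commutant (commutant A) = A"

definition self_adjoints :: "'h::complex_hilbert operator set \<Rightarrow> 'h operator set" where
  "self_adjoints A = {a \<in> A. adj a = a}"

definition op_lub :: "'h::complex_hilbert operator set \<Rightarrow> 'h operator set \<Rightarrow> 'h operator \<Rightarrow> bool" where
  "op_lub A D S \<longleftrightarrow> S \<in> self_adjoints A \<and> (\<forall>a\<in>D. op_le a S) \<and>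
     (\<forall>R\<in>self_adjoints A. (\<forall>a\<in>D. op_le a R) \<longrightarrow> op_le S R)"

definition normal_functional ::
  "'h::complex_hilbert operator set \<Rightarrow> ('h operator \<Rightarrow> complex) \<Rightarrow> bool" where
  "normal_functional A E \<longleftrightarrow>
     (\<forall>D S. D \<noteq> {} \<and> D \<subseteq> self_adjoints A \<and> (\<forall>a\<in>D. \<forall>b\<in>D. \<exists>c\<in>D. op_le a c \<and> op_le b c) \<and>
        op_lub A D S \<longrightarrow> Re (E S) = (SUP a\<in>D. Re (E a)))"

definition wstar_prob_space ::
  "'h::complex_hilbert operator set \<Rightarrow> ('h operator \<Rightarrow> complex) \<Rightarrow> bool" where
  "wstar_prob_space A E \<longleftrightarrow> von_neumann_algebra A \<and>
     (\<forall>a\<in>A. \<forall>b\<in>A. E (a + b) = E a + E b) \<and> (\<forall>c. \<forall>a\<in>A. E (scale_op c a) = c * E a) \<and>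
     (\<forall>a\<in>A. op_nonneg a \<longrightarrow> E a \<in> \<real>\<^sub>\<ge>\<^sub>0) \<and> E id_blinfun = 1 \<and>
     (\<forall>a\<in>A. \<forall>b\<in>A. E (a o\<^sub>L b) = E (b o\<^sub>L a)) \<and>
     (\<forall>a\<in>A. E (adj a o\<^sub>L a) = 0 \<longrightarrow> a = 0) \<and>
     normal_functional A E"

definition filtered_wstar_prob_space ::
  "'h::complex_hilbert operator set \<Rightarrow> (real \<Rightarrow> 'h operator set) \<Rightarrow> ('h operator \<Rightarrow> complex) \<Rightarrow> bool" where
  "filtered_wstar_prob_space A \<A> E \<longleftrightarrow> wstar_prob_space A E \<and>
     (\<forall>t\<ge>0. von_neumann_algebra (\<A> t) \<and> \<A> t \<subseteq> A) \<and>
     (\<forall>s t. 0 \<le> s \<and> s \<le> t \<longrightarrow> \<A> s \<subseteq> \<A> t)"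

definition is_cond_exp ::
  "'h::complex_hilbert operator set \<Rightarrow> ('h operator \<Rightarrow> complex) \<Rightarrow> 'h operator set \<Rightarrow>
     ('h operator \<Rightarrow> 'h operator) \<Rightarrow> bool" where
  "is_cond_exp A E N C \<longleftrightarrow> C \<in> A \<rightarrow> N \<and>
     (\<forall>a\<in>A. \<forall>b\<in>A. C (a + b) = C a + C b) \<and> (\<forall>c. \<forall>a\<in>A. C (scale_op c a) = scale_op c (C a)) \<and>
     (\<forall>a\<in>A. op_nonneg a \<longrightarrow> op_nonneg (C a)) \<and> (\<forall>b\<in>N. C b = b) \<and>
     (\<forall>a\<in>A. \<forall>b\<in>N. \<forall>c\<in>N. C (b o\<^sub>L a o\<^sub>L c) = b o\<^sub>L C a o\<^sub>L c) \<and>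
     (\<forall>a\<in>A. E (C a) = E a)"

definition cond_exp ::
  "'h::complex_hilbert operator set \<Rightarrow> ('h operator \<Rightarrow> complex) \<Rightarrow> 'h operator set \<Rightarrow>
     'h operator \<Rightarrow> 'h operator" where
  "cond_exp A E N = (THE C. C \<in> extensional A \<and> is_cond_exp A E N C)"

section \<open>Noncommutative \<open>L\<^sup>p\<close> spaces\<close>

definition Lp_norm :: "('h::complex_hilbert operator \<Rightarrow> complex) \<Rightarrow> ennreal \<Rightarrow> 'h operator \<Rightarrow> real" where
  "Lp_norm E p a = (if p = \<infinity> then norm a
     else Re (E (fun_calc (\<lambda>x. \<bar>x\<bar> powr enn2real p) (op_abs a))) powr (1 / enn2real p))"

text \<open>
  For finite \<open>p\<close>, \<open>L\<^sup>p\<close> is the set of classes of Cauchy sequences for the \<open>p\<close>-norm, two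
  sequences being equivalent when the \<open>p\<close>-norm of their difference tends to 0.
\<close>

definition Lp_Cauchy ::
  "'h::complex_hilbert operator set \<Rightarrow> ('h operator \<Rightarrow> complex) \<Rightarrow> ennreal \<Rightarrow> (nat \<Rightarrow> 'h operator) set" where
  "Lp_Cauchy A E p = {x. range x \<subseteq> A \<and>
     (\<forall>\<epsilon>>0. \<exists>N. \<forall>m\<ge>N. \<forall>n\<ge>N. Lp_norm E p (x m - x n) < \<epsilon>)}"

definition Lp_rel ::
  "'h::complex_hilbert operator set \<Rightarrow> ('h operator \<Rightarrow> complex) \<Rightarrow> ennreal \<Rightarrow>
     ((nat \<Rightarrow> 'h operator) \<times> (nat \<Rightarrow> 'h operator)) set" where
  "Lp_rel A E p = {(x, y). x \<in> Lp_Cauchy A E p \<and> y \<in> Lp_Cauchy A E p \<and>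
     (\<lambda>n. Lp_norm E p (x n - y n)) \<longlonglongrightarrow> 0}"

definition Lp_space ::
  "'h::complex_hilbert operator set \<Rightarrow> ('h operator \<Rightarrow> complex) \<Rightarrow> ennreal \<Rightarrow> (nat \<Rightarrow> 'h operator) set set" where
  "Lp_space A E p = Lp_Cauchy A E p // Lp_rel A E p"

definition Lp_of ::
  "'h::complex_hilbert operator set \<Rightarrow> ('h operator \<Rightarrow> complex) \<Rightarrow> ennreal \<Rightarrow>
     'h operator \<Rightarrow> (nat \<Rightarrow> 'h operator) set" where
  "Lp_of A E p a = Lp_rel A E p `` {\<lambda>n. a}"

definition Lp_add ::
  "'h::complex_hilbert operator set \<Rightarrow> ('h operator \<Rightarrow> complex) \<Rightarrow> ennreal \<Rightarrow>
     (nat \<Rightarrow> 'h operator) set \<Rightarrow> (nat \<Rightarrow> 'h operator) set \<Rightarrow> (nat \<Rightarrow> 'h operator) set" where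
  "Lp_add A E p \<xi> \<eta> = (\<Union>x\<in>\<xi>. \<Union>y\<in>\<eta>. Lp_rel A E p `` {\<lambda>n. x n + y n})"

definition Lp_scaleR ::
  "'h::complex_hilbert operator set \<Rightarrow> ('h operator \<Rightarrow> complex) \<Rightarrow> ennreal \<Rightarrow>
     real \<Rightarrow> (nat \<Rightarrow> 'h operator) set \<Rightarrow> (nat \<Rightarrow> 'h operator) set" where
  "Lp_scaleR A E p r \<xi> = (\<Union>x\<in>\<xi>. Lp_rel A E p `` {\<lambda>n. r *\<^sub>R x n})"

text \<open>Distance, in \<open>L\<^sup>p\<close>, between an element of the algebra and a class.\<close>

definition Lp_dist ::
  "('h::complex_hilbert operator \<Rightarrow> complex) \<Rightarrow> ennreal \<Rightarrow> 'h operator \<Rightarrow> (nat \<Rightarrow> 'h operator) set \<Rightarrow> real" where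
  "Lp_dist E p a \<xi> = the_elem ((\<lambda>x. lim (\<lambda>n. Lp_norm E p (a - x n))) ` \<xi>)"

text \<open>
  The canonical map from \<open>L\<^sup>p\<close> to \<open>L\<^sup>1\<close>: a Cauchy sequence for the \<open>p\<close>-norm is one for the 1-norm.
\<close>

definition Lp_to_L1 ::
  "'h::complex_hilbert operator set \<Rightarrow> ('h operator \<Rightarrow> complex) \<Rightarrow>
     (nat \<Rightarrow> 'h operator) set \<Rightarrow> (nat \<Rightarrow> 'h operator) set" where
  "Lp_to_L1 A E \<xi> = Lp_rel A E 1 `` \<xi>"

section \<open>Partitions and \<open>L\<^sup>\<infinity>\<close>-decomposable processes\<close>

definition is_partition :: "real \<Rightarrow> real set \<Rightarrow> bool" where
  "is_partition t \<P> \<longleftrightarrow> finite \<P> \<and> 0 \<in> \<P> \<and> t \<in> \<P> \<and> \<P> \<subseteq> {0..t}"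

definition left_nb :: "real set \<Rightarrow> real \<Rightarrow> real" where
  "left_nb \<P> s = (if s = 0 then 0 else Max {r \<in> \<P>. r < s})"

definition mesh :: "real set \<Rightarrow> real" where
  "mesh \<P> = Max ((\<lambda>s. s - left_nb \<P> s) ` \<P>)"

definition fine_partitions :: "real \<Rightarrow> real set filter" where
  "fine_partitions t = (INF \<delta>\<in>{0<..}. principal {\<P>. is_partition t \<P> \<and> mesh \<P> < \<delta>})"

definition increment :: "(real \<Rightarrow> 'a::minus) \<Rightarrow> real set \<Rightarrow> real \<Rightarrow> 'a" where
  "increment X \<P> s = X s - X (left_nb \<P> s)"

definition locally_bounded_variation :: "(real \<Rightarrow> 'a::real_normed_vector) \<Rightarrow> bool" where
  "locally_bounded_variation Y \<longleftrightarrow>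
     (\<forall>t\<ge>0. \<exists>K. \<forall>\<P>. is_partition t \<P> \<longrightarrow> (\<Sum>s\<in>\<P>. norm (increment Y \<P> s)) \<le> K)"

definition adapted_process :: "(real \<Rightarrow> 'a set) \<Rightarrow> (real \<Rightarrow> 'a) \<Rightarrow> bool" where
  "adapted_process \<A> Y \<longleftrightarrow> (\<forall>t\<ge>0. Y t \<in> \<A> t)"

definition martingale ::
  "'h::complex_hilbert operator set \<Rightarrow> (real \<Rightarrow> 'h operator set) \<Rightarrow> ('h operator \<Rightarrow> complex) \<Rightarrow>
     (real \<Rightarrow> 'h operator) \<Rightarrow> bool" where
  "martingale A \<A> E M \<longleftrightarrow> adapted_process \<A> M \<and>
     (\<forall>s t. 0 \<le> s \<and> s \<le> t \<longrightarrow> cond_exp A E (\<A> s) (M t) = M s)"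

definition Linf_decomposable ::
  "'h::complex_hilbert operator set \<Rightarrow> (real \<Rightarrow> 'h operator set) \<Rightarrow> ('h operator \<Rightarrow> complex) \<Rightarrow>
     (real \<Rightarrow> 'h operator) \<Rightarrow> bool" where
  "Linf_decomposable A \<A> E X \<longleftrightarrow> adapted_process \<A> X \<and>
     (\<exists>M Y. (\<forall>t\<ge>0. X t = X 0 + M t + Y t) \<and> M 0 = 0 \<and> Y 0 = 0 \<and>
        martingale A \<A> E M \<and> continuous_on {0..} M \<and>
        adapted_process \<A> Y \<and> continuous_on {0..} Y \<and> locally_bounded_variation Y)"

section \<open>Multilinear maps\<close>

text \<open>
  A \<open>k\<close>-linear map is a function on lists, of which only the values on lists of length \<open>k\<close> with
  entries in the domain matter. Linearity is over the reals.
\<close>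

definition tuples :: "'a set \<Rightarrow> nat \<Rightarrow> 'a list set" where
  "tuples V k = {hs. length hs = k \<and> set hs \<subseteq> V}"

definition multilinear_on ::
  "'a::real_vector set \<Rightarrow> nat \<Rightarrow> 'b::real_vector set \<Rightarrow> ('a list \<Rightarrow> 'b) \<Rightarrow> bool" where
  "multilinear_on V k W \<Lambda> \<longleftrightarrow>
     (\<forall>hs\<in>tuples V k. \<Lambda> hs \<in> W) \<and>
     (\<forall>hs\<in>tuples V k. \<forall>i<k. \<forall>a\<in>V. \<forall>b\<in>V. \<Lambda> (hs[i := a + b]) = \<Lambda> (hs[i := a]) + \<Lambda> (hs[i := b])) \<and>
     (\<forall>hs\<in>tuples V k. \<forall>i<k. \<forall>a\<in>V. \<forall>r. \<Lambda> (hs[i := r *\<^sub>R a]) = r *\<^sub>R \<Lambda> (hs[i := a]))"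

text \<open>
  The complex-multilinear extension of a real-multilinear map defined on self-adjoint tuples,
  obtained by expanding each argument as \<open>a = op_re a + \<i> op_im a\<close>.
\<close>

fun complex_ext ::
  "('h::complex_hilbert operator list \<Rightarrow> 'k::complex_hilbert operator) \<Rightarrow> 'h operator list \<Rightarrow> 'k operator" where
  "complex_ext \<Lambda> [] = \<Lambda> []"
| "complex_ext \<Lambda> (a # as) =
     complex_ext (\<lambda>hs. \<Lambda> (op_re a # hs)) as + scale_op \<i> (complex_ext (\<lambda>hs. \<Lambda> (op_im a # hs)) as)"

definition multi_norm ::
  "'h::complex_hilbert operator set \<Rightarrow> ('h operator \<Rightarrow> complex) \<Rightarrow> ('k::complex_hilbert operator \<Rightarrow> complex) \<Rightarrow>
     ennreal list \<Rightarrow> ennreal \<Rightarrow> ('h operator list \<Rightarrow> 'k operator) \<Rightarrow> ennreal" where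
  "multi_norm A EA EB ps p \<Lambda> =
     (SUP hs\<in>{hs \<in> tuples A (length ps). \<forall>i<length ps. Lp_norm EA (ps ! i) (hs ! i) \<le> 1}.
        ennreal (Lp_norm EB p (\<Lambda> hs)))"

text \<open>
  For \<open>k = 0\<close> the constraint on the exponents forces \<open>p = \<infinity>\<close>, and the value is the operator norm.
\<close>

definition triple_norm ::
  "'h::complex_hilbert operator set \<Rightarrow> ('h operator \<Rightarrow> complex) \<Rightarrow> ('k::complex_hilbert operator \<Rightarrow> complex) \<Rightarrow>
     nat \<Rightarrow> ('h operator list \<Rightarrow> 'k operator) \<Rightarrow> ennreal" where
  "triple_norm A EA EB k \<Lambda> =
     (SUP (ps, p)\<in>{(ps, p). length ps = k \<and> (\<forall>q\<in>set ps. 1 \<le> q) \<and> 1 \<le> p \<and>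
                      (\<Sum>q\<leftarrow>ps. inverse q) = inverse p}.
        multi_norm A EA EB ps p \<Lambda>)"

definition bounded_multi ::
  "'h::complex_hilbert operator set \<Rightarrow> ('h operator \<Rightarrow> complex) \<Rightarrow>
     'k::complex_hilbert operator set \<Rightarrow> ('k operator \<Rightarrow> complex) \<Rightarrow>
     nat \<Rightarrow> ('h operator list \<Rightarrow> 'k operator) set" where
  "bounded_multi A EA B EB k = {\<Lambda>. multilinear_on A k B \<Lambda> \<and> triple_norm A EA EB k \<Lambda> < \<infinity>}"

definition adapted_multi ::
  "'h::complex_hilbert operator set \<Rightarrow> (real \<Rightarrow> 'h operator set) \<Rightarrow> ('h operator \<Rightarrow> complex) \<Rightarrow>
     'k::complex_hilbert operator set \<Rightarrow> (real \<Rightarrow> 'k operator set) \<Rightarrow> ('k operator \<Rightarrow> complex) \<Rightarrow>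
     nat \<Rightarrow> real \<Rightarrow> ('h operator list \<Rightarrow> 'k operator) set" where
  "adapted_multi A \<A> EA B \<B> EB k t =
     (if k = 0 then {\<Lambda>. \<Lambda> [] \<in> \<B> t}
      else {\<Lambda> \<in> bounded_multi A EA B EB k.
              \<forall>u\<ge>t. \<forall>i<k. \<forall>as\<in>tuples (\<A> u) k. \<forall>b\<in>A.
                cond_exp B EB (\<B> u) (\<Lambda> (as[i := b])) = \<Lambda> (as[i := cond_exp A EA (\<A> u) b])})"

section \<open>Adapted \<open>C\<^sup>k\<close> maps\<close>

datatype base = All_Elements | Self_Adjoint_Elements

fun base_set :: "base \<Rightarrow> 'h::complex_hilbert operator set \<Rightarrow> 'h operator set" where
  "base_set All_Elements A = A"
| "base_set Self_Adjoint_Elements A = self_adjoints A"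

text \<open>
  \<open>D\<^sup>iF(a)[h\<^sub>1, \<dots>, h\<^sub>i]\<close> as the iterated directional derivative along \<open>h\<^sub>1\<close> first and \<open>h\<^sub>i\<close> last.
\<close>

definition iter_deriv ::
  "('a::real_normed_vector \<Rightarrow> 'b::real_normed_vector) \<Rightarrow> 'a \<Rightarrow> 'a list \<Rightarrow> 'b" where
  "iter_deriv F a hs = fold (\<lambda>h G a. vector_derivative (\<lambda>r. G (a + r *\<^sub>R h)) (at 0)) hs F a"

text \<open>
  \<open>F\<close> is \<open>k\<close> times continuously Frechet differentiable on the relatively open subset \<open>U\<close> of the
  real normed space \<open>V\<close>: for \<open>i < k\<close>, \<open>D\<^sup>i\<^sup>+\<^sup>1F\<close> is the Frechet derivative of \<open>D\<^sup>iF\<close> as a map into the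
  bounded \<open>i\<close>-linear maps from \<open>V\<close> with the operator norm. Library derivatives do not apply
  directly, since a bounded linear map on the subspace \<open>V\<close> need not extend to the whole type.
\<close>

definition frechet_Ck_on ::
  "'a::real_normed_vector set \<Rightarrow> 'a set \<Rightarrow> 'b::real_normed_vector set \<Rightarrow> nat \<Rightarrow> ('a \<Rightarrow> 'b) \<Rightarrow> bool" where
  "frechet_Ck_on V U W k F \<longleftrightarrow>
     (\<forall>i\<le>k. \<forall>a\<in>U. multilinear_on V i W (iter_deriv F a) \<and>
        (\<exists>K. \<forall>hs\<in>tuples V i. norm (iter_deriv F a hs) \<le> K * (\<Prod>h\<leftarrow>hs. norm h))) \<and>
     (\<forall>i<k. \<forall>a\<in>U. \<forall>\<epsilon>>0. \<exists>\<delta>>0. \<forall>h\<in>V. norm h < \<delta> \<and> a + h \<in> U \<longrightarrow>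
        (\<forall>hs\<in>tuples V i.
           norm (iter_deriv F (a + h) hs - iter_deriv F a hs - iter_deriv F a (hs @ [h]))
             \<le> \<epsilon> * norm h * (\<Prod>h'\<leftarrow>hs. norm h'))) \<and>
     (\<forall>i\<le>k. \<forall>a\<in>U. \<forall>\<epsilon>>0. \<exists>\<delta>>0. \<forall>a'\<in>U. dist a' a < \<delta> \<longrightarrow>
        (\<forall>hs\<in>tuples V i.
           norm (iter_deriv F a' hs - iter_deriv F a hs) \<le> \<epsilon> * (\<Prod>h\<leftarrow>hs. norm h)))"

text \<open>
  \<open>D\<^sup>iF(a)\<close> as a real-\<open>i\<close>-linear map on the whole algebra: for maps defined on self-adjoint
  elements it is the complex-multilinear extension.
\<close>

definition deriv_map ::
  "base \<Rightarrow> ('h::complex_hilbert operator \<Rightarrow> 'k::complex_hilbert operator) \<Rightarrow>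
     'h operator \<Rightarrow> 'h operator list \<Rightarrow> 'k operator" where
  "deriv_map \<beta> F a =
     (case \<beta> of All_Elements \<Rightarrow> iter_deriv F a | Self_Adjoint_Elements \<Rightarrow> complex_ext (iter_deriv F a))"

definition adapted_Ck ::
  "'h::complex_hilbert operator set \<Rightarrow> (real \<Rightarrow> 'h operator set) \<Rightarrow> ('h operator \<Rightarrow> complex) \<Rightarrow>
     'k::complex_hilbert operator set \<Rightarrow> (real \<Rightarrow> 'k operator set) \<Rightarrow> ('k operator \<Rightarrow> complex) \<Rightarrow>
     base \<Rightarrow> 'h operator set \<Rightarrow> nat \<Rightarrow> ('h operator \<Rightarrow> 'k operator) \<Rightarrow> bool" where
  "adapted_Ck A \<A> EA B \<B> EB \<beta> U k F \<longleftrightarrow>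
     frechet_Ck_on (base_set \<beta> A) U B k F \<and>
     (\<forall>i\<le>k. (\<forall>a\<in>U. deriv_map \<beta> F a \<in> bounded_multi A EA B EB i) \<and>
        (\<forall>a\<in>U. \<forall>\<epsilon>>0. \<exists>\<delta>>0. \<forall>a'\<in>U. dist a' a < \<delta> \<longrightarrow>
           triple_norm A EA EB i (\<lambda>hs. deriv_map \<beta> F a' hs - deriv_map \<beta> F a hs) < ennreal \<epsilon>)) \<and>
     (\<forall>i\<le>k. \<forall>t\<ge>0. \<forall>a\<in>U \<inter> \<A> t. deriv_map \<beta> F a \<in> adapted_multi A \<A> EA B \<B> EB i t)"

section \<open>The integrals\<close>

definition has_Lp_limit ::
  "'k::complex_hilbert operator set \<Rightarrow> ('k operator \<Rightarrow> complex) \<Rightarrow> ennreal \<Rightarrow>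
     ('i \<Rightarrow> 'k operator) \<Rightarrow> 'i filter \<Rightarrow> (nat \<Rightarrow> 'k operator) set \<Rightarrow> bool" where
  "has_Lp_limit B E p S f \<xi> \<longleftrightarrow>
     \<xi> \<in> Lp_space B E p \<and> ((\<lambda>i. Lp_dist E p (S i) \<xi>) \<longlongrightarrow> 0) f"

definition has_first_integral ::
  "'k::complex_hilbert operator set \<Rightarrow> ('k operator \<Rightarrow> complex) \<Rightarrow> base \<Rightarrow>
     ('h::complex_hilbert operator \<Rightarrow> 'k operator) \<Rightarrow> (real \<Rightarrow> 'h operator) \<Rightarrow> real \<Rightarrow>
     (nat \<Rightarrow> 'k operator) set \<Rightarrow> bool" where
  "has_first_integral B EB \<beta> F X t \<xi> \<longleftrightarrow>
     has_Lp_limit B EB 2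
       (\<lambda>\<P>. \<Sum>s\<in>\<P>. deriv_map \<beta> F (X (left_nb \<P> s)) [increment X \<P> s])
       (fine_partitions t) \<xi>"

definition has_second_integral ::
  "'k::complex_hilbert operator set \<Rightarrow> ('k operator \<Rightarrow> complex) \<Rightarrow> base \<Rightarrow>
     ('h::complex_hilbert operator \<Rightarrow> 'k operator) \<Rightarrow> (real \<Rightarrow> 'h operator) \<Rightarrow> real \<Rightarrow>
     (nat \<Rightarrow> 'k operator) set \<Rightarrow> bool" where
  "has_second_integral B EB \<beta> F X t \<xi> \<longleftrightarrow>
     has_Lp_limit B EB 1
       (\<lambda>\<P>. \<Sum>s\<in>\<P>. deriv_map \<beta> F (X (left_nb \<P> s)) [increment X \<P> s, increment X \<P> s])
       (fine_partitions t) \<xi>"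

definition first_integral ::
  "'k::complex_hilbert operator set \<Rightarrow> ('k operator \<Rightarrow> complex) \<Rightarrow> base \<Rightarrow>
     ('h::complex_hilbert operator \<Rightarrow> 'k operator) \<Rightarrow> (real \<Rightarrow> 'h operator) \<Rightarrow> real \<Rightarrow>
     (nat \<Rightarrow> 'k operator) set" where
  "first_integral B EB \<beta> F X t = (THE \<xi>. has_first_integral B EB \<beta> F X t \<xi>)"

definition second_integral ::
  "'k::complex_hilbert operator set \<Rightarrow> ('k operator \<Rightarrow> complex) \<Rightarrow> base \<Rightarrow>
     ('h::complex_hilbert operator \<Rightarrow> 'k operator) \<Rightarrow> (real \<Rightarrow> 'h operator) \<Rightarrow> real \<Rightarrow>
     (nat \<Rightarrow> 'k operator) set" where
  "second_integral B EB \<beta> F X t = (THE \<xi>. has_second_integral B EB \<beta> F X t \<xi>)"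

end

theory Submission
  imports Defs "HOL-Computational_Algebra.Fundamental_Theorem_Algebra"
begin

text \<open>
  The formula is a second-order Taylor expansion summed along a partition \<open>P\<close> of \<open>[0, t]\<close>.
  Telescoping gives \<open>F(X t) - F(X 0) = S\<^sub>1(P) + 1/2 S\<^sub>2(P) + R(P)\<close>, where \<open>S\<^sub>1(P)\<close> and \<open>S\<^sub>2(P)\<close> are the
  sums whose limits define the two integrals and \<open>R(P)\<close> is the sum of the Taylor remainders.
  Three facts about small meshes prove the theorem.

  \<^item> \<open>R(P)\<close> tends to 0 in \<open>L\<^sup>1\<close> (\<open>remainder_small\<close>). By duality between \<open>L\<^sup>1\<close> and the operator
    norm, a remainder is estimated by the classical one of the real functions
    \<open>r \<mapsto> Re E(b F(x + r h))\<close> (\<open>taylor_L1\<close>). As second derivatives are bounded from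
    \<open>L\<^sup>2 \<times> L\<^sup>2\<close> to \<open>L\<^sup>1\<close> and vary continuously, it is a small multiple of the sum of the squared
    \<open>L\<^sup>2\<close> norms of the increments of \<open>X\<close>. That sum stays bounded, since the increments of a
    martingale are orthogonal.
  \<^item> \<open>S\<^sub>1(P)\<close> is Cauchy in \<open>L\<^sup>2\<close> (\<open>sum1_Cauchy\<close>). Two such sums are compared on the common
    refinement of their partitions, where they differ by small adapted coefficients. Their
    contribution is controlled by orthogonality on the martingale part of \<open>X\<close>
    (\<open>orthogonal_sum\<close>) and by the variation on the other part.
  \<^item> \<open>S\<^sub>2(P)\<close> is Cauchy in \<open>L\<^sup>1\<close> because every other term of the expansion is (\<open>sum2_Cauchy\<close>).

  Orthogonality rests on conditional expectations, which are given by a definite description,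
  so their existence has to be proved (\<open>cond_exp_is_proj\<close>). The conditional expectation of a
  self-adjoint \<open>a\<close> is its nearest point in the subalgebra for the \<open>L\<^sup>2\<close> norm. Truncating the
  spectrum of an element does not move it away from \<open>a\<close> (\<open>truncation_closer\<close>), so that a
  minimizing sequence may be taken in a ball of the subalgebra. Such balls are complete for the \<open>L\<^sup>2\<close> norm
  (\<open>ball_complete\<close>); this is where the normality of the trace enters, through a noncommutative
  Egorov theorem (\<open>egorov_weights\<close>).

  The \<open>L\<^sup>p\<close> norms are defined by functional calculus, which exists because
  \<open>\<parallel>P(T)\<parallel> \<le> sup \<bar>P\<bar>\<close> over the numerical range of a self-adjoint \<open>T\<close> (\<open>norm_op_poly_le\<close>). The triangle
  inequality of the \<open>L\<^sup>1\<close> norm comes from its duality with the operator norm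
  (\<open>tau_compose_le_n1\<close>, \<open>n1_attained\<close>).
\<close>

section \<open>Riesz representation and adjoints\<close>

lemma quadratic_nonneg_discriminant:
  fixes p q s :: real
  assumes pos: "\<And>r. 0 \<le> p + 2 * r * q + r\<^sup>2 * s" and s: "0 \<le> s"
  shows "q\<^sup>2 \<le> p * s"
proof (cases "s = 0")
  case True
  have "q = 0"
  proof (rule ccontr)
    assume "q \<noteq> 0"
    then show False
      using pos[of "- (p + 1) / (2 * q)"] True by (simp add: field_simps)
  qed
  then show ?thesis
    using True by simp
next
  case False
  with s have "s > 0"
    by simp
  then show ?thesis
    using pos[of "- q / s"] by (simp add: field_simps power2_eq_square)
qed

text \<open>
  The direct method of the calculus of variations: under a parallelogram inequality, a
  sequence along which \<open>q\<close> tends to its infimum is Cauchy for the squared distance \<open>d\<close>. Both the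
  Riesz representation and conditional expectations are obtained from it.
\<close>

lemma minimizing_sequence:
  fixes q :: "'a \<Rightarrow> real" and d :: "'a \<Rightarrow> 'a \<Rightarrow> real"
  assumes ne: "S \<noteq> {}" and bdd: "\<And>x. x \<in> S \<Longrightarrow> l \<le> q x"
    and par: "\<And>x y. x \<in> S \<Longrightarrow> y \<in> S \<Longrightarrow> \<exists>z\<in>S. d x y \<le> 2 * (q x + q y - 2 * q z)"
  obtains b :: "nat \<Rightarrow> 'a" and m where
    "\<And>n. b n \<in> S" "\<And>x. x \<in> S \<Longrightarrow> m \<le> q x" "(\<lambda>n. q (b n)) \<longlonglongrightarrow> m"
    "\<And>e. e > 0 \<Longrightarrow> \<exists>N. \<forall>i\<ge>N. \<forall>j\<ge>N. d (b i) (b j) < e"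
proof -
  define m where "m = (INF x\<in>S. q x)"
  have low: "m \<le> q x" if "x \<in> S" for x
    unfolding m_def using that by (intro cINF_lower bdd_belowI2[of _ l]) (auto intro: bdd)
  have "\<exists>x\<in>S. q x < m + 1 / Suc n" for n
  proof -
    have "m < m + 1 / Suc n"
      by simp
    then show ?thesis
      unfolding m_def using ne bdd by (subst (asm) cINF_less_iff) (auto intro!: bdd_belowI2[of _ l])
  qed
  then obtain b where b: "\<And>n. b n \<in> S" "\<And>n. q (b n) < m + 1 / real (Suc n)"
    by metis
  have lim: "(\<lambda>n. q (b n)) \<longlonglongrightarrow> m"
  proof (rule tendsto_sandwich[OF _ _ tendsto_const])
    show "(\<lambda>n. m + 1 / real (Suc n)) \<longlonglongrightarrow> m"
      using tendsto_add[OF tendsto_const[of m] LIMSEQ_inverse_real_of_nat] by (simp add: inverse_eq_divide)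
    show "\<forall>\<^sub>F n in sequentially. q (b n) \<le> m + 1 / real (Suc n)"
      using b(2) by (intro always_eventually allI less_imp_le)
  qed (use low b in auto)
  have "\<exists>N. \<forall>i\<ge>N. \<forall>j\<ge>N. d (b i) (b j) < e" if "e > 0" for e
  proof -
    obtain N where N: "\<And>n. n \<ge> N \<Longrightarrow> q (b n) < m + e / 4"
      using order_tendstoD(2)[OF lim, of "m + e / 4"] \<open>e > 0\<close> unfolding eventually_sequentially by auto
    have "d (b i) (b j) < e" if "i \<ge> N" "j \<ge> N" for i j
      using par[OF b(1) b(1), of i j] low N[OF that(1)] N[OF that(2)] by force
    then show ?thesis
      by blast
  qed
  then show thesis
    using b(1) low lim by (rule_tac that)
qed

lemma inner_eq_imp_eq: "u = v" if "\<And>x. inner x u = inner x v" for u v :: "'a::real_inner"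
proof -
  have "inner (u - v) (u - v) = 0"
    using that[of "u - v"] by (simp add: inner_diff_right)
  then show ?thesis
    by simp
qed

text \<open>
  The representing vector minimizes \<open>\<parallel>x\<parallel>\<^sup>2 - 2 f x\<close>; that the first variation vanishes there is
  the representation.
\<close>

lemma riesz_representation:
  fixes f :: "'a::{real_inner,complete_space} \<Rightarrow> real"
  assumes "bounded_linear f"
  obtains z where "\<And>x. f x = inner z x"
proof -
  interpret f: bounded_linear f by fact
  obtain K where K: "\<And>x. \<bar>f x\<bar> \<le> norm x * K"
    using f.nonneg_bounded by auto
  define q where "q x = (norm x)\<^sup>2 - 2 * f x" for x
  have low: "- (K\<^sup>2) \<le> q x" for x
  proof -
    have "0 \<le> (norm x - K)\<^sup>2"
      by simp
    then show ?thesis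
      using K[of x] by (auto simp: q_def power2_diff)
  qed
  have par: "\<exists>z\<in>UNIV. (norm (x - y))\<^sup>2 \<le> 2 * (q x + q y - 2 * q z)" for x y
  proof
    have "(norm (x - y))\<^sup>2 = 2 * (norm x)\<^sup>2 + 2 * (norm y)\<^sup>2 - (norm (x + y))\<^sup>2"
      unfolding power2_norm_eq_inner by (simp add: inner_simps inner_commute)
    moreover have "(norm ((1/2) *\<^sub>R (x + y)))\<^sup>2 = (norm (x + y))\<^sup>2 / 4"
      by (simp add: power_divide)
    ultimately have "(norm (x - y))\<^sup>2 = 2 * (norm x)\<^sup>2 + 2 * (norm y)\<^sup>2 - 4 * (norm ((1/2) *\<^sub>R (x + y)))\<^sup>2"
      by simp
    then show "(norm (x - y))\<^sup>2 \<le> 2 * (q x + q y - 2 * q ((1/2) *\<^sub>R (x + y)))"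
      by (simp add: q_def f.scaleR f.add field_simps)
  qed simp
  obtain b :: "nat \<Rightarrow> 'a" and m where "\<And>n. b n \<in> UNIV"
    and b: "\<And>x. x \<in> UNIV \<Longrightarrow> m \<le> q x" "(\<lambda>n. q (b n)) \<longlonglongrightarrow> m"
      "\<And>e. e > 0 \<Longrightarrow> \<exists>N. \<forall>i\<ge>N. \<forall>j\<ge>N. (norm (b i - b j))\<^sup>2 < e"
    by (rule minimizing_sequence[OF UNIV_not_empty low par]) (rule that)
  have "Cauchy b"
  proof (rule CauchyI)
    fix e :: real assume "e > 0"
    then obtain N where "\<forall>i\<ge>N. \<forall>j\<ge>N. (norm (b i - b j))\<^sup>2 < e\<^sup>2"
      using b(3)[of "e\<^sup>2"] by auto
    then show "\<exists>N. \<forall>i\<ge>N. \<forall>j\<ge>N. norm (b i - b j) < e"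
      using \<open>e > 0\<close> by (meson less_imp_le power2_less_imp_less)
  qed
  then obtain z where z: "b \<longlonglongrightarrow> z"
    using Cauchy_convergent_iff convergent_def by blast
  have "(\<lambda>n. q (b n)) \<longlonglongrightarrow> q z"
    unfolding q_def by (intro tendsto_intros f.tendsto z)
  then have qz: "q z = m"
    using b(2) LIMSEQ_unique by blast
  have "f x = inner z x" for x
  proof -
    have "0 \<le> 0 + 2 * r * (inner z x - f x) + r\<^sup>2 * (norm x)\<^sup>2" for r
    proof -
      have "q (z + r *\<^sub>R x) = q z + 2 * r * (inner z x - f x) + r\<^sup>2 * (norm x)\<^sup>2"
        unfolding q_def power2_norm_eq_inner
        by (simp add: f.add f.scaleR inner_simps inner_commute power2_eq_square algebra_simps)
      then show ?thesis
        using b(1)[of "z + r *\<^sub>R x"] qz by simp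
    qed
    then have "(inner z x - f x)\<^sup>2 \<le> 0 * (norm x)\<^sup>2"
      by (rule quadratic_nonneg_discriminant) auto
    then show ?thesis
      by simp
  qed
  then show thesis
    by (rule that)
qed

lemma Im_cinner: "Im (cinner x y) = - inner x (\<i> *\<^sub>C y)"
proof -
  have "inner x (\<i> *\<^sub>C y) = Re (\<i> * cinner x y)"
    by (simp only: Re_cinner[symmetric] cinner_scaleC_right)
  then show ?thesis
    by simp
qed

lemma inner_ii_skew: "inner (\<i> *\<^sub>C x) y = - inner x (\<i> *\<^sub>C y)"
proof -
  have "inner (\<i> *\<^sub>C x) y = - Im (cinner y x)"
    by (simp add: Im_cinner inner_commute)
  also have "\<dots> = Im (cinner x y)"
    by (subst cinner_commute) simp
  finally show ?thesis
    by (simp add: Im_cinner)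
qed

lemma scaleC_eq: "c *\<^sub>C x = Re c *\<^sub>R x + Im c *\<^sub>R (\<i> *\<^sub>C x)"
proof -
  have "c *\<^sub>C x = (complex_of_real (Re c) + complex_of_real (Im c) * \<i>) *\<^sub>C x"
    using complex_eq[of c] by (simp add: mult.commute)
  also have "\<dots> = Re c *\<^sub>R x + Im c *\<^sub>R (\<i> *\<^sub>C x)"
    by (simp add: scaleC_add_left scaleC_of_real scaleC_scaleC[symmetric])
  finally show ?thesis .
qed

lemma scaleC_ii_ii [simp]: "\<i> *\<^sub>C \<i> *\<^sub>C x = - (x::'a::complex_hilbert)"
proof -
  have "\<i> *\<^sub>C \<i> *\<^sub>C x = complex_of_real (-1) *\<^sub>C x"
    by (simp add: scaleC_scaleC)
  then show ?thesis
    by (simp only: scaleC_of_real) simp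
qed

lemma bounded_ops_iff: "T \<in> bounded_ops \<longleftrightarrow> (\<forall>x. T (\<i> *\<^sub>C x) = \<i> *\<^sub>C T x)"
proof
  assume *: "\<forall>x. T (\<i> *\<^sub>C x) = \<i> *\<^sub>C T x"
  show "T \<in> bounded_ops"
    unfolding bounded_ops_def mem_Collect_eq
  proof (intro allI)
    fix c x
    show "T (c *\<^sub>C x) = c *\<^sub>C T x"
      by (subst (1 2) scaleC_eq) (simp add: * blinfun.bilinear_simps)
  qed
qed (simp add: bounded_ops_def)

lemma scale_op_apply [simp]: "scale_op c T x = c *\<^sub>C T x"
  by transfer simp

lemma scale_op_of_real: "scale_op (complex_of_real r) T = r *\<^sub>R T"
  by (rule blinfun_eqI) (simp add: blinfun.bilinear_simps scaleC_of_real)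

lemma scaleC_ii_add: "\<i> *\<^sub>C (x + y) = \<i> *\<^sub>C x + \<i> *\<^sub>C (y::'a::complex_hilbert)"
  by (rule scaleC_add_right)

lemma scaleC_ii_scaleR: "\<i> *\<^sub>C (r *\<^sub>R x) = r *\<^sub>R (\<i> *\<^sub>C (x::'a::complex_hilbert))"
  by (simp add: scaleC_of_real[symmetric] scaleC_scaleC mult.commute)

lemma scaleC_ii_uminus: "\<i> *\<^sub>C (- x) = - (\<i> *\<^sub>C (x::'a::complex_hilbert))"
  using scaleC_ii_scaleR[of "-1" x] by simp

lemma scaleC_ii_diff: "\<i> *\<^sub>C (x - y) = \<i> *\<^sub>C x - \<i> *\<^sub>C (y::'a::complex_hilbert)"
  using scaleC_ii_add[of x "- y"] by (simp add: scaleC_ii_uminus)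

lemmas ii_simps = scaleC_ii_add scaleC_ii_scaleR scaleC_ii_uminus scaleC_ii_diff

lemma bounded_linear_ii: "bounded_linear (\<lambda>x::'a::complex_hilbert. \<i> *\<^sub>C x)"
  by (rule bounded_linear_intro[where K = 1]) (auto simp: ii_simps norm_scaleC)

lemmas tendsto_ii = bounded_linear.tendsto[OF bounded_linear_ii]

lemma bounded_ops_closed:
  "S \<in> bounded_ops \<Longrightarrow> T \<in> bounded_ops \<Longrightarrow> S + T \<in> bounded_ops"
  "S \<in> bounded_ops \<Longrightarrow> T \<in> bounded_ops \<Longrightarrow> S - T \<in> bounded_ops"
  "S \<in> bounded_ops \<Longrightarrow> T \<in> bounded_ops \<Longrightarrow> S o\<^sub>L T \<in> bounded_ops"
  "S \<in> bounded_ops \<Longrightarrow> - S \<in> bounded_ops"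
  "S \<in> bounded_ops \<Longrightarrow> r *\<^sub>R S \<in> bounded_ops"
  "S \<in> bounded_ops \<Longrightarrow> scale_op c S \<in> bounded_ops"
  unfolding bounded_ops_iff
  by (auto simp: blinfun.bilinear_simps ii_simps scaleC_scaleC mult.commute)

lemma id_0_bounded_ops [simp]: "id_blinfun \<in> bounded_ops" "0 \<in> bounded_ops"
  using scaleC_ii_scaleR[of 0] by (auto simp: bounded_ops_iff)

text \<open>
  Real Riesz representation gives the adjoint for the real inner product. It commutes with the
  skew map \<open>x \<mapsto> \<i> x\<close>, and hence is also the adjoint for the complex inner product, whose
  imaginary part is \<open>- \<langle>x, \<i> y\<rangle>\<close>.
\<close>

lemma adj_exists:
  assumes T: "T \<in> bounded_ops"
  obtains S where "\<And>x y. cinner (T x) y = cinner x (blinfun_apply S y)" "\<And>x y. inner (T x) y = inner x (blinfun_apply S y)"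
proof -
  have "\<exists>z. \<forall>x. inner (T x) y = inner z x" for y
    by (rule riesz_representation[of "\<lambda>x. inner (T x) y"])
       (auto intro: bounded_linear_compose[OF bounded_linear_inner_left blinfun.bounded_linear_right])
  then obtain S where S: "\<And>x y. inner (T x) y = inner (S y) x"
    by metis
  have eq: "u = v" if "\<And>x. inner u x = inner v x" for u v :: 'a
    using that by (rule_tac inner_eq_imp_eq) (simp add: inner_commute)
  have bl: "bounded_linear S"
  proof (rule bounded_linear_intro[where K = "norm T"])
    show "S (x + y) = S x + S y" for x y
      by (rule eq) (simp add: S[symmetric] inner_simps)
    show "S (r *\<^sub>R x) = r *\<^sub>R S x" for r x
      by (rule eq) (simp add: S[symmetric] inner_simps)
    show "norm (S x) \<le> norm x * norm T" for x
    proof -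
      have "norm (S x) * norm (S x) = inner (T (S x)) x"
        by (simp add: S power2_norm_eq_inner[symmetric] power2_eq_square)
      also have "\<dots> \<le> norm (T (S x)) * norm x"
        by (rule norm_cauchy_schwarz)
      also have "\<dots> \<le> (norm T * norm (S x)) * norm x"
        by (intro mult_right_mono norm_blinfun) auto
      finally have "norm (S x) * norm (S x) \<le> norm (S x) * (norm x * norm T)"
        by (simp add: mult_ac)
      then show ?thesis
        by (cases "norm (S x) = 0") (auto simp: mult_le_cancel_left)
    qed
  qed
  have S': "inner (T x) y = inner x (Blinfun S y)" for x y
    using S[of x y] by (simp add: bounded_linear_Blinfun_apply[OF bl] inner_commute)
  have Si: "S (\<i> *\<^sub>C y) = \<i> *\<^sub>C S y" for y
  proof (rule eq)
    fix x
    have "inner (S (\<i> *\<^sub>C y)) x = inner (T x) (\<i> *\<^sub>C y)"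
      by (simp add: S)
    also have "\<dots> = - inner (T (\<i> *\<^sub>C x)) y"
      using T by (simp add: bounded_ops_iff inner_ii_skew)
    also have "\<dots> = inner (\<i> *\<^sub>C S y) x"
      by (simp add: S inner_ii_skew)
    finally show "inner (S (\<i> *\<^sub>C y)) x = inner (\<i> *\<^sub>C S y) x" .
  qed
  have "cinner (T x) y = cinner x (Blinfun S y)" for x y
  proof (rule complex_eqI)
    show "Re (cinner (T x) y) = Re (cinner x (Blinfun S y))"
      by (simp add: Re_cinner S')
    show "Im (cinner (T x) y) = Im (cinner x (Blinfun S y))"
      by (simp add: Im_cinner S' bounded_linear_Blinfun_apply[OF bl] Si)
  qed
  then show thesis
    using S' that by blast
qed

lemma adj_inner:
  assumes T: "T \<in> bounded_ops"
  shows "inner (T x) y = inner x (adj T y)"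
proof -
  obtain S where S: "\<And>x y. cinner (T x) y = cinner x (blinfun_apply S y)" "\<And>x y. inner (T x) y = inner x (blinfun_apply S y)"
    using adj_exists[OF T] by blast
  have "adj T = S"
    unfolding adj_def
  proof (rule the_equality)
    fix S' assume S': "\<forall>x y. cinner (T x) y = cinner x (blinfun_apply S' y)"
    show "S' = S"
    proof (rule blinfun_eqI)
      fix y
      show "S' y = S y"
      proof (rule inner_eq_imp_eq)
        show "inner x (S' y) = inner x (S y)" for x
          using S'[rule_format, of x y] S(1)[of x y] by (simp add: Re_cinner[symmetric])
      qed
    qed
  qed (use S in blast)
  then show ?thesis
    using S(2) by simp
qed

lemma adj_inner': "T \<in> bounded_ops \<Longrightarrow> inner (adj T x) y = inner x (T y)"
  by (metis adj_inner inner_commute)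

lemma blinfun_eq_inner: "(\<And>x y. inner x (blinfun_apply S y) = inner x (blinfun_apply T y)) \<Longrightarrow> S = T"
  by (rule blinfun_eqI, rule inner_eq_imp_eq)

lemma adj_unique:
  assumes "T \<in> bounded_ops" "\<And>x y. inner (T x) y = inner x (blinfun_apply S y)"
  shows "adj T = S"
  by (rule blinfun_eq_inner) (metis adj_inner assms)

lemma adj_bounded_ops [simp]:
  assumes T: "T \<in> bounded_ops"
  shows "adj T \<in> bounded_ops"
  unfolding bounded_ops_iff
proof
  fix y
  show "adj T (\<i> *\<^sub>C y) = \<i> *\<^sub>C adj T y"
  proof (rule inner_eq_imp_eq)
    fix x
    have "inner x (adj T (\<i> *\<^sub>C y)) = - inner (T (\<i> *\<^sub>C x)) y"
      using T by (simp add: adj_inner[OF T, symmetric] bounded_ops_iff inner_ii_skew)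
    also have "\<dots> = inner x (\<i> *\<^sub>C adj T y)"
      by (simp add: adj_inner[OF T] inner_ii_skew)
    finally show "inner x (adj T (\<i> *\<^sub>C y)) = inner x (\<i> *\<^sub>C adj T y)" .
  qed
qed

lemma adj_adj [simp]: "T \<in> bounded_ops \<Longrightarrow> adj (adj T) = T"
  by (rule adj_unique) (auto simp: adj_inner')

lemma adj_simps:
  "S \<in> bounded_ops \<Longrightarrow> T \<in> bounded_ops \<Longrightarrow> adj (S + T) = adj S + adj T"
  "S \<in> bounded_ops \<Longrightarrow> T \<in> bounded_ops \<Longrightarrow> adj (S - T) = adj S - adj T"
  "S \<in> bounded_ops \<Longrightarrow> T \<in> bounded_ops \<Longrightarrow> adj (S o\<^sub>L T) = adj T o\<^sub>L adj S"
  "S \<in> bounded_ops \<Longrightarrow> adj (- S) = - adj S"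
  "S \<in> bounded_ops \<Longrightarrow> adj (r *\<^sub>R S) = r *\<^sub>R adj S"
  by (auto intro!: adj_unique simp: bounded_ops_closed blinfun.bilinear_simps inner_simps adj_inner)

lemma adj_scale_ii:
  assumes S: "S \<in> bounded_ops"
  shows "adj (scale_op \<i> S) = - scale_op \<i> (adj S)"
proof (rule adj_unique)
  fix x y
  have "inner (S x) (\<i> *\<^sub>C y) = inner x (\<i> *\<^sub>C adj S y)"
    using adj_bounded_ops[OF S] by (simp add: adj_inner[OF S] bounded_ops_iff)
  then show "inner (scale_op \<i> S x) y = inner x ((- scale_op \<i> (adj S)) y)"
    by (simp add: inner_ii_skew blinfun.bilinear_simps)
qed (simp add: bounded_ops_closed S)

lemma adj_id_0 [simp]: "adj id_blinfun = id_blinfun" "adj 0 = 0"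
  by (auto intro!: adj_unique)

lemma norm_adj_le: "T \<in> bounded_ops \<Longrightarrow> norm (adj T) \<le> norm T"
proof (rule norm_blinfun_bound)
  fix x assume T: "T \<in> bounded_ops"
  have "norm (adj T x) * norm (adj T x) = inner (T (adj T x)) x"
    by (simp add: adj_inner[OF T] power2_norm_eq_inner[symmetric] power2_eq_square)
  also have "\<dots> \<le> norm (T (adj T x)) * norm x"
    by (rule norm_cauchy_schwarz)
  also have "\<dots> \<le> (norm T * norm (adj T x)) * norm x"
    by (intro mult_right_mono norm_blinfun) auto
  finally have "norm (adj T x) * norm (adj T x) \<le> norm (adj T x) * (norm T * norm x)"
    by (simp add: mult_ac)
  then show "norm (adj T x) \<le> norm T * norm x"
    by (cases "norm (adj T x) = 0") (auto simp: mult_le_cancel_left)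
qed simp

lemma norm_adj [simp]: "T \<in> bounded_ops \<Longrightarrow> norm (adj T) = norm T"
  using norm_adj_le[of T] norm_adj_le[of "adj T"] by simp

section \<open>Self-adjoint and positive operators\<close>

abbreviation hermitian :: "'h::complex_hilbert operator \<Rightarrow> bool" where
  "hermitian T \<equiv> T \<in> self_adjoints bounded_ops"

lemma hermitian_iff: "hermitian T \<longleftrightarrow> T \<in> bounded_ops \<and> (\<forall>x y. inner (T x) y = inner x (T y))"
  unfolding self_adjoints_def by (auto simp: adj_inner intro: adj_unique)

lemma hermitian_closed:
  "hermitian S \<Longrightarrow> hermitian T \<Longrightarrow> hermitian (S + T)"
  "hermitian S \<Longrightarrow> hermitian T \<Longrightarrow> hermitian (S - T)"
  "hermitian S \<Longrightarrow> hermitian (- S)"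
  "hermitian S \<Longrightarrow> hermitian (r *\<^sub>R S)"
  by (auto simp: self_adjoints_def adj_simps bounded_ops_closed)

lemma hermitian_id_0 [simp]: "hermitian id_blinfun" "hermitian 0"
  by (auto simp: self_adjoints_def)

text \<open>
  That \<open>\<langle>x, T x\<rangle>\<close> is real for all \<open>x\<close> says that the real form \<open>\<langle>x, \<i> T y\<rangle>\<close> is alternating, which by
  polarization makes \<open>T\<close> self-adjoint.
\<close>

lemma op_nonneg_iff: "op_nonneg T \<longleftrightarrow> hermitian T \<and> (\<forall>x. 0 \<le> inner x (T x))"
proof -
  have *: "cinner x (T x) \<in> \<real>\<^sub>\<ge>\<^sub>0 \<longleftrightarrow> 0 \<le> inner x (T x) \<and> inner x (\<i> *\<^sub>C T x) = 0" for x
    by (simp add: complex_nonneg_Reals_iff Re_cinner Im_cinner)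
  show ?thesis
  proof (intro iffI conjI allI)
    assume T: "op_nonneg T"
    then have b: "T \<in> bounded_ops" and z: "\<And>x. inner x (\<i> *\<^sub>C T x) = 0"
      using * by (auto simp: op_nonneg_def)
    show "0 \<le> inner x (T x)" for x
      using T * by (auto simp: op_nonneg_def)
    have "inner (T x) y = inner x (T y)" for x y
    proof -
      define w where "w = - (\<i> *\<^sub>C y)"
      have y: "y = \<i> *\<^sub>C w"
        by (simp add: w_def ii_simps)
      have "inner x (\<i> *\<^sub>C T w) + inner w (\<i> *\<^sub>C T x) = 0"
        using z[of "x + w"] z[of x] z[of w] by (simp add: blinfun.bilinear_simps ii_simps inner_simps)
      then show ?thesis
        using b inner_ii_skew[of w "T x"] unfolding y by (simp add: bounded_ops_iff inner_commute)
    qed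
    then show "hermitian T"
      using b by (simp add: hermitian_iff)
  next
    assume T: "hermitian T \<and> (\<forall>x. 0 \<le> inner x (T x))"
    have "inner x (\<i> *\<^sub>C T x) = 0" for x
    proof -
      have "inner x (\<i> *\<^sub>C T x) = inner x (T (\<i> *\<^sub>C x))"
        using T by (simp add: hermitian_iff bounded_ops_iff)
      also have "\<dots> = inner (T x) (\<i> *\<^sub>C x)"
        using T by (simp add: hermitian_iff)
      also have "\<dots> = - inner x (\<i> *\<^sub>C T x)"
        using inner_ii_skew[of "T x" x] inner_commute[of x] by (metis add.inverse_inverse inner_commute)
      finally show ?thesis
        by simp
    qed
    then show "op_nonneg T"
      using T * by (auto simp: op_nonneg_def hermitian_iff)
  qed
qed

lemma op_nonneg_hermitian: "op_nonneg T \<Longrightarrow> hermitian T" and op_nonneg_inner: "op_nonneg T \<Longrightarrow> 0 \<le> inner x (T x)"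
  by (auto simp: op_nonneg_iff)

lemma op_nonneg_add: "op_nonneg S \<Longrightarrow> op_nonneg T \<Longrightarrow> op_nonneg (S + T)"
  by (auto simp: op_nonneg_iff hermitian_closed blinfun.bilinear_simps inner_simps)

lemma op_nonneg_scaleR: "op_nonneg S \<Longrightarrow> 0 \<le> r \<Longrightarrow> op_nonneg (r *\<^sub>R S)"
  by (auto simp: op_nonneg_iff hermitian_closed blinfun.bilinear_simps inner_simps)

lemma op_nonneg_0 [simp]: "op_nonneg 0"
  by (auto simp: op_nonneg_iff)

lemma op_nonneg_adj_sandwich:
  assumes T: "op_nonneg T" and b: "b \<in> bounded_ops"
  shows "op_nonneg (adj b o\<^sub>L T o\<^sub>L b)"
  using T b by (auto simp: op_nonneg_iff hermitian_iff bounded_ops_closed adj_inner[symmetric] adj_inner')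

lemma hermitian_adj_self: "b \<in> bounded_ops \<Longrightarrow> hermitian (adj b o\<^sub>L b)"
  by (auto simp: self_adjoints_def bounded_ops_closed adj_simps)

lemma op_nonneg_adj_self: "b \<in> bounded_ops \<Longrightarrow> op_nonneg (adj b o\<^sub>L b)"
  by (auto simp: op_nonneg_iff hermitian_adj_self adj_inner[symmetric])

lemma op_nonneg_square: "hermitian b \<Longrightarrow> op_nonneg (b o\<^sub>L b)"
  using op_nonneg_adj_self[of b] by (auto simp: self_adjoints_def)

lemma op_nonneg_cauchy_schwarz:
  assumes T: "op_nonneg T"
  shows "(inner x (T y))\<^sup>2 \<le> inner x (T x) * inner y (T y)"
proof (rule quadratic_nonneg_discriminant)
  have s: "inner y (T x) = inner x (T y)"
    using op_nonneg_hermitian[OF T] by (metis hermitian_iff inner_commute)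
  show "0 \<le> inner x (T x) + 2 * r * inner x (T y) + r\<^sup>2 * inner y (T y)" for r
    using op_nonneg_inner[OF T, of "x + r *\<^sub>R y"]
    by (simp add: blinfun.bilinear_simps inner_simps s power2_eq_square algebra_simps)
qed (rule op_nonneg_inner[OF T])

lemma op_nonneg_norm_sq_le:
  assumes T: "op_nonneg T"
  shows "(norm (T x))\<^sup>2 \<le> norm T * inner x (T x)"
proof -
  let ?n = "(norm (T x))\<^sup>2"
  have "(inner x (T (T x)))\<^sup>2 \<le> inner x (T x) * inner (T x) (T (T x))"
    by (rule op_nonneg_cauchy_schwarz[OF T])
  moreover have "inner x (T (T x)) = ?n"
    using op_nonneg_hermitian[OF T] by (metis hermitian_iff power2_norm_eq_inner)
  moreover have "inner (T x) (T (T x)) \<le> norm T * ?n"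
  proof -
    have "inner (T x) (T (T x)) \<le> norm (T x) * (norm T * norm (T x))"
      by (rule order_trans[OF norm_cauchy_schwarz mult_left_mono[OF norm_blinfun]]) simp
    then show ?thesis
      by (simp add: power2_eq_square mult_ac)
  qed
  ultimately have "?n * ?n \<le> inner x (T x) * (norm T * ?n)"
    using op_nonneg_inner[OF T, of x] by (smt (verit) mult_left_mono power2_eq_square)
  then have le: "?n * ?n \<le> (norm T * inner x (T x)) * ?n"
    by (simp only: mult_ac)
  show ?thesis
  proof (cases "?n = 0")
    case False
    then show ?thesis
      by (intro mult_right_le_imp_le[OF le]) simp
  qed (use op_nonneg_inner[OF T, of x] in simp)
qed

lemma hermitian_norm_le:
  assumes T: "hermitian T" and c: "\<And>x. \<bar>inner x (T x)\<bar> \<le> c * (norm x)\<^sup>2" and c0: "0 \<le> c"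
  shows "norm T \<le> c"
proof (rule norm_blinfun_bound[OF c0])
  fix x
  show "norm (T x) \<le> c * norm x"
  proof (cases "x = 0 \<or> T x = 0")
    case True
    then show ?thesis
      using c0 by auto
  next
    case False
    \<comment> \<open>Rescaling makes the two vectors that are polarized equally long.\<close>
    define y where "y = (norm x / norm (T x)) *\<^sub>R T x"
    have ny: "norm y = norm x"
      using False by (simp add: y_def)
    have "4 * inner y (T x) = inner (x + y) (T (x + y)) - inner (x - y) (T (x - y))"
      using T by (simp add: hermitian_iff blinfun.bilinear_simps inner_simps) (metis inner_commute)
    also have "\<dots> \<le> c * (norm (x + y))\<^sup>2 + c * (norm (x - y))\<^sup>2"
      using c[of "x + y"] c[of "x - y"] by linarith
    also have "\<dots> = c * (2 * (norm x)\<^sup>2 + 2 * (norm y)\<^sup>2)"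
      unfolding power2_norm_eq_inner by (simp add: inner_simps inner_commute algebra_simps)
    finally have "inner y (T x) \<le> c * (norm x)\<^sup>2"
      by (simp add: ny)
    moreover have "inner y (T x) = norm x * norm (T x)"
      using False by (simp add: y_def power2_norm_eq_inner[symmetric] power2_eq_square)
    ultimately show ?thesis
      using False by (simp add: power2_eq_square)
  qed
qed

lemma abs_inner_blinfun_le: "\<bar>inner x (blinfun_apply T x)\<bar> \<le> norm T * (norm x)\<^sup>2"
proof -
  have "\<bar>inner x (T x)\<bar> \<le> norm x * norm (T x)"
    by (rule Cauchy_Schwarz_ineq2)
  also have "\<dots> \<le> norm x * (norm T * norm x)"
    by (intro mult_left_mono norm_blinfun) auto
  finally show ?thesis
    by (simp add: power2_eq_square mult_ac)
qed

lemma op_nonneg_norm_minus: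
  assumes "hermitian T" "norm T \<le> c"
  shows "op_nonneg (c *\<^sub>R id_blinfun - T)" "op_nonneg (c *\<^sub>R id_blinfun + T)"
proof -
  have "\<bar>inner x (T x)\<bar> \<le> c * inner x x" for x
    using abs_inner_blinfun_le[of x T] mult_right_mono[OF assms(2), of "(norm x)\<^sup>2"]
    by (simp add: power2_norm_eq_inner)
  from abs_le_D1[OF this] abs_le_D2[OF this]
  show "op_nonneg (c *\<^sub>R id_blinfun - T)" "op_nonneg (c *\<^sub>R id_blinfun + T)"
    using assms(1) by (auto simp: op_nonneg_iff hermitian_closed blinfun.bilinear_simps inner_simps) (smt (verit))
qed

lemma norm_adj_self:
  assumes b: "b \<in> bounded_ops"
  shows "norm (adj b o\<^sub>L b) = (norm b)\<^sup>2"
proof (rule antisym)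
  show "norm (adj b o\<^sub>L b) \<le> (norm b)\<^sup>2"
    using norm_blinfun_compose[of "adj b" b] b by (simp add: power2_eq_square)
  have "norm b \<le> sqrt (norm (adj b o\<^sub>L b))"
  proof (rule norm_blinfun_bound)
    fix x
    have "(norm (b x))\<^sup>2 = \<bar>inner x ((adj b o\<^sub>L b) x)\<bar>"
      using b by (simp add: adj_inner[symmetric] power2_norm_eq_inner)
    also have "\<dots> \<le> norm (adj b o\<^sub>L b) * (norm x)\<^sup>2"
      by (rule abs_inner_blinfun_le)
    finally show "norm (b x) \<le> sqrt (norm (adj b o\<^sub>L b)) * norm x"
      by (metis real_le_rsqrt real_sqrt_abs real_sqrt_mult abs_norm_cancel)
  qed simp
  then show "(norm b)\<^sup>2 \<le> norm (adj b o\<^sub>L b)"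
    by (metis norm_ge_zero power_mono real_sqrt_pow2)
qed

section \<open>Continuous functional calculus\<close>

instance complex_hilbert \<subseteq> banach ..

lemmas compose_simps =
  bounded_bilinear.add_left[OF bounded_bilinear_blinfun_compose]
  bounded_bilinear.add_right[OF bounded_bilinear_blinfun_compose]
  bounded_bilinear.diff_left[OF bounded_bilinear_blinfun_compose]
  bounded_bilinear.diff_right[OF bounded_bilinear_blinfun_compose]
  bounded_bilinear.minus_left[OF bounded_bilinear_blinfun_compose]
  bounded_bilinear.minus_right[OF bounded_bilinear_blinfun_compose]
  bounded_bilinear.scaleR_left[OF bounded_bilinear_blinfun_compose]
  bounded_bilinear.scaleR_right[OF bounded_bilinear_blinfun_compose]
  bounded_bilinear.zero_left[OF bounded_bilinear_blinfun_compose]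
  bounded_bilinear.zero_right[OF bounded_bilinear_blinfun_compose]

lemma compose_assoc: "(a o\<^sub>L b) o\<^sub>L c = a o\<^sub>L (b o\<^sub>L c)"
  by (rule blinfun_eqI) simp

lemma compose_id [simp]: "a o\<^sub>L id_blinfun = a" "id_blinfun o\<^sub>L a = a"
  by (auto intro: blinfun_eqI)

lemma scale_op_compose: "scale_op c a o\<^sub>L b = scale_op c (a o\<^sub>L b)"
  "a \<in> bounded_ops \<Longrightarrow> a o\<^sub>L scale_op c b = scale_op c (a o\<^sub>L b)"
  by (auto intro!: blinfun_eqI simp: bounded_ops_def)

lemma op_power_simps: "op_power T 0 = id_blinfun" "op_power T (Suc n) = T o\<^sub>L op_power T n"
  by (auto simp: op_power_def)

lemma op_poly_eq: "degree P \<le> n \<Longrightarrow> op_poly P T = (\<Sum>i\<le>n. coeff P i *\<^sub>R op_power T i)"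
  unfolding op_poly_def by (rule sum.mono_neutral_left) (auto simp: coeff_eq_0)

lemma op_poly_0 [simp]: "op_poly 0 T = 0"
  by (simp add: op_poly_def)

lemma op_poly_pCons: "op_poly (pCons a P) T = a *\<^sub>R id_blinfun + (T o\<^sub>L op_poly P T)"
proof -
  have "op_poly (pCons a P) T = (\<Sum>i\<le>Suc (degree P). coeff (pCons a P) i *\<^sub>R op_power T i)"
    by (rule op_poly_eq) (rule degree_pCons_le)
  also have "\<dots> = a *\<^sub>R id_blinfun + (\<Sum>i\<le>degree P. coeff P i *\<^sub>R (T o\<^sub>L op_power T i))"
    by (subst sum.atMost_Suc_shift) (simp add: op_power_simps)
  finally show ?thesis
    by (simp add: op_poly_def bounded_bilinear.sum_right[OF bounded_bilinear_blinfun_compose] compose_simps)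
qed

lemma op_poly_add: "op_poly (P + Q) T = op_poly P T + op_poly Q T"
proof -
  let ?n = "max (degree P) (degree Q)"
  show ?thesis
    using op_poly_eq[of P ?n T] op_poly_eq[of Q ?n T] op_poly_eq[of "P + Q" ?n T]
    by (simp add: degree_add_le sum.distrib scaleR_left.add)
qed

lemma op_poly_smult: "op_poly (smult c P) T = c *\<^sub>R op_poly P T"
  by (induction P) (auto simp: op_poly_pCons compose_simps scaleR_add_right)

lemma op_poly_diff: "op_poly (P - Q) T = op_poly P T - op_poly Q T"
  using op_poly_add[of P "smult (-1) Q" T] op_poly_smult[of "-1" Q T] by simp

lemma op_poly_mult: "op_poly (P * Q) T = op_poly P T o\<^sub>L op_poly Q T"
  by (induction P) (auto simp: op_poly_pCons op_poly_add op_poly_smult compose_simps compose_assoc)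

lemma op_poly_commute: "S o\<^sub>L T = T o\<^sub>L S \<Longrightarrow> S o\<^sub>L op_poly P T = op_poly P T o\<^sub>L S"
proof (induction P)
  case (pCons a P)
  then have "S o\<^sub>L (T o\<^sub>L op_poly P T) = (T o\<^sub>L op_poly P T) o\<^sub>L S"
    by (metis compose_assoc)
  then show ?case
    by (simp add: op_poly_pCons compose_simps)
qed (simp add: compose_simps)

lemma hermitian_compose:
  "hermitian S \<Longrightarrow> hermitian T \<Longrightarrow> S o\<^sub>L T = T o\<^sub>L S \<Longrightarrow> hermitian (S o\<^sub>L T)"
  by (auto simp: self_adjoints_def bounded_ops_closed adj_simps)

lemma hermitian_op_poly: "hermitian T \<Longrightarrow> hermitian (op_poly P T)"
  by (induction P) (auto simp: op_poly_pCons op_poly_commute intro!: hermitian_closed hermitian_compose)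

definition num_range_in :: "real \<Rightarrow> real \<Rightarrow> 'h::complex_hilbert operator \<Rightarrow> bool" where
  "num_range_in m M T \<longleftrightarrow> hermitian T \<and>
     (\<forall>x. m * (norm x)\<^sup>2 \<le> inner x (T x) \<and> inner x (T x) \<le> M * (norm x)\<^sup>2)"

lemma num_range_norm: "hermitian T \<Longrightarrow> num_range_in (- norm T) (norm T) T"
  unfolding num_range_in_def using abs_inner_blinfun_le[of _ T] by (auto simp: abs_le_iff minus_le_iff)

lemma poly_of_real_pCons:
  "poly (map_poly complex_of_real (pCons a p)) z = complex_of_real a + z * poly (map_poly complex_of_real p) z"
  by (simp add: map_poly_pCons)

lemma poly_of_real_add: "poly (map_poly complex_of_real (p + q)) z =
    poly (map_poly complex_of_real p) z + poly (map_poly complex_of_real q) z"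
  by (induction p q rule: poly_induct2) (auto simp: poly_of_real_pCons algebra_simps)

lemma poly_of_real_smult: "poly (map_poly complex_of_real (smult c p)) z =
    complex_of_real c * poly (map_poly complex_of_real p) z"
  by (induction p) (auto simp: poly_of_real_pCons algebra_simps)

lemma poly_of_real_mult: "poly (map_poly complex_of_real (p * q)) z =
    poly (map_poly complex_of_real p) z * poly (map_poly complex_of_real q) z"
  by (induction p) (auto simp: poly_of_real_pCons poly_of_real_add poly_of_real_smult algebra_simps)

lemma poly_of_real_of_real: "poly (map_poly complex_of_real p) (complex_of_real r) = complex_of_real (poly p r)"
  by (induction p) (auto simp: poly_of_real_pCons)

lemma real_poly_factor:
  fixes Q :: "real poly"
  assumes "degree Q > 0"
  obtains r where "[:- r, 1:] dvd Q" | a b where "b \<noteq> 0" "[:a\<^sup>2 + b\<^sup>2, - 2 * a, 1:] dvd Q"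
proof -
  have "degree (map_poly complex_of_real Q) = degree Q"
    by (rule degree_map_poly) simp
  then obtain z where z: "poly (map_poly complex_of_real Q) z = 0"
    using fundamental_theorem_of_algebra[of "map_poly complex_of_real Q"] assms by (auto simp: constant_degree)
  show thesis
  proof (cases "Im z = 0")
    case True
    then have "complex_of_real (Re z) = z"
      by (simp add: complex_eq_iff)
    then have "poly Q (Re z) = 0"
      using z poly_of_real_of_real[of Q "Re z"] by simp
    then show thesis
      using that(1) poly_eq_0_iff_dvd by blast
  next
    case False
    define D where "D = [:(Re z)\<^sup>2 + (Im z)\<^sup>2, - 2 * Re z, 1:]"
    have Dz: "poly (map_poly complex_of_real D) z = 0"
      by (simp add: D_def poly_of_real_pCons complex_eq_iff power2_eq_square algebra_simps)
    have "degree (Q mod D) < degree D \<or> Q mod D = 0"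
      using degree_mod_less[of D Q] by (auto simp: D_def)
    then have deg: "degree (Q mod D) \<le> 1"
      by (auto simp: D_def)
    define r s where "r = coeff (Q mod D) 0" and "s = coeff (Q mod D) 1"
    have R: "Q mod D = [:r, s:]"
      using deg by (intro poly_eqI) (auto simp: r_def s_def coeff_pCons coeff_eq_0 split: nat.split)
    have "poly (map_poly complex_of_real (D * (Q div D) + Q mod D)) z = 0"
      using z by simp
    then have "poly (map_poly complex_of_real (Q mod D)) z = 0"
      unfolding poly_of_real_add poly_of_real_mult Dz by simp
    then have "complex_of_real r + z * complex_of_real s = 0"
      by (simp add: R poly_of_real_pCons)
    then have "Q mod D = 0"
      using False by (auto simp: R complex_eq_iff)
    then have "D dvd Q"
      by (simp add: dvd_eq_mod_eq_0)
    then show thesis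
      using that(2)[of "Im z" "Re z"] False by (simp add: D_def)
  qed
qed

text \<open>
  A polynomial without zeros on the numerical range is a product of linear factors and of
  quadratic factors \<open>(x - a)\<^sup>2 + b\<^sup>2\<close>, and each of them is bounded below as an operator.
\<close>

lemma op_poly_bounded_below:
  assumes T: "num_range_in m M T" and "Q \<noteq> 0" "\<And>r. r \<in> {m..M} \<Longrightarrow> poly Q r \<noteq> 0"
  shows "\<exists>c>0. \<forall>x. c * norm x \<le> norm (op_poly Q T x)"
  using assms(2,3)
proof (induction "degree Q" arbitrary: Q rule: less_induct)
  case less
  have step: ?case if Q: "Q = D * R" and dR: "degree D > 0" and D: "\<exists>c>0. \<forall>x. c * norm x \<le> norm (op_poly D T x)" for D R
  proof -
    have "R \<noteq> 0" "D \<noteq> 0"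
      using Q less.prems(1) by auto
    then have "degree R < degree Q"
      using dR by (simp add: Q degree_mult_eq)
    then obtain c where c: "c > 0" "\<And>x. c * norm x \<le> norm (op_poly R T x)"
      using less.hyps[of R] less.prems(2) \<open>R \<noteq> 0\<close> by (auto simp: Q)
    obtain d where d: "d > 0" "\<And>x. d * norm x \<le> norm (op_poly D T x)"
      using D by auto
    have "(d * c) * norm x \<le> norm (op_poly Q T x)" for x
    proof -
      have "(d * c) * norm x \<le> d * norm (op_poly R T x)"
        using c(2)[of x] d(1) by (simp add: mult.assoc)
      also have "\<dots> \<le> norm (op_poly Q T x)"
        using d(2) by (simp add: Q op_poly_mult)
      finally show ?thesis .
    qed
    then show ?case
      using c(1) d(1) by (intro exI[of _ "d * c"]) simp
  qed
  have cs: "c * norm x \<le> norm y" if "c * (norm x)\<^sup>2 \<le> \<bar>inner x y\<bar>" for c and x y :: 'a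
  proof -
    have "norm x * (c * norm x) \<le> norm x * norm y"
      using that Cauchy_Schwarz_ineq2[of x y] by (simp add: power2_eq_square mult_ac)
    then show ?thesis
      by (cases "x = 0") (auto simp: mult_le_cancel_left)
  qed
  show ?case
  proof (cases "degree Q = 0")
    case True
    then obtain q where q: "Q = [:q:]"
      by (rule degree_eq_zeroE)
    then show ?thesis
      using less.prems by (intro exI[of _ "\<bar>q\<bar>"]) (auto simp: op_poly_pCons blinfun.bilinear_simps)
  next
    case False
    then have "degree Q > 0"
      by simp
    then show ?thesis
    proof (rule real_poly_factor)
      fix r assume "[:- r, 1:] dvd Q"
      then obtain R where R: "Q = [:- r, 1:] * R"
        by (elim dvdE)
      then have "poly Q r = 0"
        by simp
      then have r: "r < m \<or> M < r"
        using less.prems(2)[of r] by (meson atLeastAtMost_iff not_le)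
      have app: "op_poly [:- r, 1:] T x = T x - r *\<^sub>R x" for x
        by (simp add: op_poly_pCons blinfun.bilinear_simps)
      have "\<exists>c>0. \<forall>x. c * norm x \<le> norm (op_poly [:- r, 1:] T x)"
      proof (cases "r < m")
        case True
        have "(m - r) * (norm x)\<^sup>2 \<le> \<bar>inner x (T x - r *\<^sub>R x)\<bar>" for x
          using T by (auto simp: num_range_in_def inner_simps power2_norm_eq_inner left_diff_distrib intro: abs_ge_self[THEN order_trans[rotated]])
        then show ?thesis
          using True by (intro exI[of _ "m - r"]) (auto intro: cs simp: app)
      next
        case False
        have "(r - M) * (norm x)\<^sup>2 \<le> \<bar>inner x (T x - r *\<^sub>R x)\<bar>" for x
          using T by (auto simp: num_range_in_def inner_simps power2_norm_eq_inner left_diff_distrib intro: abs_ge_minus_self[THEN order_trans[rotated]])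
        then show ?thesis
          using False r by (intro exI[of _ "r - M"]) (auto intro: cs simp: app)
      qed
      then show ?thesis
        using R by (intro step) auto
    next
      fix a b :: real assume b: "b \<noteq> 0" and "[:a\<^sup>2 + b\<^sup>2, - 2 * a, 1:] dvd Q"
      then obtain R where R: "Q = [:a\<^sup>2 + b\<^sup>2, - 2 * a, 1:] * R"
        by (elim dvdE)
      have "b\<^sup>2 * (norm x)\<^sup>2 \<le> \<bar>inner x (op_poly [:a\<^sup>2 + b\<^sup>2, - 2 * a, 1:] T x)\<bar>" for x
      proof -
        have s: "inner x (T (T x)) = inner (T x) (T x)" "inner (T x) x = inner x (T x)"
          using T by (auto simp: num_range_in_def hermitian_iff)
        have "inner x (op_poly [:a\<^sup>2 + b\<^sup>2, - 2 * a, 1:] T x) =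
            inner (T x - a *\<^sub>R x) (T x - a *\<^sub>R x) + b\<^sup>2 * (norm x)\<^sup>2"
          by (simp add: op_poly_pCons blinfun.bilinear_simps inner_simps s power2_norm_eq_inner)
             (simp add: algebra_simps power2_eq_square)
        then show ?thesis
          by (smt (verit) inner_ge_zero)
      qed
      then have "\<exists>c>0. \<forall>x. c * norm x \<le> norm (op_poly [:a\<^sup>2 + b\<^sup>2, - 2 * a, 1:] T x)"
        using b by (intro exI[of _ "b\<^sup>2"]) (auto intro: cs)
      then show ?thesis
        using R by (intro step) auto
    qed
  qed
qed

text \<open>
  If \<open>\<lambda> = \<parallel>P(T)\<parallel>\<close> exceeded \<open>c\<close>, then \<open>\<lambda>\<^sup>2 - P\<^sup>2\<close> would have no zeros on the numerical range and
  so be bounded below as an operator; but vectors that almost attain the norm of the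
  self-adjoint operator \<open>P(T)\<close> are almost annihilated by \<open>\<lambda>\<^sup>2 - P(T)\<^sup>2\<close>.
\<close>

lemma norm_op_poly_le:
  assumes T: "num_range_in m M T" and P: "\<And>r. r \<in> {m..M} \<Longrightarrow> \<bar>poly P r\<bar> \<le> c" and c0: "0 \<le> c"
  shows "norm (op_poly P T) \<le> c"
proof (rule ccontr)
  define S where "S = op_poly P T"
  define l where "l = norm S"
  assume "\<not> norm (op_poly P T) \<le> c"
  then have l: "c < l" "0 < l"
    using c0 by (auto simp: l_def S_def)
  have S: "hermitian S"
    using T by (simp add: S_def num_range_in_def hermitian_op_poly)
  have "m \<le> M"
  proof (rule ccontr)
    assume "\<not> m \<le> M"
    have z: "x = 0" for x :: 'a
    proof (rule ccontr)
      assume "x \<noteq> 0"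
      then have "M * (norm x)\<^sup>2 < m * (norm x)\<^sup>2"
        using \<open>\<not> m \<le> M\<close> by simp
      then show False
        using T by (smt (verit) num_range_in_def)
    qed
    have "S = 0"
      by (rule blinfun_eqI) (rule trans[OF z z[symmetric]])
    then show False
      using l by (simp add: l_def)
  qed
  define Q where "Q = [:l\<^sup>2:] - P * P"
  have Q: "poly Q r \<noteq> 0" if "r \<in> {m..M}" for r
  proof -
    have "\<bar>poly P r\<bar>\<^sup>2 < l\<^sup>2"
      using P[OF that] l by (intro power_strict_mono) auto
    then show ?thesis
      by (simp add: Q_def power2_eq_square)
  qed
  have "Q \<noteq> 0"
    using Q[of m] \<open>m \<le> M\<close> by auto
  from op_poly_bounded_below[OF T this Q]
  obtain d where d: "d > 0" "\<And>x. d * norm x \<le> norm (op_poly Q T x)"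
    by blast
  define k where "k = l\<^sup>2 - d\<^sup>2 / l\<^sup>2"
  have "(norm (S x))\<^sup>2 \<le> k * (norm x)\<^sup>2" for x
  proof -
    have s: "inner (S (S x)) x = inner (S x) (S x)" "inner x (S (S x)) = inner (S x) (S x)"
      using S unfolding hermitian_iff by (metis, metis)
    have "d\<^sup>2 * (norm x)\<^sup>2 \<le> (norm (op_poly Q T x))\<^sup>2"
      using power_mono[OF d(2)[of x], of 2] d(1) by (simp add: power_mult_distrib)
    also have "op_poly Q T x = l\<^sup>2 *\<^sub>R x - S (S x)"
      by (simp add: Q_def op_poly_diff op_poly_mult op_poly_pCons blinfun.bilinear_simps S_def[symmetric])
    also have "(norm (l\<^sup>2 *\<^sub>R x - S (S x)))\<^sup>2 = l\<^sup>2 * (l\<^sup>2 * (norm x)\<^sup>2 - 2 * (norm (S x))\<^sup>2) + (norm (S (S x)))\<^sup>2"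
      unfolding power2_norm_eq_inner by (simp add: inner_simps s) (simp add: algebra_simps)
    also have "(norm (S (S x)))\<^sup>2 \<le> l\<^sup>2 * (norm (S x))\<^sup>2"
      using power_mono[OF norm_blinfun[of S "S x"], of 2] by (simp add: power_mult_distrib l_def)
    finally have "l\<^sup>2 * (norm (S x))\<^sup>2 \<le> l\<^sup>2 * (l\<^sup>2 * (norm x)\<^sup>2) - d\<^sup>2 * (norm x)\<^sup>2"
      by (simp add: right_diff_distrib)
    also have "\<dots> = l\<^sup>2 * (k * (norm x)\<^sup>2)"
      using l by (simp add: k_def left_diff_distrib right_diff_distrib)
    finally show ?thesis
      using l by (simp add: mult_le_cancel_left)
  qed
  then have *: "(norm (S x))\<^sup>2 \<le> (max 0 k) * (norm x)\<^sup>2" for x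
    by (rule order_trans) (simp add: mult_right_mono)
  have "norm S \<le> sqrt (max 0 k)"
  proof (rule norm_blinfun_bound)
    show "norm (S x) \<le> sqrt (max 0 k) * norm x" for x
      using real_le_rsqrt[OF *[of x]] by (simp add: real_sqrt_mult)
  qed simp
  also have "max 0 k < l\<^sup>2"
    using l d by (auto simp: k_def)
  then have "sqrt (max 0 k) < l"
    using l real_sqrt_less_mono[of "max 0 k" "l\<^sup>2"] by simp
  finally show False
    by (simp add: l_def)
qed

lemma exists_poly_approx:
  assumes "continuous_on UNIV f"
  obtains P :: "nat \<Rightarrow> real poly" where "uniform_limit {a..b} (\<lambda>n. poly (P n)) f sequentially"
proof -
  have "\<exists>P. \<forall>x\<in>{a..b}. \<bar>f x - poly P x\<bar> < 1 / Suc n" for n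
  proof -
    obtain g where g: "real_polynomial_function g" "\<And>x. x \<in> {a..b} \<Longrightarrow> \<bar>f x - g x\<bar> < 1 / Suc n"
      using Stone_Weierstrass_real_polynomial_function[of "{a..b}" f "1 / Suc n"]
        continuous_on_subset[OF assms, of "{a..b}"] by auto
    then obtain c N where "g = (\<lambda>x. \<Sum>i\<le>N. c i * x ^ i)"
      unfolding real_polynomial_function_iff_sum by auto
    then have "g = poly (\<Sum>i\<le>N. monom (c i) i)"
      by (simp add: poly_sum poly_monom fun_eq_iff)
    then show ?thesis
      using g(2) by blast
  qed
  then obtain P where P: "\<And>n x. x \<in> {a..b} \<Longrightarrow> \<bar>f x - poly (P n) x\<bar> < 1 / Suc n"
    by metis
  have "uniform_limit {a..b} (\<lambda>n. poly (P n)) f sequentially"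
  proof (rule uniform_limitI)
    fix e :: real assume "e > 0"
    then obtain N where N: "inverse (real (Suc N)) < e"
      using reals_Archimedean by blast
    have "\<forall>x\<in>{a..b}. dist (poly (P n) x) (f x) < e" if "n \<ge> N" for n
    proof
      fix x assume "x \<in> {a..b}"
      then have "\<bar>f x - poly (P n) x\<bar> < inverse (real (Suc n))"
        using P[of x n] by (simp add: inverse_eq_divide)
      also have "\<dots> \<le> inverse (real (Suc N))"
        using that by (intro le_imp_inverse_le) auto
      finally show "dist (poly (P n) x) (f x) < e"
        using N by (simp add: dist_real_def abs_minus_commute)
    qed
    then show "\<forall>\<^sub>F n in sequentially. \<forall>x\<in>{a..b}. dist (poly (P n) x) (f x) < e"
      unfolding eventually_sequentially by blast
  qed
  then show thesis
    by (rule that)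
qed

text \<open>
  By \<open>norm_op_poly_le\<close>, polynomials that are uniformly close to \<open>f\<close> on the interval have values
  at \<open>T\<close> close to each other. So the values of approximants converge, and their limit is the
  only operator with the defining property of \<open>fun_calc f T\<close>.
\<close>

lemma fun_calc_limit:
  assumes T: "hermitian T" and f: "continuous_on UNIV f"
    and P: "uniform_limit {- norm T..norm T} (\<lambda>n. poly (P n)) f sequentially"
  shows "(\<lambda>n. op_poly (P n) T) \<longlonglongrightarrow> fun_calc f T"
proof -
  define near where "near Q d \<longleftrightarrow> (\<forall>x\<in>{- norm T..norm T}. \<bar>poly Q x - f x\<bar> < d)" for Q d
  define is_calc where "is_calc S \<longleftrightarrow> (\<forall>e>0. \<exists>d>0. \<forall>Q. near Q d \<longrightarrow> norm (op_poly Q T - S) < e)" for S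
  have close: "\<exists>N. \<forall>n\<ge>N. near (P n) d" if "d > 0" for d
    using uniform_limitD[OF P that] by (simp add: eventually_sequentially dist_real_def near_def)
  have lim: "(\<lambda>n. op_poly (P n) T) \<longlonglongrightarrow> S" if S: "is_calc S" for S
  proof (rule LIMSEQ_I)
    fix e :: real assume "e > 0"
    then obtain d where "d > 0" and d: "\<And>Q. near Q d \<Longrightarrow> norm (op_poly Q T - S) < e"
      using S unfolding is_calc_def by blast
    then show "\<exists>N. \<forall>n\<ge>N. norm (op_poly (P n) T - S) < e"
      using close by blast
  qed
  have bnd: "norm (op_poly Q T - op_poly R T) \<le> 2 * d" if Q: "near Q d" and R: "near R d" and d: "d > 0" for Q R d
  proof -
    have "norm (op_poly (Q - R) T) \<le> 2 * d"
    proof (rule norm_op_poly_le[OF num_range_norm[OF T]])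
      fix r assume "r \<in> {- norm T..norm T}"
      with Q R have "\<bar>poly Q r - f r\<bar> < d" "\<bar>poly R r - f r\<bar> < d"
        unfolding near_def by blast+
      then show "\<bar>poly (Q - R) r\<bar> \<le> 2 * d"
        unfolding poly_diff by linarith
    next
      show "0 \<le> 2 * d"
        using d by simp
    qed
    then show ?thesis
      by (simp only: op_poly_diff)
  qed
  have "Cauchy (\<lambda>n. op_poly (P n) T)"
  proof (rule CauchyI)
    fix e :: real assume e: "e > 0"
    obtain N where N: "\<And>n. n \<ge> N \<Longrightarrow> near (P n) (e / 3)"
      using close[of "e / 3"] e by auto
    have "norm (op_poly (P i) T - op_poly (P j) T) < e" if "i \<ge> N" "j \<ge> N" for i j
      using bnd[OF N[OF that(1)] N[OF that(2)]] e by simp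
    then show "\<exists>N. \<forall>i\<ge>N. \<forall>j\<ge>N. norm (op_poly (P i) T - op_poly (P j) T) < e"
      by blast
  qed
  then obtain S where S: "(\<lambda>n. op_poly (P n) T) \<longlonglongrightarrow> S"
    using Cauchy_convergent_iff convergent_def by blast
  have "is_calc S"
    unfolding is_calc_def
  proof (intro allI impI)
    fix e :: real assume e: "e > 0"
    obtain N where N: "\<And>n. n \<ge> N \<Longrightarrow> near (P n) (e / 4)"
      using close[of "e / 4"] e by auto
    obtain N' where N': "\<And>n. n \<ge> N' \<Longrightarrow> norm (op_poly (P n) T - S) < e / 4"
      using LIMSEQ_D[OF S, of "e / 4"] e by auto
    let ?n = "max N N'"
    have "norm (op_poly Q T - S) < e" if "near Q (e / 4)" for Q
    proof -
      have "norm (op_poly Q T - op_poly (P ?n) T) \<le> 2 * (e / 4)"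
        using that N e by (intro bnd) simp_all
      moreover have "norm (op_poly (P ?n) T - S) < e / 4"
        using N' by simp
      ultimately show ?thesis
        using norm_triangle_ineq[of "op_poly Q T - op_poly (P ?n) T" "op_poly (P ?n) T - S"] e by simp
    qed
    then show "\<exists>d>0. \<forall>Q. near Q d \<longrightarrow> norm (op_poly Q T - S) < e"
      using e by (intro exI[of _ "e / 4"]) simp
  qed
  moreover have "S' = S" if "is_calc S'" for S'
    using lim[OF that] S LIMSEQ_unique by blast
  ultimately have "fun_calc f T = S"
    unfolding fun_calc_def is_calc_def near_def by (rule the_equality)
  then show ?thesis
    using S by simp
qed

lemma fun_calc_poly: "hermitian T \<Longrightarrow> fun_calc (poly P) T = op_poly P T"
  by (rule LIMSEQ_unique[OF fun_calc_limit[of T "poly P" "\<lambda>n. P"] tendsto_const])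
    (auto intro!: continuous_intros uniform_limit_const)

lemma fun_calc_mem:
  assumes T: "hermitian T" and f: "continuous_on UNIV f"
    and V: "\<And>P. op_poly P T \<in> V" "\<And>X S. (\<And>n::nat. X n \<in> V) \<Longrightarrow> X \<longlonglongrightarrow> S \<Longrightarrow> S \<in> V"
  shows "fun_calc f T \<in> V"
proof -
  obtain P where "uniform_limit {- norm T..norm T} (\<lambda>n. poly (P n)) f sequentially"
    using exists_poly_approx[OF f] by blast
  then show ?thesis
    by (intro V(2)[OF _ fun_calc_limit[OF T f]] V(1))
qed

lemma poly_add_fun: "poly (P + Q) = (\<lambda>x. poly P x + poly Q x)"
  and poly_mult_fun: "poly (P * Q) = (\<lambda>x. poly P x * poly Q x)"
  by (auto simp: fun_eq_iff)

lemma fun_calc_add: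
  assumes T: "hermitian T" and f: "continuous_on UNIV f" and g: "continuous_on UNIV g"
  shows "fun_calc (\<lambda>x. f x + g x) T = fun_calc f T + fun_calc g T"
proof -
  obtain P where P: "uniform_limit {- norm T..norm T} (\<lambda>n. poly (P n)) f sequentially"
    using exists_poly_approx[OF f] by blast
  obtain Q where Q: "uniform_limit {- norm T..norm T} (\<lambda>n. poly (Q n)) g sequentially"
    using exists_poly_approx[OF g] by blast
  have "(\<lambda>n. op_poly (P n + Q n) T) \<longlonglongrightarrow> fun_calc (\<lambda>x. f x + g x) T"
    using uniform_limit_add[OF P Q] by (intro fun_calc_limit T continuous_intros f g) (simp add: poly_add_fun)
  moreover have "(\<lambda>n. op_poly (P n + Q n) T) \<longlonglongrightarrow> fun_calc f T + fun_calc g T"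
    unfolding op_poly_add by (intro tendsto_add fun_calc_limit T f g P Q)
  ultimately show ?thesis
    by (rule LIMSEQ_unique)
qed

lemma fun_calc_mult:
  assumes T: "hermitian T" and f: "continuous_on UNIV f" and g: "continuous_on UNIV g"
  shows "fun_calc (\<lambda>x. f x * g x) T = fun_calc f T o\<^sub>L fun_calc g T"
proof -
  let ?I = "{- norm T..norm T}"
  obtain P where P: "uniform_limit ?I (\<lambda>n. poly (P n)) f sequentially"
    using exists_poly_approx[OF f] by blast
  obtain Q where Q: "uniform_limit ?I (\<lambda>n. poly (Q n)) g sequentially"
    using exists_poly_approx[OF g] by blast
  have "bounded (f ` ?I)" "bounded (g ` ?I)"
    using f g by (auto intro!: compact_imp_bounded compact_continuous_image intro: continuous_on_subset)
  then have "uniform_limit ?I (\<lambda>n x. poly (P n) x * poly (Q n) x) (\<lambda>x. f x * g x) sequentially"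
    by (intro uniform_lim_mult P Q)
  then have "(\<lambda>n. op_poly (P n * Q n) T) \<longlonglongrightarrow> fun_calc (\<lambda>x. f x * g x) T"
    by (intro fun_calc_limit T continuous_intros f g) (simp add: poly_mult_fun)
  moreover have "(\<lambda>n. op_poly (P n * Q n) T) \<longlonglongrightarrow> (fun_calc f T o\<^sub>L fun_calc g T)"
    unfolding op_poly_mult
    by (intro bounded_bilinear.tendsto[OF bounded_bilinear_blinfun_compose] fun_calc_limit T f g P Q)
  ultimately show ?thesis
    by (rule LIMSEQ_unique)
qed

lemma norm_fun_calc_le:
  assumes T: "num_range_in m M T" and f: "continuous_on UNIV f"
    and c: "\<And>r. m \<le> r \<Longrightarrow> r \<le> M \<Longrightarrow> \<bar>f r\<bar> \<le> c" and c0: "0 \<le> c"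
  shows "norm (fun_calc f T) \<le> c"
proof (rule field_le_epsilon)
  fix e :: real assume e: "e > 0"
  have h: "hermitian T"
    using T by (simp add: num_range_in_def)
  obtain P where P: "uniform_limit {- norm T..norm T} (\<lambda>n. poly (P n)) f sequentially"
    using exists_poly_approx[OF f] by blast
  have T': "num_range_in (max m (- norm T)) (min M (norm T)) T"
    using T num_range_norm[OF h] by (auto simp: num_range_in_def max_def min_def)
  have "\<forall>\<^sub>F n in sequentially. norm (op_poly (P n) T) \<le> c + e"
    using uniform_limitD[OF P e]
  proof eventually_elim
    case (elim n)
    show ?case
    proof (rule norm_op_poly_le[OF T'])
      fix r assume "r \<in> {max m (- norm T)..min M (norm T)}"
      then have "\<bar>f r\<bar> \<le> c" "\<bar>poly (P n) r - f r\<bar> < e"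
        using c[of r] elim by (auto simp: dist_real_def)
      then show "\<bar>poly (P n) r\<bar> \<le> c + e"
        by linarith
    qed (use c0 e in simp)
  qed
  then show "norm (fun_calc f T) \<le> c + e"
    by (intro tendsto_upperbound[OF tendsto_norm[OF fun_calc_limit[OF h f P]]]) auto
qed

lemma fun_calc_scale:
  assumes "hermitian T" "continuous_on UNIV f"
  shows "fun_calc (\<lambda>x. c * f x) T = c *\<^sub>R fun_calc f T"
  using fun_calc_mult[OF assms(1) _ assms(2), of "poly [:c:]"] fun_calc_poly[OF assms(1), of "[:c:]"]
  by (simp add: op_poly_pCons compose_simps)

lemma fun_calc_diff:
  assumes "hermitian T" "continuous_on UNIV f" "continuous_on UNIV g"
  shows "fun_calc (\<lambda>x. f x - g x) T = fun_calc f T - fun_calc g T"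
  using fun_calc_add[OF assms(1,2), of "\<lambda>x. (-1) * g x"] fun_calc_scale[OF assms(1,3), of "-1"] assms(3)
  by (simp add: continuous_on_minus)

lemma fun_calc_cong:
  assumes T: "num_range_in m M T" and f: "continuous_on UNIV f" and g: "continuous_on UNIV g"
    and eq: "\<And>r. m \<le> r \<Longrightarrow> r \<le> M \<Longrightarrow> f r = g r"
  shows "fun_calc f T = fun_calc g T"
proof -
  have "norm (fun_calc (\<lambda>x. f x - g x) T) \<le> 0"
    by (rule norm_fun_calc_le[OF T]) (auto intro!: continuous_intros f g simp: eq)
  then show ?thesis
    using T f g by (simp add: fun_calc_diff num_range_in_def)
qed

lemma fun_calc_id_const:
  assumes "hermitian T"
  shows "fun_calc (\<lambda>x. x) T = T" "fun_calc (\<lambda>x. c) T = c *\<^sub>R id_blinfun"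
proof -
  have "poly [:0, 1:] = (\<lambda>x::real. x)" "poly [:c:] = (\<lambda>x. c)"
    by (auto simp: fun_eq_iff)
  then show "fun_calc (\<lambda>x. x) T = T" "fun_calc (\<lambda>x. c) T = c *\<^sub>R id_blinfun"
    using fun_calc_poly[OF assms, of "[:0, 1:]"] fun_calc_poly[OF assms, of "[:c:]"]
    by (auto simp: op_poly_pCons compose_simps)
qed

lemma bounded_ops_strong_limit:
  assumes "\<And>n. X n \<in> bounded_ops" and lim: "\<And>x. (\<lambda>n. blinfun_apply (X n) x) \<longlonglongrightarrow> blinfun_apply S x"
  shows "S \<in> bounded_ops"
  unfolding bounded_ops_iff
proof
  fix x
  have "(\<lambda>n. X n (\<i> *\<^sub>C x)) \<longlonglongrightarrow> \<i> *\<^sub>C S x"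
    using assms(1) tendsto_ii[OF lim[of x]] by (simp add: bounded_ops_iff)
  then show "S (\<i> *\<^sub>C x) = \<i> *\<^sub>C S x"
    using lim LIMSEQ_unique by blast
qed

lemma hermitian_strong_limit:
  assumes X: "\<And>n. hermitian (X n)" and lim: "\<And>x. (\<lambda>n. blinfun_apply (X n) x) \<longlonglongrightarrow> blinfun_apply S x"
  shows "hermitian S"
  unfolding hermitian_iff
proof (intro conjI allI)
  show "S \<in> bounded_ops"
    using X lim by (auto intro: bounded_ops_strong_limit simp: self_adjoints_def)
  fix x y
  have "(\<lambda>n. inner (X n x) y) \<longlonglongrightarrow> inner x (S y)"
    using tendsto_inner[OF tendsto_const lim, of x y] X by (simp add: hermitian_iff)
  then show "inner (S x) y = inner x (S y)"
    using tendsto_inner[OF lim tendsto_const, of x y] LIMSEQ_unique by blast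
qed

lemma hermitian_fun_calc:
  assumes T: "hermitian T" and f: "continuous_on UNIV f"
  shows "hermitian (fun_calc f T)"
proof (rule fun_calc_mem[OF T f])
  show "hermitian (op_poly P T)" for P
    by (rule hermitian_op_poly[OF T])
  show "hermitian S" if "\<And>n. hermitian (X n)" "X \<longlonglongrightarrow> S" for X S
    by (rule hermitian_strong_limit[OF that(1)]) (rule blinfun.tendsto[OF that(2) tendsto_const])
qed

lemma fun_calc_nonneg:
  assumes T: "num_range_in m M T" and f: "continuous_on UNIV f"
    and pos: "\<And>r. m \<le> r \<Longrightarrow> r \<le> M \<Longrightarrow> 0 \<le> f r"
  shows "op_nonneg (fun_calc f T)"
proof -
  have h: "hermitian T"
    using T by (simp add: num_range_in_def)
  let ?g = "\<lambda>x. sqrt \<bar>f x\<bar>"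
  have g: "continuous_on UNIV ?g"
    by (intro continuous_intros f)
  have "fun_calc f T = fun_calc (\<lambda>x. ?g x * ?g x) T"
    by (rule fun_calc_cong[OF T f]) (auto intro!: continuous_intros f simp: pos)
  also have "\<dots> = fun_calc ?g T o\<^sub>L fun_calc ?g T"
    by (rule fun_calc_mult[OF h g g])
  finally show ?thesis
    using op_nonneg_square[OF hermitian_fun_calc[OF h g]] by simp
qed

lemma num_range_nonneg: "op_nonneg T \<Longrightarrow> num_range_in 0 (norm T) T"
  using abs_inner_blinfun_le[of _ T] by (auto simp: op_nonneg_iff num_range_in_def abs_le_iff)

section \<open>Von Neumann algebras\<close>

lemma commutant_closed:
  assumes K: "K \<subseteq> bounded_ops"
  shows "S \<in> commutant K \<Longrightarrow> T \<in> commutant K \<Longrightarrow> S + T \<in> commutant K"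
    "S \<in> commutant K \<Longrightarrow> T \<in> commutant K \<Longrightarrow> S - T \<in> commutant K"
    "S \<in> commutant K \<Longrightarrow> T \<in> commutant K \<Longrightarrow> S o\<^sub>L T \<in> commutant K"
    "S \<in> commutant K \<Longrightarrow> r *\<^sub>R S \<in> commutant K"
    "S \<in> commutant K \<Longrightarrow> scale_op c S \<in> commutant K"
proof -
  have "(S o\<^sub>L T) o\<^sub>L R = R o\<^sub>L (S o\<^sub>L T)" if "S o\<^sub>L R = R o\<^sub>L S" "T o\<^sub>L R = R o\<^sub>L T" for R S T :: "'a operator"
    by (simp only: compose_assoc that(2)) (simp only: compose_assoc[symmetric] that(1))
  then show "S \<in> commutant K \<Longrightarrow> T \<in> commutant K \<Longrightarrow> S o\<^sub>L T \<in> commutant K"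
    by (simp add: commutant_def bounded_ops_closed)
qed (use K in \<open>auto simp: commutant_def bounded_ops_closed compose_simps scale_op_compose subset_iff\<close>)

lemma id_commutant: "K \<subseteq> bounded_ops \<Longrightarrow> id_blinfun \<in> commutant K"
  by (auto simp: commutant_def)

lemma commutant_strong_limit:
  assumes X: "\<And>n. X n \<in> commutant K" and lim: "\<And>x. (\<lambda>n. blinfun_apply (X n) x) \<longlonglongrightarrow> blinfun_apply S x"
  shows "S \<in> commutant K"
proof -
  have "S o\<^sub>L R = R o\<^sub>L S" if "R \<in> K" for R
  proof (rule blinfun_eqI)
    fix x
    have "X n (R x) = R (X n x)" for n
    proof -
      have "X n o\<^sub>L R = R o\<^sub>L X n"
        using X[of n] that by (simp add: commutant_def)
      from arg_cong[OF this, of "\<lambda>T. blinfun_apply T x"] show ?thesis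
        by simp
    qed
    moreover have "(\<lambda>n. R (X n x)) \<longlonglongrightarrow> R (S x)"
      by (rule blinfun.tendsto[OF tendsto_const lim])
    ultimately show "(S o\<^sub>L R) x = (R o\<^sub>L S) x"
      using lim[of "R x"] by (simp add: LIMSEQ_unique)
  qed
  moreover have "S \<in> bounded_ops"
    using X by (rule_tac bounded_ops_strong_limit[OF _ lim]) (simp add: commutant_def)
  ultimately show ?thesis
    by (simp add: commutant_def)
qed

locale vn_algebra =
  fixes A :: "'h::complex_hilbert operator set"
  assumes vn: "von_neumann_algebra A"
begin

lemma bounded: "a \<in> A \<Longrightarrow> a \<in> bounded_ops"
  using vn by (auto simp: von_neumann_algebra_def)

lemma commutant_bounded: "commutant A \<subseteq> bounded_ops"
  by (auto simp: commutant_def)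

lemma bicommutant: "commutant (commutant A) = A"
  using vn by (simp add: von_neumann_algebra_def)

lemmas closed [simp] = commutant_closed[OF commutant_bounded, unfolded bicommutant]

lemma id_closed [simp]: "id_blinfun \<in> A"
  using id_commutant[OF commutant_bounded] by (simp add: bicommutant)

lemma zero_closed [simp]: "0 \<in> A"
  using closed(4)[OF id_closed, of 0] by simp

lemma minus_closed [simp]: "a \<in> A \<Longrightarrow> - a \<in> A"
  using closed(4)[of a "-1"] by simp

lemma adj_closed [simp]: "a \<in> A \<Longrightarrow> adj a \<in> A"
  using vn by (auto simp: von_neumann_algebra_def)

lemma sum_closed: "(\<And>i. i \<in> I \<Longrightarrow> f i \<in> A) \<Longrightarrow> sum f I \<in> A"
  by (induction I rule: infinite_finite_induct) auto

lemma strong_limit_closed: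
  "(\<And>n. X n \<in> A) \<Longrightarrow> (\<And>x. (\<lambda>n. blinfun_apply (X n) x) \<longlonglongrightarrow> blinfun_apply S x) \<Longrightarrow> S \<in> A"
  using commutant_strong_limit[of X "commutant A" S] by (simp add: bicommutant)

lemma fun_calc_closed:
  assumes "hermitian T" "T \<in> A" "continuous_on UNIV f"
  shows "fun_calc f T \<in> A"
proof (rule fun_calc_mem[OF assms(1,3)])
  show "op_poly P T \<in> A" for P
    by (induction P) (auto simp: op_poly_pCons assms(2))
  show "S \<in> A" if "\<And>n. X n \<in> A" "X \<longlonglongrightarrow> S" for X S
    by (rule strong_limit_closed[OF that(1)]) (rule blinfun.tendsto[OF that(2) tendsto_const])
qed

lemma op_re_im_closed:
  assumes a: "a \<in> A"
  shows "op_re a \<in> A" "hermitian (op_re a)" "op_im a \<in> A" "hermitian (op_im a)" "a = op_re a + scale_op \<i> (op_im a)"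
proof -
  have b: "a \<in> bounded_ops"
    using a by (rule bounded)
  have m: "(- (\<i> / 2)) *\<^sub>C x = - ((1/2) *\<^sub>R (\<i> *\<^sub>C x))" for x :: 'h
    using scaleC_eq[of "- (\<i>/2)" x] by simp
  have im: "op_im a = (- 1/2) *\<^sub>R scale_op \<i> (a - adj a)"
    unfolding op_im_def by (rule blinfun_eqI) (simp add: blinfun.bilinear_simps m)
  show "op_re a \<in> A" "op_im a \<in> A"
    using a by (auto simp: op_re_def op_im_def)
  show "hermitian (op_re a)"
    using b by (auto simp: op_re_def self_adjoints_def adj_simps bounded_ops_closed add.commute)
  have "scale_op \<i> (adj a - a) = - scale_op \<i> (a - adj a)"
    by (rule blinfun_eqI) (simp add: blinfun.bilinear_simps ii_simps)
  then show "hermitian (op_im a)"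
    using b by (simp add: im self_adjoints_def adj_simps adj_scale_ii bounded_ops_closed)
  show "a = op_re a + scale_op \<i> (op_im a)"
    unfolding im op_re_def
    by (rule blinfun_eqI) (simp add: blinfun.bilinear_simps ii_simps scaleR_add_right scaleR_diff_right,
        simp add: scaleR_add_left[symmetric])
qed

end

section \<open>The trace, its \<open>L\<^sup>2\<close> norm and its \<open>L\<^sup>1\<close> norm\<close>

locale tracial = vn_algebra A
  for A :: "'h::complex_hilbert operator set" +
  fixes E :: "'h operator \<Rightarrow> complex"
  assumes W: "wstar_prob_space A E"
begin

text \<open>
  Working with the real part turns the trace form into a real inner product; \<open>E\<close> is recovered
  from it by complex linearity.
\<close>

definition tau :: "'h operator \<Rightarrow> real" where
  "tau a = Re (E a)"

lemmas wstar_conjuncts = W[unfolded wstar_prob_space_def, THEN conjunct2]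

lemmas E_add = wstar_conjuncts[THEN conjunct1, rule_format]
  and E_scale = wstar_conjuncts[THEN conjunct2, THEN conjunct1, rule_format]
  and E_pos = wstar_conjuncts[THEN conjunct2, THEN conjunct2, THEN conjunct1, rule_format]
  and E_id = wstar_conjuncts[THEN conjunct2, THEN conjunct2, THEN conjunct2, THEN conjunct1]
  and E_commute = wstar_conjuncts[THEN conjunct2, THEN conjunct2, THEN conjunct2, THEN conjunct2, THEN conjunct1, rule_format]
  and E_faithful = wstar_conjuncts[THEN conjunct2, THEN conjunct2, THEN conjunct2, THEN conjunct2, THEN conjunct2,
      THEN conjunct1, rule_format]
  and E_normal = wstar_conjuncts[THEN conjunct2, THEN conjunct2, THEN conjunct2, THEN conjunct2, THEN conjunct2,
      THEN conjunct2]

lemma E_scaleR: "a \<in> A \<Longrightarrow> E (r *\<^sub>R a) = r * E a"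
  using E_scale[of a "complex_of_real r"] by (simp add: scale_op_of_real)

lemma tau_add: "a \<in> A \<Longrightarrow> b \<in> A \<Longrightarrow> tau (a + b) = tau a + tau b"
  and tau_scaleR: "a \<in> A \<Longrightarrow> tau (r *\<^sub>R a) = r * tau a"
  and tau_commute: "a \<in> A \<Longrightarrow> b \<in> A \<Longrightarrow> tau (a o\<^sub>L b) = tau (b o\<^sub>L a)"
  and tau_id [simp]: "tau id_blinfun = 1"
  and tau_nonneg: "a \<in> A \<Longrightarrow> op_nonneg a \<Longrightarrow> 0 \<le> tau a"
  using E_pos[of a] by (auto simp: tau_def E_add E_scaleR E_id complex_nonneg_Reals_iff intro: arg_cong[OF E_commute])

lemma tau_minus: "a \<in> A \<Longrightarrow> tau (- a) = - tau a"
  using tau_scaleR[of a "-1"] by simp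

lemma tau_diff: "a \<in> A \<Longrightarrow> b \<in> A \<Longrightarrow> tau (a - b) = tau a - tau b"
  using tau_add[of a "- b"] by (simp add: tau_minus)

lemma tau_0 [simp]: "tau 0 = 0"
  using tau_scaleR[of 0 0] by simp

lemma E_eq_tau: "a \<in> A \<Longrightarrow> E a = Complex (tau a) (- tau (scale_op \<i> a))"
  by (simp add: tau_def E_scale complex_eq_iff)

text \<open>
  A self-adjoint element has real trace, being a difference of a multiple of 1 and a positive
  element.
\<close>

lemma tau_scale_ii_hermitian:
  assumes "a \<in> A" "hermitian a"
  shows "tau (scale_op \<i> a) = 0"
proof -
  have "Im (E (norm a *\<^sub>R id_blinfun - a)) = 0"
    using E_pos[of "norm a *\<^sub>R id_blinfun - a"] op_nonneg_norm_minus(1)[OF assms(2) order_refl] assms(1)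
    by (simp add: complex_nonneg_Reals_iff)
  moreover have "E (norm a *\<^sub>R id_blinfun - a) = norm a - E a"
    using E_add[of "norm a *\<^sub>R id_blinfun" "(- 1) *\<^sub>R a"] assms(1) E_scaleR[of a "-1"] by (simp add: E_scaleR E_id)
  ultimately show ?thesis
    using assms(1) by (simp add: tau_def E_scale)
qed

lemma tau_adj:
  assumes a: "a \<in> A"
  shows "tau (adj a) = tau a"
proof -
  note r = op_re_im_closed[OF a]
  have "adj a = 2 *\<^sub>R op_re a - a"
    by (rule blinfun_eqI) (simp add: op_re_def blinfun.bilinear_simps)
  moreover have "tau a = tau (op_re a) + tau (scale_op \<i> (op_im a))"
    using r tau_add[of "op_re a" "scale_op \<i> (op_im a)"] by simp
  ultimately show ?thesis
    using r a tau_scale_ii_hermitian[OF r(3,4)] by (simp add: tau_diff tau_scaleR)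
qed

definition n2 :: "'h operator \<Rightarrow> real" where
  "n2 a = sqrt (tau (adj a o\<^sub>L a))"

definition ip :: "'h operator \<Rightarrow> 'h operator \<Rightarrow> real" where
  "ip a b = tau (adj a o\<^sub>L b)"

lemma n2_sq: "a \<in> A \<Longrightarrow> (n2 a)\<^sup>2 = ip a a"
  by (simp add: n2_def ip_def tau_nonneg op_nonneg_adj_self bounded)

lemma n2_nonneg [simp]: "a \<in> A \<Longrightarrow> 0 \<le> n2 a"
  by (simp add: n2_def tau_nonneg op_nonneg_adj_self bounded)

lemma ip_nonneg: "a \<in> A \<Longrightarrow> 0 \<le> ip a a"
  by (simp add: ip_def tau_nonneg op_nonneg_adj_self bounded)

lemma ip_commute: "a \<in> A \<Longrightarrow> b \<in> A \<Longrightarrow> ip a b = ip b a"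
  using tau_adj[of "adj a o\<^sub>L b"] by (simp add: ip_def adj_simps bounded)

lemma ip_simps:
  assumes "a \<in> A" "b \<in> A" "c \<in> A"
  shows "ip (a + b) c = ip a c + ip b c" "ip a (b + c) = ip a b + ip a c"
    "ip (a - b) c = ip a c - ip b c" "ip a (b - c) = ip a b - ip a c"
    "ip (r *\<^sub>R a) b = r * ip a b" "ip a (r *\<^sub>R b) = r * ip a b"
  using assms by (auto simp: ip_def adj_simps bounded compose_simps tau_add tau_diff tau_scaleR)

lemma ip_le: 
  assumes "a \<in> A" "b \<in> A"
  shows "ip a b \<le> n2 a * n2 b"
proof -
  have "(ip a b)\<^sup>2 \<le> ip a a * ip b b"
  proof (rule quadratic_nonneg_discriminant)
    show "0 \<le> ip a a + 2 * r * ip a b + r\<^sup>2 * ip b b" for r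
      using ip_nonneg[of "a + r *\<^sub>R b"] assms ip_commute[of b a]
      by (simp add: ip_simps power2_eq_square algebra_simps)
  qed (simp add: ip_nonneg assms)
  then have "(ip a b)\<^sup>2 \<le> (n2 a * n2 b)\<^sup>2"
    by (simp add: power_mult_distrib n2_sq assms)
  then show ?thesis
    by (rule power2_le_imp_le) (simp add: assms)
qed

lemma n2_triangle: 
  assumes "a \<in> A" "b \<in> A"
  shows "n2 (a + b) \<le> n2 a + n2 b"
proof (rule power2_le_imp_le)
  have "(n2 (a + b))\<^sup>2 = (n2 a)\<^sup>2 + 2 * ip a b + (n2 b)\<^sup>2"
    using assms ip_commute[of b a] by (simp add: n2_sq ip_simps)
  also have "\<dots> \<le> (n2 a + n2 b)\<^sup>2"
    using ip_le[OF assms] by (simp add: power2_sum)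
  finally show "(n2 (a + b))\<^sup>2 \<le> (n2 a + n2 b)\<^sup>2" .
qed (use assms in auto)

lemma n2_scaleR:
  assumes "a \<in> A"
  shows "n2 (r *\<^sub>R a) = \<bar>r\<bar> * n2 a"
proof -
  have "tau (adj (r *\<^sub>R a) o\<^sub>L r *\<^sub>R a) = r\<^sup>2 * tau (adj a o\<^sub>L a)"
    using assms by (simp add: adj_simps bounded compose_simps tau_scaleR power2_eq_square)
  then show ?thesis
    by (simp add: n2_def real_sqrt_mult)
qed

lemma n2_0 [simp]: "n2 0 = 0"
  using n2_scaleR[of 0 0] by simp

lemma n2_minus: "a \<in> A \<Longrightarrow> n2 (- a) = n2 a"
  using n2_scaleR[of a "-1"] by simp

lemma n2_minus_commute: "a \<in> A \<Longrightarrow> b \<in> A \<Longrightarrow> n2 (a - b) = n2 (b - a)"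
  using n2_minus[of "a - b"] by simp

lemma n2_triangle_diff: "a \<in> A \<Longrightarrow> b \<in> A \<Longrightarrow> c \<in> A \<Longrightarrow> n2 (a - c) \<le> n2 (a - b) + n2 (b - c)"
  using n2_triangle[of "a - b" "b - c"] by simp

lemma n2_adj: "a \<in> A \<Longrightarrow> n2 (adj a) = n2 a"
  using tau_commute[of a "adj a"] by (simp add: n2_def bounded)

text \<open>
  This is the positivity of \<open>b\<^sup>* (\<parallel>a\<parallel>\<^sup>2 - a\<^sup>* a) b\<close>.
\<close>

lemma n2_mult_left:
  assumes a: "a \<in> A" and b: "b \<in> A"
  shows "n2 (a o\<^sub>L b) \<le> norm a * n2 b"
proof -
  let ?T = "(norm a)\<^sup>2 *\<^sub>R id_blinfun - (adj a o\<^sub>L a)"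
  have "op_nonneg ?T"
    by (rule op_nonneg_norm_minus) (simp_all add: hermitian_adj_self norm_adj_self bounded a)
  then have "op_nonneg (adj b o\<^sub>L ?T o\<^sub>L b)"
    by (rule op_nonneg_adj_sandwich) (simp add: bounded b)
  then have "0 \<le> tau (adj b o\<^sub>L ?T o\<^sub>L b)"
    using a b by (intro tau_nonneg) auto
  also have "adj b o\<^sub>L ?T o\<^sub>L b = (norm a)\<^sup>2 *\<^sub>R (adj b o\<^sub>L b) - (adj (a o\<^sub>L b) o\<^sub>L (a o\<^sub>L b))"
    using a b by (simp add: compose_simps adj_simps bounded compose_assoc)
  finally have "ip (a o\<^sub>L b) (a o\<^sub>L b) \<le> (norm a)\<^sup>2 * ip b b"
    using a b by (simp add: tau_diff tau_scaleR ip_def)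
  then have "(n2 (a o\<^sub>L b))\<^sup>2 \<le> (norm a * n2 b)\<^sup>2"
    using a b by (simp add: n2_sq power_mult_distrib)
  then show ?thesis
    by (rule power2_le_imp_le) (simp add: b)
qed

lemma n2_id [simp]: "n2 id_blinfun = 1"
  by (simp add: n2_def)

lemma n2_le_norm: "a \<in> A \<Longrightarrow> n2 a \<le> norm a"
  using n2_mult_left[of a id_blinfun] by simp

lemma tau_le_norm: "a \<in> A \<Longrightarrow> tau a \<le> norm a"
  using ip_le[of id_blinfun a] n2_le_norm[of a] by (simp add: ip_def)

lemma n2_eq_0:
  assumes "a \<in> A" "n2 a = 0"
  shows "a = 0"
proof -
  have "tau (adj a o\<^sub>L a) = 0"
    using assms n2_sq[of a] by (simp add: ip_def)
  moreover have "Im (E (adj a o\<^sub>L a)) = 0"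
    using E_pos[of "adj a o\<^sub>L a"] assms by (simp add: complex_nonneg_Reals_iff op_nonneg_adj_self bounded)
  ultimately show ?thesis
    using assms by (intro E_faithful) (auto simp: tau_def complex_eq_iff)
qed

lemma tau_mono:
  assumes "a \<in> A" "b \<in> A" "op_le a b"
  shows "tau a \<le> tau b"
  using tau_nonneg[of "b - a"] assms by (simp add: op_le_def tau_diff)

definition n1 :: "'h operator \<Rightarrow> real" where
  "n1 a = tau (op_abs a)"

lemma abs_sq_facts:
  assumes d: "d \<in> A"
  shows "hermitian (adj d o\<^sub>L d)" "num_range_in 0 (norm (adj d o\<^sub>L d)) (adj d o\<^sub>L d)"
    "op_abs d \<in> A" "op_nonneg (op_abs d)" "op_abs d o\<^sub>L op_abs d = adj d o\<^sub>L d"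
proof -
  let ?T = "adj d o\<^sub>L d"
  show h: "hermitian ?T" and r: "num_range_in 0 (norm ?T) ?T"
    using d by (auto simp: hermitian_adj_self bounded num_range_nonneg op_nonneg_adj_self)
  have s: "continuous_on UNIV sqrt"
    by (intro continuous_intros)
  show "op_abs d \<in> A"
    unfolding op_abs_def using d h s by (intro fun_calc_closed) auto
  show "op_nonneg (op_abs d)"
    unfolding op_abs_def by (rule fun_calc_nonneg[OF r s]) simp
  have "op_abs d o\<^sub>L op_abs d = fun_calc (\<lambda>x. sqrt x * sqrt x) ?T"
    unfolding op_abs_def by (rule fun_calc_mult[OF h s s, symmetric])
  also have "\<dots> = fun_calc (\<lambda>x. x) ?T"
    by (rule fun_calc_cong[OF r]) (auto intro!: continuous_intros)
  finally show "op_abs d o\<^sub>L op_abs d = ?T"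
    by (simp add: fun_calc_id_const h)
qed

lemma n1_nonneg [simp]: "a \<in> A \<Longrightarrow> 0 \<le> n1 a"
  using abs_sq_facts[of a] by (simp add: n1_def tau_nonneg)

text \<open>
  With \<open>T = d\<^sup>* d\<close>, the operator \<open>d (T + e\<^sup>2)\<^sup>-\<^sup>1\<^sup>/\<^sup>2\<close> stands in for the partial isometry in the polar
  decomposition of \<open>d\<close>: it is a contraction in the algebra, and multiplying it by
  \<open>(T + e\<^sup>2)\<^sup>1\<^sup>/\<^sup>2\<close>, which is within \<open>e\<close> of the absolute value of \<open>d\<close>, gives back \<open>d\<close>.
\<close>

lemma approximate_polar:
  assumes d: "d \<in> A" and e: "e > 0"
  obtains G K L where "G \<in> A" "K \<in> A" "L \<in> A" "hermitian G" "hermitian L" "K = L o\<^sub>L L" "G o\<^sub>L K = id_blinfun"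
    "norm (d o\<^sub>L G) \<le> 1" "norm (K - op_abs d) \<le> e" "norm ((G o\<^sub>L (adj d o\<^sub>L d)) - op_abs d) \<le> e"
proof -
  let ?T = "adj d o\<^sub>L d"
  note h = abs_sq_facts(1)[OF d] and r = abs_sq_facts(2)[OF d]
  have T: "?T \<in> A"
    using d by simp
  have p: "0 < \<bar>x\<bar> + e\<^sup>2" for x :: real
    using e by (smt (verit) zero_less_power)
  define g k l where "g x = 1 / sqrt (\<bar>x\<bar> + e\<^sup>2)" and "k x = sqrt (\<bar>x\<bar> + e\<^sup>2)" and "l x = sqrt (k x)" for x
  have k0: "k x > 0" for x
    using p by (simp add: k_def)
  have ck: "continuous_on UNIV k" and cl: "continuous_on UNIV l"
    unfolding k_def l_def by (intro continuous_intros)+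
  have cg: "continuous_on UNIV g"
    unfolding g_def using p by (intro continuous_intros) (simp add: less_imp_neq[symmetric])
  have cs: "continuous_on UNIV sqrt" and ci: "continuous_on UNIV (\<lambda>x::real. x)"
    by (intro continuous_intros)+
  have gk: "g x * k x = 1" for x
    using k0[of x] by (simp add: g_def k_def)
  have ksq: "k x * k x = \<bar>x\<bar> + e\<^sup>2" for x
    using p[of x] by (simp add: k_def)
  have k_sqrt: "sqrt x \<le> k x" "k x \<le> sqrt x + e" if "0 \<le> x" for x
    using that e sqrt_add_le_add_sqrt[of x "e\<^sup>2"] by (auto simp: k_def)
  define G K L where "G = fun_calc g ?T" and "K = fun_calc k ?T" and "L = fun_calc l ?T"
  have KL: "K = L o\<^sub>L L"
    unfolding K_def L_def fun_calc_mult[OF h cl cl, symmetric]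
    using k0 by (simp add: l_def less_imp_le)
  have GK: "G o\<^sub>L K = id_blinfun"
    unfolding G_def K_def fun_calc_mult[OF h cg ck, symmetric] by (simp add: gk fun_calc_id_const[OF h])
  have GT: "G o\<^sub>L ?T = fun_calc (\<lambda>x. g x * x) ?T"
    using fun_calc_mult[OF h cg ci] by (simp add: G_def fun_calc_id_const[OF h])
  have hG: "hermitian G"
    unfolding G_def by (rule hermitian_fun_calc[OF h cg])
  have G: "G \<in> A" "K \<in> A" "L \<in> A"
    unfolding G_def K_def L_def using h T ck cl cg by (auto intro: fun_calc_closed)
  have "norm (d o\<^sub>L G) \<le> 1"
  proof -
    have "adj (d o\<^sub>L G) o\<^sub>L (d o\<^sub>L G) = (G o\<^sub>L ?T) o\<^sub>L G"
      using G d hG by (simp add: adj_simps bounded compose_assoc self_adjoints_def)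
    also have "\<dots> = fun_calc (\<lambda>x. g x * x * g x) ?T"
      unfolding GT by (subst fun_calc_mult[OF h _ cg]) (auto intro!: continuous_intros cg simp: G_def)
    also have "norm \<dots> \<le> 1"
    proof (rule norm_fun_calc_le[OF r])
      fix x :: real
      have "g x * x * g x = x / (k x * k x)"
        by (simp add: g_def k_def)
      also have "\<bar>\<dots>\<bar> \<le> 1"
        unfolding ksq using p[of x] by (simp add: abs_divide)
      finally show "\<bar>g x * x * g x\<bar> \<le> 1" .
    qed (auto intro!: continuous_intros cg)
    finally show ?thesis
      using d G by (simp add: norm_adj_self bounded abs_square_le_1)
  qed
  moreover have "norm (K - op_abs d) \<le> e"
    unfolding K_def op_abs_def fun_calc_diff[OF h ck cs, symmetric]
    using k_sqrt e by (intro norm_fun_calc_le[OF r]) (auto intro!: continuous_intros ck simp: abs_le_iff algebra_simps)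
  moreover have "norm ((G o\<^sub>L ?T) - op_abs d) \<le> e"
    unfolding GT op_abs_def fun_calc_diff[OF h continuous_on_mult[OF cg ci] cs, symmetric]
  proof (rule norm_fun_calc_le[OF r])
    fix x :: real assume x: "0 \<le> x"
    have q: "0 \<le> sqrt x / k x" "sqrt x / k x \<le> 1"
      using k_sqrt(1)[OF x] k0[of x] x by (auto simp: divide_le_eq_1)
    have "g x * x = sqrt x * (sqrt x / k x)"
      using x by (simp add: g_def k_def)
    then have z: "sqrt x - g x * x = (sqrt x / k x) * (k x - sqrt x)"
      using k0[of x] by (simp add: right_diff_distrib)
    have "0 \<le> sqrt x - g x * x"
      unfolding z using q k_sqrt(1)[OF x] by (intro mult_nonneg_nonneg) auto
    then have "\<bar>g x * x - sqrt x\<bar> = sqrt x - g x * x"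
      by simp
    also have "\<dots> \<le> 1 * (k x - sqrt x)"
      unfolding z using q k_sqrt(1)[OF x] by (intro mult_right_mono) auto
    also have "\<dots> \<le> e"
      using k_sqrt(2)[OF x] by simp
    finally show "\<bar>g x * x - sqrt x\<bar> \<le> e" .
  qed (use e in \<open>auto intro!: continuous_intros cg\<close>)
  ultimately show thesis
    using that G KL GK hG hermitian_fun_calc[OF h cl] by (simp add: L_def)
qed

text \<open>
  Writing \<open>d = (d G) L L\<close> with \<open>d G\<close> a contraction and \<open>L\<^sup>2\<close> close to the absolute value of \<open>d\<close>,
  the Cauchy-Schwarz inequality bounds \<open>\<tau>(L (a d G) L)\<close> by \<open>\<parallel>a\<parallel> \<tau>(L\<^sup>2)\<close>.
\<close>

lemma tau_compose_le_n1:
  assumes a: "a \<in> A" and d: "d \<in> A"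
  shows "tau (a o\<^sub>L d) \<le> norm a * n1 d"
proof -
  have *: "tau (a o\<^sub>L d) \<le> norm a * n1 d + norm a * e" if e: "e > 0" for e
  proof -
    obtain G K L where G: "G \<in> A" "K \<in> A" "L \<in> A" and L: "hermitian L" "K = L o\<^sub>L L" "G o\<^sub>L K = id_blinfun"
      and n: "norm (d o\<^sub>L G) \<le> 1" "norm (K - op_abs d) \<le> e"
      using approximate_polar[OF d e] by metis
    let ?y = "a o\<^sub>L (d o\<^sub>L G)"
    have aL: "adj L = L"
      using L by (simp add: self_adjoints_def)
    have ny: "norm ?y \<le> norm a"
      using norm_blinfun_compose[of a "d o\<^sub>L G"] mult_left_mono[OF n(1), of "norm a"] by simp
    have "a o\<^sub>L d = (?y o\<^sub>L L) o\<^sub>L L"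
      using L by (simp add: compose_assoc)
    then have "tau (a o\<^sub>L d) = ip L (?y o\<^sub>L L)"
      using tau_commute[of "?y o\<^sub>L L" L] a d G by (simp add: ip_def aL)
    also have "\<dots> \<le> n2 L * n2 (?y o\<^sub>L L)"
      using a d G by (intro ip_le) auto
    also have "\<dots> \<le> n2 L * (norm ?y * n2 L)"
      using a d G by (intro mult_left_mono n2_mult_left) auto
    also have "\<dots> = norm ?y * tau K"
      using n2_sq[of L] G by (simp add: ip_def aL L power2_eq_square)
    also have "\<dots> \<le> norm a * tau K"
      using G ny n2_sq[of L] ip_nonneg[of L] by (intro mult_right_mono) (auto simp: ip_def aL L)
    also have "tau K \<le> n1 d + e"
      using tau_le_norm[of "K - op_abs d"] n(2) G abs_sq_facts(3)[OF d] by (simp add: tau_diff n1_def)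
    finally show ?thesis
      by (simp add: distrib_left mult_left_mono)
  qed
  show ?thesis
  proof (rule field_le_epsilon)
    fix e :: real assume e: "e > 0"
    have "norm a / (norm a + 1) \<le> 1"
      by (smt (verit) divide_le_eq_1 norm_ge_zero)
    then have "norm a * (e / (norm a + 1)) \<le> e"
      using e mult_left_mono[of "norm a / (norm a + 1)" 1 e] by (simp add: mult.commute)
    then show "tau (a o\<^sub>L d) \<le> norm a * n1 d + e"
      using *[of "e / (norm a + 1)"] e by (smt (verit) divide_pos_pos norm_ge_zero)
  qed
qed

text \<open>
  The adjoint of the approximate partial isometry almost attains the norm in the duality.
  Hence the \<open>L\<^sup>1\<close> norm is a supremum of linear functionals and satisfies the triangle
  inequality.
\<close>

lemma n1_attained:
  assumes d: "d \<in> A" and e: "e > 0"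
  shows "\<exists>c\<in>A. norm c \<le> 1 \<and> n1 d - e \<le> tau (c o\<^sub>L d)"
proof -
  obtain G K L where G: "G \<in> A" "hermitian G" "norm (d o\<^sub>L G) \<le> 1" "norm ((G o\<^sub>L (adj d o\<^sub>L d)) - op_abs d) \<le> e"
    using approximate_polar[OF d e] by metis
  show ?thesis
  proof (intro bexI conjI)
    have "adj (d o\<^sub>L G) = G o\<^sub>L adj d"
      using G d by (simp add: adj_simps bounded self_adjoints_def)
    then show "norm (G o\<^sub>L adj d) \<le> 1"
      using G(1,3) d norm_adj[of "d o\<^sub>L G"] by (simp add: bounded)
    have "tau (op_abs d - (G o\<^sub>L (adj d o\<^sub>L d))) \<le> e"
      using tau_le_norm[of "op_abs d - (G o\<^sub>L (adj d o\<^sub>L d))"] G d abs_sq_facts(3)[OF d]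
      by (simp add: norm_minus_commute)
    then show "n1 d - e \<le> tau (G o\<^sub>L adj d o\<^sub>L d)"
      using G d abs_sq_facts(3)[OF d] by (simp add: tau_diff n1_def compose_assoc)
  qed (use G d in auto)
qed

lemma n1_leI:
  assumes d: "d \<in> A" and K: "\<And>c. c \<in> A \<Longrightarrow> norm c \<le> 1 \<Longrightarrow> tau (c o\<^sub>L d) \<le> K"
  shows "n1 d \<le> K"
proof (rule field_le_epsilon)
  fix e :: real assume "e > 0"
  then show "n1 d \<le> K + e"
    using n1_attained[OF d, of e] K by force
qed

lemma tau_compose_le_n1': "c \<in> A \<Longrightarrow> norm c \<le> 1 \<Longrightarrow> d \<in> A \<Longrightarrow> tau (c o\<^sub>L d) \<le> n1 d"
  using tau_compose_le_n1[of c d] mult_right_mono[of "norm c" 1 "n1 d"] by simp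

lemma n1_triangle:
  assumes "a \<in> A" "b \<in> A"
  shows "n1 (a + b) \<le> n1 a + n1 b"
proof (rule n1_leI)
  fix c assume "c \<in> A" "norm c \<le> 1"
  then show "tau (c o\<^sub>L (a + b)) \<le> n1 a + n1 b"
    using assms tau_compose_le_n1'[of c a] tau_compose_le_n1'[of c b] by (simp add: compose_simps tau_add)
qed (use assms in simp)

lemma n1_le_n2:
  assumes "a \<in> A"
  shows "n1 a \<le> n2 a"
proof (rule n1_leI[OF assms])
  fix c assume c: "c \<in> A" "norm c \<le> 1"
  have "tau (c o\<^sub>L a) \<le> n2 (adj c) * n2 a"
    using ip_le[of "adj c" a] c assms by (simp add: ip_def bounded)
  also have "n2 (adj c) \<le> 1"
    using n2_le_norm[of c] c by (simp add: n2_adj)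
  finally show "tau (c o\<^sub>L a) \<le> n2 a"
    using assms by (simp add: mult_right_mono)
qed

lemma n1_scaleR_le:
  assumes "a \<in> A"
  shows "n1 (r *\<^sub>R a) \<le> \<bar>r\<bar> * n1 a"
proof (rule n1_leI)
  fix c assume c: "c \<in> A" "norm c \<le> 1"
  have "tau (c o\<^sub>L r *\<^sub>R a) = tau ((r *\<^sub>R c) o\<^sub>L a)"
    by (simp add: compose_simps)
  also have "\<dots> \<le> norm (r *\<^sub>R c) * n1 a"
    using c assms by (intro tau_compose_le_n1) auto
  also have "\<dots> \<le> \<bar>r\<bar> * n1 a"
    using c assms mult_left_mono[of "norm c" 1 "\<bar>r\<bar>"] by (intro mult_right_mono) auto
  finally show "tau (c o\<^sub>L r *\<^sub>R a) \<le> \<bar>r\<bar> * n1 a" .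
qed (use assms in simp)

lemma n1_scaleR:
  assumes "a \<in> A"
  shows "n1 (r *\<^sub>R a) = \<bar>r\<bar> * n1 a"
proof (cases "r = 0")
  case True
  have "n1 0 \<le> 0"
    using n1_scaleR_le[OF assms, of 0] by simp
  then have "n1 0 = 0"
    by (intro antisym) simp_all
  then show ?thesis
    using True by simp
next
  case False
  have "\<bar>r\<bar> * n1 a \<le> n1 (r *\<^sub>R a)"
    using n1_scaleR_le[of "r *\<^sub>R a" "1 / r"] assms False by (simp add: field_simps)
  then show ?thesis
    using n1_scaleR_le[OF assms, of r] by simp
qed

lemma Lp_norm_2:
  assumes a: "a \<in> A"
  shows "Lp_norm E 2 a = n2 a"
proof -
  have h: "hermitian (op_abs a)"
    using abs_sq_facts[OF a] by (simp add: op_nonneg_hermitian)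
  have "(\<lambda>x::real. \<bar>x\<bar> powr 2) = (\<lambda>x. x * x)"
    by (simp add: fun_eq_iff powr_numeral power2_eq_square)
  moreover have "fun_calc (\<lambda>x. x * x) (op_abs a) = adj a o\<^sub>L a"
    using fun_calc_mult[OF h, of "\<lambda>x. x" "\<lambda>x. x"] abs_sq_facts(5)[OF a] by (simp add: fun_calc_id_const[OF h])
  moreover have "enn2real 2 = 2" "(2::ennreal) \<noteq> \<infinity>"
    by simp_all
  ultimately show ?thesis
    using ip_nonneg[OF a] by (simp add: Lp_norm_def n2_def tau_def ip_def powr_half_sqrt)
qed

lemma Lp_norm_1:
  assumes a: "a \<in> A"
  shows "Lp_norm E 1 a = n1 a"
proof -
  note f = abs_sq_facts[OF a]
  have "fun_calc (\<lambda>x. \<bar>x\<bar>) (op_abs a) = fun_calc (\<lambda>x. x) (op_abs a)"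
    by (rule fun_calc_cong[OF num_range_nonneg[OF f(4)]]) (auto intro!: continuous_intros)
  moreover have "(\<lambda>x::real. \<bar>x\<bar> powr 1) = (\<lambda>x. \<bar>x\<bar>)"
    by (simp add: fun_eq_iff)
  ultimately show ?thesis
    using n1_nonneg[OF a] f by (simp add: Lp_norm_def n1_def tau_def fun_calc_id_const op_nonneg_hermitian)
qed

end

section \<open>Monotone limits of operators and completeness of balls in \<open>L\<^sup>2\<close>\<close>

lemma strong_limit_exists:
  fixes X :: "nat \<Rightarrow> 'a::real_normed_vector \<Rightarrow>\<^sub>L 'b::real_normed_vector"
  assumes conv: "\<And>x. convergent (\<lambda>n. X n x)" and bnd: "\<And>n. norm (X n) \<le> C"
  obtains S where "\<And>x. (\<lambda>n. X n x) \<longlonglongrightarrow> blinfun_apply S x" "norm S \<le> C"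
proof -
  define S where "S x = lim (\<lambda>n. X n x)" for x
  have lim: "(\<lambda>n. X n x) \<longlonglongrightarrow> S x" for x
    unfolding S_def using conv convergent_LIMSEQ_iff by blast
  have C0: "0 \<le> C"
    using norm_ge_zero order_trans bnd by blast
  have le: "norm (S x) \<le> C * norm x" for x
  proof (rule tendsto_upperbound[OF tendsto_norm[OF lim]])
    have "norm (X n x) \<le> C * norm x" for n
      using norm_blinfun[of "X n" x] mult_right_mono[OF bnd, of "norm x" n] by simp
    then show "\<forall>\<^sub>F n in sequentially. norm (X n x) \<le> C * norm x"
      by simp
  qed simp
  have bl: "bounded_linear S"
  proof (rule bounded_linear_intro[where K = C])
    show "S (x + y) = S x + S y" for x y
      using LIMSEQ_unique[OF lim[of "x + y"]] tendsto_add[OF lim[of x] lim[of y]]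
      by (simp add: blinfun.bilinear_simps)
    show "S (r *\<^sub>R x) = r *\<^sub>R S x" for r x
      using LIMSEQ_unique[OF lim[of "r *\<^sub>R x"]] tendsto_scaleR[OF tendsto_const lim[of x]]
      by (simp add: blinfun.bilinear_simps)
    show "norm (S x) \<le> norm x * C" for x
      using le[of x] by (simp add: mult.commute)
  qed
  show thesis
  proof (rule that)
    show "(\<lambda>n. X n x) \<longlonglongrightarrow> Blinfun S x" for x
      using lim by (simp add: bounded_linear_Blinfun_apply[OF bl])
    show "norm (Blinfun S) \<le> C"
      by (rule norm_blinfun_bound[OF C0]) (simp add: bounded_linear_Blinfun_apply[OF bl] le)
  qed
qed

lemma op_nonneg_strong_limit:
  assumes X: "\<And>n. op_nonneg (X n)" and lim: "\<And>x. (\<lambda>n. blinfun_apply (X n) x) \<longlonglongrightarrow> blinfun_apply S x"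
  shows "op_nonneg S"
  unfolding op_nonneg_iff
proof (intro conjI allI)
  show "hermitian S"
    by (rule hermitian_strong_limit[OF _ lim]) (rule op_nonneg_hermitian[OF X])
  show "0 \<le> inner x (S x)" for x
    by (rule LIMSEQ_le_const[OF tendsto_inner[OF tendsto_const lim]]) (auto intro: op_nonneg_inner[OF X])
qed

lemma op_nonneg_norm_mono:
  assumes "op_nonneg S" "op_nonneg (T - S)"
  shows "norm S \<le> norm T"
proof (rule hermitian_norm_le)
  show "hermitian S"
    by (rule op_nonneg_hermitian[OF assms(1)])
  show "\<bar>inner x (S x)\<bar> \<le> norm T * (norm x)\<^sup>2" for x
    using op_nonneg_inner[OF assms(1), of x] op_nonneg_inner[OF assms(2), of x] abs_inner_blinfun_le[of x T]
    by (simp add: blinfun.bilinear_simps inner_simps)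
qed simp

text \<open>
  The quadratic forms converge by monotonicity, and the Cauchy-Schwarz inequality for the
  positive form of \<open>r\<^sub>m - r\<^sub>n\<close> bounds \<open>\<parallel>(r\<^sub>m - r\<^sub>n) x\<parallel>\<^sup>2\<close> by a multiple of their differences.
\<close>

lemma decreasing_strong_limit:
  fixes r :: "nat \<Rightarrow> 'h::complex_hilbert operator"
  assumes pos: "\<And>n. op_nonneg (r n)" and dec: "\<And>m n. m \<le> n \<Longrightarrow> op_nonneg (r m - r n)"
  obtains R where "\<And>x. (\<lambda>n. r n x) \<longlonglongrightarrow> blinfun_apply R x" "op_nonneg R" "\<And>n. op_nonneg (r n - R)"
proof -
  have nd: "norm (r m - r n) \<le> norm (r 0)" if "m \<le> n" for m n
  proof (rule op_nonneg_norm_mono[OF dec[OF that]])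
    show "op_nonneg (r 0 - (r m - r n))"
      using op_nonneg_add[OF dec[of 0 m] pos[of n]] by (simp add: algebra_simps)
  qed
  have "convergent (\<lambda>n. r n x)" for x
  proof -
    let ?f = "\<lambda>n. inner x (r n x)"
    have "convergent ?f"
    proof (rule Bseq_monoseq_convergent)
      have mono: "?f n \<le> ?f m" if "m \<le> n" for m n
        using op_nonneg_inner[OF dec[OF that], of x] by (simp add: blinfun.bilinear_simps inner_simps)
      then show "monoseq ?f"
        by (auto simp: monoseq_def)
      show "Bseq ?f"
        using op_nonneg_inner[OF pos, of x] mono[of 0] by (intro BseqI'[where K = "?f 0"]) auto
    qed
    then have f: "Cauchy ?f"
      by (simp add: Cauchy_convergent_iff)
    have "Cauchy (\<lambda>n. r n x)"
    proof (rule CauchyI)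
      fix e :: real assume e: "e > 0"
      define d where "d = e\<^sup>2 / (norm (r 0) + 1)"
      have n0: "0 < norm (r 0) + 1"
        by (simp add: add_nonneg_pos)
      then have "d > 0"
        using e by (simp add: d_def)
      then obtain M where M: "\<And>m n. m \<ge> M \<Longrightarrow> n \<ge> M \<Longrightarrow> norm (?f m - ?f n) < d"
        using CauchyD[OF f] by blast
      have lt: "norm (r m x - r n x) < e" if "m \<ge> M" "n > m" for m n
      proof (rule power2_less_imp_less)
        have "(norm (r m x - r n x))\<^sup>2 \<le> norm (r m - r n) * inner x ((r m - r n) x)"
          using op_nonneg_norm_sq_le[OF dec[of m n], of x] that by (simp add: blinfun.bilinear_simps)
        also have "\<dots> \<le> norm (r 0) * inner x ((r m - r n) x)"
          using nd[of m n] op_nonneg_inner[OF dec[of m n], of x] that by (intro mult_right_mono) auto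
        also have "inner x ((r m - r n) x) = ?f m - ?f n"
          by (simp add: blinfun.bilinear_simps inner_simps)
        also have "norm (r 0) * (?f m - ?f n) \<le> norm (r 0) * d"
          using M[of m n] that by (intro mult_left_mono) auto
        also have "\<dots> < (norm (r 0) + 1) * d"
          using \<open>d > 0\<close> by simp
        also have "\<dots> = e\<^sup>2"
          using n0 by (simp add: d_def)
        finally show "(norm (r m x - r n x))\<^sup>2 < e\<^sup>2" .
      qed (use e in simp)
      have "norm (r m x - r n x) < e" if "m \<ge> M" "n \<ge> M" for m n
        using lt[of m n] lt[of n m] that e by (cases m n rule: linorder_cases) (auto simp: norm_minus_commute)
      then show "\<exists>M. \<forall>m\<ge>M. \<forall>n\<ge>M. norm (r m x - r n x) < e"
        by blast
    qed
    then show ?thesis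
      by (simp add: Cauchy_convergent_iff)
  qed
  moreover have "norm (r n) \<le> norm (r 0)" for n
    by (rule op_nonneg_norm_mono[OF pos dec]) simp
  ultimately obtain R where R: "\<And>x. (\<lambda>n. r n x) \<longlonglongrightarrow> blinfun_apply R x"
    using strong_limit_exists[of r "norm (r 0)"] by blast
  show thesis
  proof (rule that[OF R])
    show "op_nonneg R"
      by (rule op_nonneg_strong_limit[OF pos R])
    show "op_nonneg (r n - R)" for n
    proof (rule op_nonneg_strong_limit)
      show "op_nonneg (r n - r (k + n))" for k
        by (rule dec) simp
      show "(\<lambda>k. (r n - r (k + n)) x) \<longlonglongrightarrow> (r n - R) x" for x
        using tendsto_diff[OF tendsto_const LIMSEQ_ignore_initial_segment[OF R]]
        by (simp add: blinfun.bilinear_simps)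
    qed
  qed
qed

lemma convergent_geometric:
  fixes z :: "nat \<Rightarrow> 'a::banach"
  assumes q: "0 \<le> q" "q < 1" and z: "\<And>k. k \<ge> m \<Longrightarrow> norm (z (Suc k) - z k) \<le> q ^ k"
  shows "convergent z"
proof -
  have "summable (\<lambda>k. z (Suc k) - z k)"
  proof (rule summable_comparison_test)
    show "\<exists>N. \<forall>k\<ge>N. norm (z (Suc k) - z k) \<le> q ^ k"
      using z by blast
    show "summable (\<lambda>k. q ^ k)"
      using q by (simp add: summable_geometric)
  qed
  then have "convergent (\<lambda>n. z n - z 0)"
    by (simp add: summable_iff_convergent sum_lessThan_telescope)
  then have "convergent (\<lambda>n. (z n - z 0) + z 0)"
    by (intro convergent_add convergent_const)
  then show ?thesis
    by simp
qed

text \<open>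
  For positive \<open>S\<close> this is \<open>(1 + S)\<^sup>-\<^sup>1\<close>; the absolute value only makes the function continuous on
  the whole line.
\<close>

definition resolvent :: "'h::complex_hilbert operator \<Rightarrow> 'h operator" where
  "resolvent S = fun_calc (\<lambda>x. 1 / (1 + \<bar>x\<bar>)) S"

lemma continuous_resolvent: "continuous_on UNIV (\<lambda>x::real. 1 / (1 + \<bar>x\<bar>))"
  by (intro continuous_intros) (auto simp: add_nonneg_eq_0_iff)

lemma resolvent_facts:
  assumes S: "op_nonneg S"
  shows "op_nonneg (resolvent S)" "norm (resolvent S) \<le> 1" "(id_blinfun + S) o\<^sub>L resolvent S = id_blinfun"
    "op_nonneg (S - (id_blinfun - resolvent S))" "op_nonneg (id_blinfun - resolvent S)"
proof -
  note h = op_nonneg_hermitian[OF S] and r = num_range_nonneg[OF S] and c = continuous_resolvent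
  show "op_nonneg (resolvent S)"
    unfolding resolvent_def by (rule fun_calc_nonneg[OF r c]) simp
  show n: "norm (resolvent S) \<le> 1"
    unfolding resolvent_def by (rule norm_fun_calc_le[OF r c]) (auto simp: divide_le_eq_1)
  show "op_nonneg (id_blinfun - resolvent S)"
    using op_nonneg_norm_minus(1)[OF op_nonneg_hermitian n] \<open>op_nonneg (resolvent S)\<close> by simp
  have c1: "continuous_on UNIV (\<lambda>x::real. 1 + x)" and c2: "continuous_on UNIV (\<lambda>x::real. x)"
    by (intro continuous_intros)+
  have "fun_calc (\<lambda>x. 1 + x) S = id_blinfun + S"
    using fun_calc_add[OF h continuous_on_const c2, of 1] by (simp add: fun_calc_id_const[OF h])
  then have "(id_blinfun + S) o\<^sub>L resolvent S = fun_calc (\<lambda>x. (1 + x) * (1 / (1 + \<bar>x\<bar>))) S"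
    unfolding resolvent_def fun_calc_mult[OF h c1 c] by simp
  also have "\<dots> = fun_calc (\<lambda>x. 1) S"
    by (rule fun_calc_cong[OF r continuous_on_mult[OF c1 c] continuous_on_const]) simp
  finally show "(id_blinfun + S) o\<^sub>L resolvent S = id_blinfun"
    by (simp add: fun_calc_id_const[OF h])
  have c3: "continuous_on UNIV (\<lambda>x::real. 1 - 1 / (1 + \<bar>x\<bar>))"
    by (intro continuous_on_diff continuous_on_const c)
  have "S - (id_blinfun - resolvent S) = fun_calc (\<lambda>x. x - (1 - 1 / (1 + \<bar>x\<bar>))) S"
    unfolding resolvent_def fun_calc_diff[OF h c2 c3] fun_calc_diff[OF h continuous_on_const c]
    by (simp add: fun_calc_id_const[OF h])
  moreover have "op_nonneg (fun_calc (\<lambda>x. x - (1 - 1 / (1 + \<bar>x\<bar>))) S)"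
    by (rule fun_calc_nonneg[OF r continuous_on_diff[OF c2 c3]]) (simp add: field_simps)
  ultimately show "op_nonneg (S - (id_blinfun - resolvent S))"
    by simp
qed

lemma resolvent_apply: "op_nonneg S \<Longrightarrow> resolvent S x + S (resolvent S x) = x"
  using arg_cong[OF resolvent_facts(3), of S "\<lambda>T. blinfun_apply T x"] by (simp add: blinfun.bilinear_simps)

lemma resolvent_inner_le:
  assumes S: "op_nonneg S"
  shows "inner (resolvent S x) (S (resolvent S x)) \<le> (norm x)\<^sup>2"
proof -
  let ?u = "resolvent S x"
  have "inner ?u (S ?u) \<le> inner ?u (?u + S ?u)"
    by (simp add: inner_simps)
  also have "\<dots> = inner x ?u"
    using resolvent_apply[OF S, of x] by (simp add: inner_commute)
  also have "\<dots> \<le> norm (resolvent S) * (norm x)\<^sup>2"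
    using abs_inner_blinfun_le[of x "resolvent S"] by linarith
  also have "\<dots> \<le> (norm x)\<^sup>2"
    using mult_right_mono[OF resolvent_facts(2)[OF S], of "(norm x)\<^sup>2"] by simp
  finally show ?thesis .
qed

text \<open>
  With \<open>u = (1 + S)\<^sup>-\<^sup>1 x\<close> and \<open>v = (1 + T)\<^sup>-\<^sup>1 x\<close>, the Cauchy-Schwarz
  inequality for the form of \<open>1 + S\<close> gives \<open>\<langle>x, v\<rangle>\<^sup>2 \<le> \<langle>x, u\<rangle> \<langle>(1 + S) v, v\<rangle> \<le> \<langle>x, u\<rangle> \<langle>x, v\<rangle>\<close>.
\<close>

lemma resolvent_antitone:
  assumes S: "op_nonneg S" and ST: "op_nonneg (T - S)"
  shows "op_nonneg (resolvent S - resolvent T)"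
proof -
  have T: "op_nonneg T"
    using op_nonneg_add[OF S ST] by simp
  have "0 \<le> inner x ((resolvent S - resolvent T) x)" for x
  proof -
    let ?B = "id_blinfun + S"
    let ?u = "resolvent S x" and ?v = "resolvent T x"
    have B: "op_nonneg ?B"
      by (intro op_nonneg_add S) (simp add: op_nonneg_iff)
    have u: "?B ?u = x"
      using resolvent_apply[OF S, of x] by (simp add: blinfun.bilinear_simps)
    have v: "?v + T ?v = x"
      by (rule resolvent_apply[OF T])
    have "(inner ?v (?B ?u))\<^sup>2 \<le> inner ?v (?B ?v) * inner ?u (?B ?u)"
      by (rule op_nonneg_cauchy_schwarz[OF B])
    moreover have "inner ?v (?B ?v) \<le> inner ?v x"
    proof -
      have "inner ?v x = inner ?v ?v + inner ?v (T ?v)"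
        by (subst v[symmetric]) (simp add: inner_add_right)
      then show ?thesis
        using op_nonneg_inner[OF ST, of ?v] by (simp add: blinfun.bilinear_simps inner_simps)
    qed
    moreover have u0: "0 \<le> inner ?u x"
      using op_nonneg_inner[OF B, of ?u] unfolding u .
    ultimately have "(inner ?v x)\<^sup>2 \<le> inner ?v x * inner ?u x"
      unfolding u using mult_right_mono order_trans by blast
    moreover have "0 \<le> inner ?v x"
      using op_nonneg_inner[OF resolvent_facts(1)[OF T], of x] by (simp add: inner_commute)
    ultimately have "inner ?v x \<le> inner ?u x"
      using u0 by (cases "inner ?v x = 0") (auto simp: power2_eq_square mult_le_cancel_left)
    then show ?thesis
      by (simp add: blinfun.bilinear_simps inner_simps inner_commute)
  qed
  then show ?thesis
    using resolvent_facts(1)[OF S] resolvent_facts(1)[OF T] by (simp add: op_nonneg_iff hermitian_closed)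
qed

context tracial
begin

text \<open>
  Normality speaks of suprema of directed sets; the strong limit of an increasing sequence is
  its supremum.
\<close>

lemma tau_normal:
  fixes a :: "nat \<Rightarrow> 'h operator"
  assumes a: "\<And>n. a n \<in> A" "\<And>n. hermitian (a n)" and mono: "\<And>m n. m \<le> n \<Longrightarrow> op_nonneg (a n - a m)"
    and lim: "\<And>x. (\<lambda>n. a n x) \<longlonglongrightarrow> blinfun_apply S x" and K: "\<And>n. tau (a n) \<le> K"
  shows "tau S \<le> K"
proof -
  have "S \<in> A"
    by (rule strong_limit_closed[OF a(1) lim])
  have "op_lub A (range a) S"
    unfolding op_lub_def
  proof (intro conjI ballI impI)
    show "S \<in> self_adjoints A"
      using \<open>S \<in> A\<close> hermitian_strong_limit[OF a(2) lim] by (simp add: self_adjoints_def)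
    show "op_le b S" if "b \<in> range a" for b
    proof -
      obtain m where m: "b = a m"
        using \<open>b \<in> range a\<close> by auto
      show ?thesis
        unfolding op_le_def
      proof (rule op_nonneg_strong_limit)
        show "op_nonneg (a (k + m) - b)" for k
          unfolding m by (rule mono) simp
        show "(\<lambda>k. (a (k + m) - b) x) \<longlonglongrightarrow> (S - b) x" for x
          using tendsto_diff[OF LIMSEQ_ignore_initial_segment[OF lim] tendsto_const]
          by (simp add: blinfun.bilinear_simps)
      qed
    qed
    show "op_le S R" if "R \<in> self_adjoints A" "\<forall>b\<in>range a. op_le b R" for R
      unfolding op_le_def
    proof (rule op_nonneg_strong_limit)
      show "op_nonneg (R - a n)" for n
        using that(2) by (simp add: op_le_def)
      show "(\<lambda>n. (R - a n) x) \<longlonglongrightarrow> (R - S) x" for x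
        using tendsto_diff[OF tendsto_const lim] by (simp add: blinfun.bilinear_simps)
    qed
  qed
  moreover have "\<forall>b\<in>range a. \<forall>c\<in>range a. \<exists>d\<in>range a. op_le b d \<and> op_le c d"
  proof (clarify)
    fix i j
    show "\<exists>d\<in>range a. op_le (a i) d \<and> op_le (a j) d"
      by (rule bexI[of _ "a (max i j)"]) (simp_all add: op_le_def mono)
  qed
  moreover have "range a \<subseteq> self_adjoints A"
    using a by (auto simp: self_adjoints_def)
  ultimately have "Re (E S) = (SUP b\<in>range a. Re (E b))"
    using E_normal unfolding normal_functional_def by blast
  also have "\<dots> \<le> K"
    using K by (intro cSUP_least) (auto simp: tau_def)
  finally show ?thesis
    by (simp add: tau_def)
qed

lemma n2_sq_le_tau:
  assumes h: "h \<in> A" "op_nonneg h" "norm h \<le> 1"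
  shows "(n2 h)\<^sup>2 \<le> tau h"
proof -
  have hh: "hermitian h"
    by (rule op_nonneg_hermitian[OF h(2)])
  have "op_nonneg (h - (h o\<^sub>L h))"
    unfolding op_nonneg_iff
  proof (intro conjI allI)
    show "hermitian (h - (h o\<^sub>L h))"
      by (intro hermitian_closed hh hermitian_compose) simp
    fix x
    have "inner x (h (h x)) = (norm (h x))\<^sup>2"
      using hh by (simp add: hermitian_iff power2_norm_eq_inner)
    also have "\<dots> \<le> norm h * inner x (h x)"
      by (rule op_nonneg_norm_sq_le[OF h(2)])
    also have "\<dots> \<le> inner x (h x)"
      using mult_right_mono[OF h(3) op_nonneg_inner[OF h(2), of x]] by simp
    finally show "0 \<le> inner x ((h - (h o\<^sub>L h)) x)"
      by (simp add: blinfun.bilinear_simps inner_simps)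
  qed
  then have "0 \<le> tau (h - (h o\<^sub>L h))"
    using h by (intro tau_nonneg) simp_all
  then show ?thesis
    using h hh by (simp add: n2_sq ip_def tau_diff self_adjoints_def)
qed

text \<open>
  A noncommutative Egorov theorem. If \<open>y\<^sub>k = \<bar>c\<^sub>k\<^sub>+\<^sub>1 - c\<^sub>k\<bar>\<^sup>2\<close> has trace at most \<open>16\<^sup>-\<^sup>k\<close>, the
  formal sum of \<open>2\<^sup>k y\<^sub>k\<close> over \<open>k \<ge> m\<close> is a possibly unbounded positive operator of small
  trace. Its resolvent \<open>R\<^sub>m\<close> exists as the decreasing limit of the resolvents of the partial sums.
  Normality bounds the trace of \<open>1 - R\<^sub>m\<close>. As \<open>2\<^sup>k y\<^sub>k\<close> is below the sum, which the resolvent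
  compresses to a contraction, \<open>(c\<^sub>k\<^sub>+\<^sub>1 - c\<^sub>k) R\<^sub>m\<close> is small in the operator norm.
\<close>

lemma egorov_weights:
  assumes N: "vn_algebra N" "N \<subseteq> A" and c: "\<And>k. c k \<in> N" and small: "\<And>k. n2 (c (Suc k) - c k) \<le> (1/4) ^ k"
  obtains R where "\<And>m. R m \<in> N" "\<And>m. op_nonneg (R m)" "\<And>m. op_nonneg (id_blinfun - R m)"
    "\<And>m. tau (id_blinfun - R m) \<le> 2 * (1/2) ^ m"
    "\<And>m k. m \<le> k \<Longrightarrow> norm ((c (Suc k) - c k) o\<^sub>L R m) \<le> sqrt (1/2) ^ k"
    "\<And>m. op_nonneg (R (Suc m) - R m)"
proof -
  interpret N: vn_algebra N by fact
  define y where "y k = adj (c (Suc k) - c k) o\<^sub>L (c (Suc k) - c k)" for k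
  define S where "S m n = (\<Sum>k\<in>{m..<m + n}. 2 ^ k *\<^sub>R y k)" for m n
  have y: "y k \<in> N" "op_nonneg (y k)" for k
    using c by (auto simp: y_def op_nonneg_adj_self N.bounded)
  have S_Suc: "S m (Suc n) = S m n + 2 ^ (m + n) *\<^sub>R y (m + n)" for m n
    by (simp add: S_def)
  have S_Suc': "S m (Suc n) = 2 ^ m *\<^sub>R y m + S (Suc m) n" for m n
    by (simp add: S_def sum.atLeast_Suc_lessThan)
  have "S m n \<in> N \<and> op_nonneg (S m n)" for m n
    by (induction n) (simp_all add: S_Suc y op_nonneg_add op_nonneg_scaleR, simp_all add: S_def)
  then have S: "S m n \<in> N" "op_nonneg (S m n)" for m n
    by blast+
  have S_mono: "op_nonneg (S m n' - S m n)" if "n \<le> n'" for m n n'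
    using that
  proof (induction n' rule: dec_induct)
    case (step k)
    then show ?case
      using op_nonneg_add[OF step.IH op_nonneg_scaleR[OF y(2), of "2 ^ (m + k)" "m + k"]]
      by (simp add: S_Suc algebra_simps)
  qed simp
  have y_le_S: "op_nonneg (S m n - 2 ^ k *\<^sub>R y k)" if "m \<le> k" "k < m + n" for m n k
  proof -
    obtain i where i: "k = m + i"
      using \<open>m \<le> k\<close> nat_le_iff_add by blast
    have "op_nonneg ((S m n - S m (Suc i)) + S m i)"
      using that i by (intro op_nonneg_add S_mono S) simp
    then show ?thesis
      by (simp add: S_Suc i)
  qed
  have tau_y: "tau (2 ^ k *\<^sub>R y k) \<le> (1/2) ^ k" for k
  proof -
    have yA: "y k \<in> A" and dA: "c (Suc k) - c k \<in> A"
      using y c N(2) by auto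
    have "tau (y k) = (n2 (c (Suc k) - c k))\<^sup>2"
      using dA by (simp add: n2_sq ip_def y_def)
    also have "\<dots> \<le> ((1/4) ^ k)\<^sup>2"
      by (rule power_mono[OF small n2_nonneg[OF dA]])
    also have "\<dots> = (1/16) ^ k"
      by (simp add: power2_eq_square power_mult_distrib[symmetric])
    finally have "tau (2 ^ k *\<^sub>R y k) \<le> 2 ^ k * (1/16) ^ k"
      using yA by (simp add: tau_scaleR)
    also have "\<dots> = (1/8) ^ k"
      by (simp add: power_mult_distrib[symmetric])
    also have "\<dots> \<le> (1/2) ^ k"
      by (rule power_mono) simp_all
    finally show ?thesis .
  qed
  have tau_S: "tau (S m n) \<le> 2 * (1/2) ^ m - 2 * (1/2) ^ (m + n)" for m n
  proof (induction n)
    case (Suc n)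
    have "S m n \<in> A" "2 ^ (m + n) *\<^sub>R y (m + n) \<in> A"
      using S y N(2) by auto
    then show ?case
      using Suc.IH tau_y[of "m + n"] by (simp add: S_Suc tau_add power_add)
  qed (simp add: S_def)
  define r where "r m n = resolvent (S m n)" for m n
  have r: "op_nonneg (r m n)" "op_nonneg (id_blinfun - r m n)" for m n
    unfolding r_def by (intro resolvent_facts S)+
  have rN: "r m n \<in> N" for m n
    unfolding r_def resolvent_def
    by (intro N.fun_calc_closed op_nonneg_hermitian S continuous_resolvent)
  have r_dec: "op_nonneg (r m n - r m n')" if "n \<le> n'" for m n n'
    unfolding r_def by (intro resolvent_antitone S S_mono that)
  have "\<forall>m. \<exists>R. (\<forall>x. (\<lambda>n. r m n x) \<longlonglongrightarrow> blinfun_apply R x) \<and> op_nonneg R \<and> (\<forall>n. op_nonneg (r m n - R))"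
  proof
    fix m
    show "\<exists>R. (\<forall>x. (\<lambda>n. r m n x) \<longlonglongrightarrow> blinfun_apply R x) \<and> op_nonneg R \<and> (\<forall>n. op_nonneg (r m n - R))"
      by (rule decreasing_strong_limit[of "r m", OF r(1) r_dec]) blast+
  qed
  then obtain R where R: "\<And>m x. (\<lambda>n. r m n x) \<longlonglongrightarrow> blinfun_apply (R m) x" "\<And>m. op_nonneg (R m)"
      "\<And>m n. op_nonneg (r m n - R m)"
    by metis
  have RN: "R m \<in> N" for m
    by (rule N.strong_limit_closed[OF rN R(1)])
  have compl: "(\<lambda>n. (id_blinfun - r m n) x) \<longlonglongrightarrow> (id_blinfun - R m) x" for m x
    using tendsto_diff[OF tendsto_const R(1)] by (simp add: blinfun.bilinear_simps)
  have R1: "op_nonneg (id_blinfun - R m)" for m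
    by (rule op_nonneg_strong_limit[OF r(2) compl])
  have tau_R: "tau (id_blinfun - R m) \<le> 2 * (1/2) ^ m" for m
  proof (rule tau_normal[OF _ _ _ compl])
    fix n
    show "id_blinfun - r m n \<in> A"
      using rN N(2) by auto
    show "hermitian (id_blinfun - r m n)"
      by (rule op_nonneg_hermitian[OF r(2)])
    show "op_nonneg ((id_blinfun - r m n) - (id_blinfun - r m k))" if "k \<le> n" for k
      using r_dec[OF that] by simp
    have "tau (id_blinfun - r m n) \<le> tau (S m n)"
      using S N(2) rN resolvent_facts(4)[OF S(2)] by (intro tau_mono) (auto simp: r_def op_le_def)
    also have "\<dots> \<le> 2 * (1/2) ^ m - 2 * (1/2) ^ (m + n)"
      by (rule tau_S)
    also have "\<dots> \<le> 2 * (1/2) ^ m"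
      by simp
    finally show "tau (id_blinfun - r m n) \<le> 2 * (1/2) ^ m" .
  qed
  have norm_le: "norm ((c (Suc k) - c k) o\<^sub>L R m) \<le> sqrt (1/2) ^ k" if "m \<le> k" for m k
  proof (rule norm_blinfun_bound)
    fix x
    let ?d = "c (Suc k) - c k"
    have "norm (?d (r m n x)) \<le> sqrt (1/2) ^ k * norm x" if n: "n > k" for n
    proof (rule power2_le_imp_le)
      let ?v = "r m n x"
      have "0 \<le> inner ?v ((S m n - 2 ^ k *\<^sub>R y k) ?v)"
        using n \<open>m \<le> k\<close> by (intro op_nonneg_inner y_le_S) auto
      moreover have "inner ?v (y k ?v) = (norm (?d ?v))\<^sup>2"
        using adj_inner[of ?d ?v "?d ?v"] c by (simp add: y_def N.bounded power2_norm_eq_inner)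
      ultimately have "2 ^ k * (norm (?d ?v))\<^sup>2 \<le> inner ?v (S m n ?v)"
        by (simp add: blinfun.diff_left blinfun.scaleR_left inner_diff_right)
      also have "\<dots> \<le> (norm x)\<^sup>2"
        unfolding r_def by (rule resolvent_inner_le[OF S(2)])
      finally have "(norm (?d ?v))\<^sup>2 \<le> (1/2) ^ k * (norm x)\<^sup>2"
        by (simp add: power_divide field_simps)
      also have "(1/2) ^ k = (sqrt (1/2) ^ k)\<^sup>2"
        by (simp add: power_mult[symmetric] mult.commute[of k 2]) (simp add: power_mult)
      finally show "(norm (?d ?v))\<^sup>2 \<le> (sqrt (1/2) ^ k * norm x)\<^sup>2"
        by (simp only: power_mult_distrib)
    qed simp
    then have "\<exists>M. \<forall>n\<ge>M. norm (?d (r m n x)) \<le> sqrt (1/2) ^ k * norm x"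
      using Suc_le_lessD by blast
    then have "norm (?d (R m x)) \<le> sqrt (1/2) ^ k * norm x"
      by (rule LIMSEQ_le_const2[OF tendsto_norm[OF blinfun.tendsto[OF tendsto_const R(1)]]])
    then show "norm ((?d o\<^sub>L R m) x) \<le> sqrt (1/2) ^ k * norm x"
      by simp
  qed simp
  have R_mono: "op_nonneg (R (Suc m) - R m)" for m
  proof (rule op_nonneg_strong_limit)
    fix n
    have "S m (Suc n) - S (Suc m) n = 2 ^ m *\<^sub>R y m"
      by (simp add: S_Suc')
    then show "op_nonneg (r (Suc m) n - r m (Suc n))"
      unfolding r_def using y by (intro resolvent_antitone S) (simp add: op_nonneg_scaleR)
  next
    fix x
    show "(\<lambda>n. (r (Suc m) n - r m (Suc n)) x) \<longlonglongrightarrow> (R (Suc m) - R m) x"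
      using tendsto_diff[OF R(1)[of "Suc m" x] LIMSEQ_Suc[OF R(1)[of m x]]] by (simp add: blinfun.bilinear_simps)
  qed
  show thesis
    by (rule that[OF RN R(2) R1 tau_R norm_le R_mono])
qed

text \<open>
  The weights \<open>R\<^sub>m\<close> of \<open>egorov_weights\<close> increase to 1, because the trace of \<open>1 - R\<^sub>m\<close> tends to 0 and
  the trace is faithful. So the ranges of the \<open>R\<^sub>m\<close> are jointly dense and the bounded
  sequence \<open>c\<^sub>k\<close> converges strongly, to \<open>b\<close> say. In the \<open>L\<^sup>2\<close> norm, \<open>(c\<^sub>k - b) R\<^sub>m\<close> is small by convergence in operator
  norm, and \<open>(c\<^sub>k - b) (1 - R\<^sub>m)\<close> is small because \<open>1 - R\<^sub>m\<close> is.
\<close>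

lemma ball_complete_fast:
  assumes N: "vn_algebra N" "N \<subseteq> A" and c: "\<And>k. c k \<in> N" and small: "\<And>k. n2 (c (Suc k) - c k) \<le> (1/4) ^ k"
    and bnd: "\<And>k. norm (c k) \<le> C"
  obtains b where "b \<in> N" "norm b \<le> C" "\<And>x. (\<lambda>k. c k x) \<longlonglongrightarrow> blinfun_apply b x" "(\<lambda>k. n2 (c k - b)) \<longlonglongrightarrow> 0"
proof -
  interpret N: vn_algebra N by fact
  obtain R where R: "\<And>m. R m \<in> N" "\<And>m. op_nonneg (R m)" "\<And>m. op_nonneg (id_blinfun - R m)"
    "\<And>m. tau (id_blinfun - R m) \<le> 2 * (1/2) ^ m"
    "\<And>m k. m \<le> k \<Longrightarrow> norm ((c (Suc k) - c k) o\<^sub>L R m) \<le> sqrt (1/2) ^ k"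
    "\<And>m. op_nonneg (R (Suc m) - R m)"
    by (rule egorov_weights[OF N c small]) (rule that)
  have A: "R m \<in> A" "id_blinfun - R m \<in> A" "c k \<in> A" for m k
    using R(1) c N(2) by auto
  have C0: "0 \<le> C"
    using bnd[of 0] norm_ge_zero order_trans by blast
  have norm_compl: "norm (id_blinfun - R m) \<le> 1" for m
    using op_nonneg_norm_mono[OF R(3)[of m], of id_blinfun] R(2)[of m] norm_blinfun_id_le order_trans by fastforce
  have half: "(\<lambda>m. 2 * (1/2::real) ^ m) \<longlonglongrightarrow> 0"
    by (intro tendsto_mult_right_zero LIMSEQ_realpow_zero) auto
  have n2_compl: "(\<lambda>m. n2 (id_blinfun - R m)) \<longlonglongrightarrow> 0"
  proof -
    have "(n2 (id_blinfun - R m))\<^sup>2 \<le> 2 * (1/2) ^ m" for m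
      using n2_sq_le_tau[OF A(2) R(3) norm_compl] R(4) order_trans by blast
    then have "(\<lambda>m. (n2 (id_blinfun - R m))\<^sup>2) \<longlonglongrightarrow> 0"
      by (intro tendsto_sandwich[OF _ _ tendsto_const half]) auto
    then have "(\<lambda>m. sqrt ((n2 (id_blinfun - R m))\<^sup>2)) \<longlonglongrightarrow> sqrt 0"
      by (rule tendsto_real_sqrt)
    then show ?thesis
      using A by simp
  qed
  have R_id: "(\<lambda>m. (id_blinfun - R m) x) \<longlonglongrightarrow> 0" for x
  proof -
    have "op_nonneg ((id_blinfun - R m) - (id_blinfun - R n))" if "m \<le> n" for m n
      using that
    proof (induction n rule: dec_induct)
      case (step n)
      then show ?case
        using op_nonneg_add[OF step.IH R(6)[of n]] by simp
    qed simp
    then obtain Z where Z: "\<And>x. (\<lambda>m. (id_blinfun - R m) x) \<longlonglongrightarrow> blinfun_apply Z x" "op_nonneg Z"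
      "\<And>m. op_nonneg ((id_blinfun - R m) - Z)"
      using decreasing_strong_limit[of "\<lambda>m. id_blinfun - R m", OF R(3)] by blast
    have ZA: "Z \<in> A"
      by (rule strong_limit_closed[OF A(2) Z(1)])
    have "tau Z \<le> 2 * (1/2) ^ m" for m
      using tau_mono[OF ZA A(2)[of m]] Z(3)[of m] R(4)[of m] by (simp add: op_le_def)
    then have "tau Z \<le> 0"
      by (intro LIMSEQ_le_const[OF half]) auto
    moreover have "norm Z \<le> 1"
      using op_nonneg_norm_mono[OF Z(2) Z(3)[of 0]] norm_compl[of 0] by simp
    ultimately have "n2 Z = 0"
      using n2_sq_le_tau[OF ZA Z(2)] by (smt (verit) zero_le_power2 power2_eq_iff zero_power2)
    then show ?thesis
      using Z(1) n2_eq_0[OF ZA] by (simp add: blinfun.bilinear_simps)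
  qed
  have conv_R: "convergent (\<lambda>k. c k o\<^sub>L R m)" for m
  proof (rule convergent_geometric)
    show "norm ((c (Suc k) o\<^sub>L R m) - (c k o\<^sub>L R m)) \<le> sqrt (1/2) ^ k" if "k \<ge> m" for k
      using R(5)[OF that] by (simp add: compose_simps)
  qed simp_all
  have "convergent (\<lambda>k. c k x)" for x
  proof -
    have "Cauchy (\<lambda>k. c k x)"
    proof (rule CauchyI)
      fix e :: real assume e: "e > 0"
      have "\<exists>m. norm ((id_blinfun - R m) x) < e / (4 * (C + 1))"
        using LIMSEQ_D[OF R_id[of x], of "e / (4 * (C + 1))"] e C0 by auto
      then obtain m where m: "norm ((id_blinfun - R m) x) < e / (4 * (C + 1))"
        by blast
      let ?z = "(id_blinfun - R m) x"
      have "convergent (\<lambda>k. (c k o\<^sub>L R m) x)"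
        using conv_R[of m] blinfun.tendsto[OF _ tendsto_const] unfolding convergent_def by blast
      then obtain M where M: "\<And>i j. i \<ge> M \<Longrightarrow> j \<ge> M \<Longrightarrow> norm (c i (R m x) - c j (R m x)) < e / 2"
        using CauchyD[of "\<lambda>k. (c k o\<^sub>L R m) x" "e / 2"] e by (auto simp: Cauchy_convergent_iff)
      have z: "norm (c k ?z) < e / 4" for k
      proof -
        have "norm (c k ?z) \<le> C * norm ?z"
          using norm_blinfun[of "c k" ?z] mult_right_mono[OF bnd[of k], of "norm ?z"] by simp
        also have "\<dots> \<le> (C + 1) * norm ?z"
          by (intro mult_right_mono) auto
        also have "\<dots> < (C + 1) * (e / (4 * (C + 1)))"
          using m C0 by (intro mult_strict_left_mono) auto
        also have "\<dots> = e / 4"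
          using C0 by (simp add: field_simps)
        finally show ?thesis .
      qed
      have "norm (c i x - c j x) < e" if "i \<ge> M" "j \<ge> M" for i j
      proof -
        have "c i x - c j x = c i ?z - c j ?z + (c i (R m x) - c j (R m x))"
          by (simp add: blinfun.bilinear_simps)
        then have "norm (c i x - c j x) \<le> norm (c i ?z) + norm (c j ?z) + norm (c i (R m x) - c j (R m x))"
          using norm_triangle_ineq[of "c i ?z - c j ?z" "c i (R m x) - c j (R m x)"]
            norm_triangle_ineq4[of "c i ?z" "c j ?z"] by simp
        then show ?thesis
          using z[of i] z[of j] M[OF that] by linarith
      qed
      then show "\<exists>M. \<forall>i\<ge>M. \<forall>j\<ge>M. norm (c i x - c j x) < e"
        by blast
    qed
    then show ?thesis
      by (simp add: Cauchy_convergent_iff)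
  qed
  then obtain b where b: "\<And>x. (\<lambda>k. c k x) \<longlonglongrightarrow> blinfun_apply b x" "norm b \<le> C"
    using strong_limit_exists[of c C] bnd by blast
  have bN: "b \<in> N"
    by (rule N.strong_limit_closed[OF c b(1)])
  then have bA: "b \<in> A"
    using N(2) by blast
  have norm_lim: "(\<lambda>k. norm ((c k - b) o\<^sub>L R m)) \<longlonglongrightarrow> 0" for m
  proof -
    obtain L where L: "(\<lambda>k. c k o\<^sub>L R m) \<longlonglongrightarrow> L"
      using conv_R[of m] unfolding convergent_def by blast
    have "L = b o\<^sub>L R m"
    proof (rule blinfun_eqI)
      fix x
      show "L x = (b o\<^sub>L R m) x"
        using blinfun.tendsto[OF L tendsto_const, of x] b(1)[of "R m x"] by (simp add: LIMSEQ_unique)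
    qed
    then show ?thesis
      using tendsto_norm_zero[OF Lim_null[THEN iffD1, OF L]] by (simp add: compose_simps)
  qed
  have "(\<lambda>k. n2 (c k - b)) \<longlonglongrightarrow> 0"
  proof (rule LIMSEQ_I)
    fix e :: real assume e: "e > 0"
    obtain m where m: "n2 (id_blinfun - R m) < e / (4 * (C + 1))"
      using LIMSEQ_D[OF n2_compl, of "e / (4 * (C + 1))"] e C0 A by auto
    obtain M where M: "\<And>k. k \<ge> M \<Longrightarrow> norm ((c k - b) o\<^sub>L R m) < e / 2"
      using LIMSEQ_D[OF norm_lim[of m], of "e / 2"] e by auto
    have "norm (n2 (c k - b) - 0) < e" if "k \<ge> M" for k
    proof -
      let ?d = "c k - b"
      have dA: "?d \<in> A"
        using A bA by simp
      have "?d = (?d o\<^sub>L R m) + (?d o\<^sub>L (id_blinfun - R m))"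
        by (simp add: compose_simps)
      then have "n2 ?d \<le> n2 (?d o\<^sub>L R m) + n2 (?d o\<^sub>L (id_blinfun - R m))"
        using n2_triangle[of "?d o\<^sub>L R m" "?d o\<^sub>L (id_blinfun - R m)"] dA A by simp
      also have "n2 (?d o\<^sub>L R m) \<le> norm (?d o\<^sub>L R m)"
        using dA A by (intro n2_le_norm) simp
      also have "n2 (?d o\<^sub>L (id_blinfun - R m)) \<le> norm ?d * n2 (id_blinfun - R m)"
        using dA A by (intro n2_mult_left) simp_all
      also have "\<dots> \<le> (2 * (C + 1)) * n2 (id_blinfun - R m)"
        using norm_triangle_ineq4[of "c k" b] bnd[of k] b(2) A by (intro mult_right_mono) auto
      also have "\<dots> \<le> (2 * (C + 1)) * (e / (4 * (C + 1)))"
        using m C0 by (intro mult_left_mono) auto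
      also have "\<dots> = e / 2"
        using C0 by (simp add: field_simps)
      finally show ?thesis
        using M[OF that] n2_nonneg[OF dA] by simp
    qed
    then show "\<exists>M. \<forall>k\<ge>M. norm (n2 (c k - b) - 0) < e"
      by blast
  qed
  then show thesis
    using that bN b by blast
qed

lemma ball_complete:
  assumes N: "vn_algebra N" "N \<subseteq> A" and b: "\<And>k. b k \<in> N" "\<And>k. norm (b k) \<le> C" "\<And>k. hermitian (b k)"
    and Cauchy: "\<And>e. e > 0 \<Longrightarrow> \<exists>M. \<forall>i\<ge>M. \<forall>j\<ge>M. n2 (b i - b j) < e"
  obtains b0 where "b0 \<in> N" "norm b0 \<le> C" "hermitian b0" "(\<lambda>k. n2 (b k - b0)) \<longlonglongrightarrow> 0"
proof -
  have "\<forall>k. \<exists>M. \<forall>i\<ge>M. \<forall>j\<ge>M. n2 (b i - b j) < (1/4) ^ k"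
    by (intro allI Cauchy) simp
  then obtain M where M: "\<And>k i j. i \<ge> M k \<Longrightarrow> j \<ge> M k \<Longrightarrow> n2 (b i - b j) < (1/4) ^ k"
    by metis
  \<comment> \<open>Both \<open>f k\<close> and \<open>f (Suc k)\<close> are at least \<open>M k\<close>, and \<open>f k\<close> tends to infinity.\<close>
  define f where "f k = k + (\<Sum>i\<le>k. M i)" for k
  have f: "M k \<le> f k" "M k \<le> f (Suc k)" "k \<le> f k" for k
    using member_le_sum[of k "{..k}" M] by (auto simp: f_def)
  obtain b0 where b0: "b0 \<in> N" "norm b0 \<le> C" "\<And>x. (\<lambda>k. b (f k) x) \<longlonglongrightarrow> blinfun_apply b0 x"
      "(\<lambda>k. n2 (b (f k) - b0)) \<longlonglongrightarrow> 0"
    using ball_complete_fast[OF N, of "\<lambda>k. b (f k)" C] b M f less_imp_le by metis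
  have A: "b k \<in> A" "b0 \<in> A" for k
    using b(1) b0(1) N(2) by auto
  have "(\<lambda>k. n2 (b k - b0)) \<longlonglongrightarrow> 0"
  proof (rule LIMSEQ_I)
    fix e :: real assume e: "e > 0"
    obtain K where K: "\<And>i j. i \<ge> K \<Longrightarrow> j \<ge> K \<Longrightarrow> n2 (b i - b j) < e / 2"
      using Cauchy[of "e / 2"] e by auto
    obtain K' where K': "\<And>k. k \<ge> K' \<Longrightarrow> n2 (b (f k) - b0) < e / 2"
      using LIMSEQ_D[OF b0(4), of "e / 2"] e A by auto
    let ?k = "max K K'"
    have "norm (n2 (b i - b0) - 0) < e" if "i \<ge> K" for i
    proof -
      have "K \<le> f ?k"
        using f(3)[of ?k] by simp
      then have "n2 (b i - b0) < e"
        using K[OF that, of "f ?k"] K'[of ?k] n2_triangle_diff[OF A(1) A(1) A(2), of i "f ?k"] by simp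
      then show ?thesis
        using n2_nonneg[of "b i - b0"] A by simp
    qed
    then show "\<exists>K. \<forall>k\<ge>K. norm (n2 (b k - b0) - 0) < e"
      by blast
  qed
  moreover have "hermitian b0"
    by (rule hermitian_strong_limit[OF b(3) b0(3)])
  ultimately show thesis
    using that b0 by blast
qed

end

section \<open>Conditional expectations\<close>

context tracial
begin

lemma tau_scale_ii_hermitian_compose:
  assumes "x \<in> A" "c \<in> A" "hermitian x" "hermitian c"
  shows "tau (scale_op \<i> (x o\<^sub>L c)) = 0"
proof -
  have "adj (scale_op \<i> (x o\<^sub>L c)) = - scale_op \<i> (c o\<^sub>L x)"
    using assms by (simp add: adj_scale_ii adj_simps bounded self_adjoints_def)
  then have "tau (scale_op \<i> (x o\<^sub>L c)) = - tau (scale_op \<i> (c o\<^sub>L x))"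
    using tau_adj[of "scale_op \<i> (x o\<^sub>L c)"] assms by (simp add: tau_minus)
  moreover have "tau (scale_op \<i> (c o\<^sub>L x)) = tau (scale_op \<i> (x o\<^sub>L c))"
    using assms by (simp add: tau_def E_scale E_commute[of c x])
  ultimately show ?thesis
    by simp
qed

text \<open>
  The spectrum of \<open>b\<close> is cut off at the interval \<open>[-\<parallel>a\<parallel>, \<parallel>a\<parallel>]\<close>. The part \<open>P\<^sup>2 - Q\<^sup>2\<close> that is cut
  off lives where the remainder \<open>b'\<close> equals \<open>\<plusminus>\<parallel>a\<parallel>\<close>, and there \<open>a\<close> lies on the inner side, so
  that its inner product with \<open>a - b'\<close> is not positive.
\<close>

lemma truncation_closer:
  assumes N: "vn_algebra N" "N \<subseteq> A" and a: "a \<in> A" "hermitian a" and b: "b \<in> N" "hermitian b"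
  shows "\<exists>b'\<in>N. hermitian b' \<and> norm b' \<le> norm a \<and> n2 (a - b') \<le> n2 (a - b)"
proof -
  interpret N: vn_algebra N by fact
  let ?R = "norm a"
  define t where "t x = max (- ?R) (min x ?R)" for x
  define p where "p x = sqrt (max (x - ?R) 0)" for x
  define q where "q x = sqrt (max (- x - ?R) 0)" for x
  have c: "continuous_on UNIV t" "continuous_on UNIV p" "continuous_on UNIV q"
    unfolding t_def p_def q_def by (intro continuous_intros)+
  note cm = c[THEN continuous_on_mult]
  define b' P Q where "b' = fun_calc t b" and "P = fun_calc p b" and "Q = fun_calc q b"
  have mem: "b' \<in> N" "P \<in> N" "Q \<in> N"
    unfolding b'_def P_def Q_def using b c by (auto intro: N.fun_calc_closed)
  have h: "hermitian b'" "hermitian P" "hermitian Q"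
    unfolding b'_def P_def Q_def using b c by (auto intro: hermitian_fun_calc)
  have mA: "b' \<in> A" "P \<in> A" "Q \<in> A" "b \<in> A"
    using mem b N(2) by auto
  have PP: "P o\<^sub>L P = fun_calc (\<lambda>x. p x * p x) b" and QQ: "Q o\<^sub>L Q = fun_calc (\<lambda>x. q x * q x) b"
    unfolding P_def Q_def using fun_calc_mult[OF b(2)] c by auto
  have R0: "0 \<le> ?R"
    by simp
  have "fun_calc (\<lambda>x. t x + p x * p x - q x * q x) b = b' + (P o\<^sub>L P) - (Q o\<^sub>L Q)"
    unfolding PP QQ b'_def
    using fun_calc_diff[OF b(2) continuous_on_add[OF c(1) cm(2)[OF c(2)]] cm(3)[OF c(3)]]
      fun_calc_add[OF b(2) c(1) cm(2)[OF c(2)]] by simp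
  moreover have "(\<lambda>x. t x + p x * p x - q x * q x) = (\<lambda>x. x)"
    by (auto simp: fun_eq_iff t_def p_def q_def max_def min_def) (smt (verit) norm_ge_zero)
  ultimately have decomp: "b = b' + (P o\<^sub>L P) - (Q o\<^sub>L Q)"
    by (simp add: fun_calc_id_const[OF b(2)])
  have "P o\<^sub>L P o\<^sub>L b' = fun_calc (\<lambda>x. (p x * p x) * t x) b"
    unfolding PP b'_def by (rule fun_calc_mult[OF b(2) cm(2)[OF c(2)] c(1), symmetric])
  moreover have "(\<lambda>x. (p x * p x) * t x) = (\<lambda>x. ?R * (p x * p x))"
    using R0 by (auto simp: fun_eq_iff t_def p_def max_def min_def)
  ultimately have Pt: "P o\<^sub>L P o\<^sub>L b' = ?R *\<^sub>R (P o\<^sub>L P)"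
    using fun_calc_scale[OF b(2) cm(2)[OF c(2)], of ?R] PP by simp
  have "Q o\<^sub>L Q o\<^sub>L b' = fun_calc (\<lambda>x. (q x * q x) * t x) b"
    unfolding QQ b'_def by (rule fun_calc_mult[OF b(2) cm(3)[OF c(3)] c(1), symmetric])
  moreover have "(\<lambda>x. (q x * q x) * t x) = (\<lambda>x. (- ?R) * (q x * q x))"
    by (auto simp: fun_eq_iff t_def q_def max_def min_def) (smt (verit) norm_ge_zero)
  ultimately have Qt: "Q o\<^sub>L Q o\<^sub>L b' = (- ?R) *\<^sub>R (Q o\<^sub>L Q)"
    using fun_calc_scale[OF b(2) cm(3)[OF c(3)], of "- ?R"] QQ by simp
  have sandwich: "0 \<le> tau (x o\<^sub>L x o\<^sub>L y)" if "x \<in> A" "hermitian x" "y \<in> A" "op_nonneg y" for x y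
  proof -
    have "op_nonneg (adj x o\<^sub>L y o\<^sub>L x)"
      by (rule op_nonneg_adj_sandwich[OF that(4) bounded[OF that(1)]])
    then have "0 \<le> tau (x o\<^sub>L y o\<^sub>L x)"
      using that by (intro tau_nonneg) (auto simp: self_adjoints_def)
    then show ?thesis
      using that tau_commute[of "x o\<^sub>L y" x] by (simp add: compose_assoc)
  qed
  let ?W = "(P o\<^sub>L P) - (Q o\<^sub>L Q)"
  have W: "b = b' + ?W" "?W \<in> A" "adj ?W = ?W"
    using decomp mA h by (simp_all add: adj_simps bounded self_adjoints_def)
  have "ip ?W (a - b') \<le> 0"
  proof -
    have 1: "P o\<^sub>L P o\<^sub>L (?R *\<^sub>R id_blinfun - a) = - (P o\<^sub>L P o\<^sub>L (a - b'))"
      by (simp add: compose_simps Pt)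
    have 2: "Q o\<^sub>L Q o\<^sub>L (?R *\<^sub>R id_blinfun + a) = Q o\<^sub>L Q o\<^sub>L (a - b')"
      by (simp add: compose_simps Qt)
    have "0 \<le> tau (- (P o\<^sub>L P o\<^sub>L (a - b')))" "0 \<le> tau (Q o\<^sub>L Q o\<^sub>L (a - b'))"
      unfolding 1[symmetric] 2[symmetric]
      using mA h a op_nonneg_norm_minus[OF a(2) order_refl] by (auto intro!: sandwich)
    moreover have "ip ?W (a - b') = tau (P o\<^sub>L P o\<^sub>L (a - b')) - tau (Q o\<^sub>L Q o\<^sub>L (a - b'))"
      using mA a by (simp add: ip_def W(3) compose_simps(3) tau_diff)
    ultimately show ?thesis
      using mA a by (simp add: tau_minus)
  qed
  moreover have "(n2 (a - b))\<^sup>2 = (n2 (a - b'))\<^sup>2 - 2 * ip ?W (a - b') + (n2 ?W)\<^sup>2"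
  proof -
    have "a - b = (a - b') - ?W"
      using W(1) by simp
    then show ?thesis
      using W(2) mA a ip_commute[of ?W "a - b'"] by (simp only:) (simp add: n2_sq ip_simps)
  qed
  ultimately have "(n2 (a - b'))\<^sup>2 \<le> (n2 (a - b))\<^sup>2"
    by (smt (verit) zero_le_power2)
  then have "n2 (a - b') \<le> n2 (a - b)"
    by (rule power2_le_imp_le) (simp add: a mA)
  moreover have "\<bar>t x\<bar> \<le> ?R" for x
    unfolding t_def max_def min_def using R0 by (smt (verit))
  then have "norm b' \<le> ?R"
    unfolding b'_def by (intro norm_fun_calc_le[OF num_range_norm[OF b(2)] c(1)] R0)
  ultimately show ?thesis
    using mem h by blast
qed

text \<open>
  By \<open>truncation_closer\<close>, a minimizing sequence for the \<open>L\<^sup>2\<close> distance of \<open>a\<close> to \<open>N\<close> may be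
  taken in the ball of radius \<open>\<parallel>a\<parallel>\<close>, which is complete; the difference of \<open>a\<close> and the
  minimizer is then orthogonal to all of \<open>N\<close>.
\<close>

lemma hermitian_projection:
  assumes N: "vn_algebra N" "N \<subseteq> A" and a: "a \<in> A" "hermitian a"
  shows "\<exists>b\<in>N. hermitian b \<and> norm b \<le> norm a \<and> (\<forall>c\<in>N. tau (a o\<^sub>L c) = tau (b o\<^sub>L c))"
proof -
  interpret N: vn_algebra N by fact
  define K where "K = {b \<in> N. hermitian b \<and> norm b \<le> norm a}"
  define q where "q b = (n2 (a - b))\<^sup>2" for b
  have KA: "b \<in> A" if "b \<in> K" for b
    using that N(2) by (auto simp: K_def)
  have "0 \<in> K"
    by (simp add: K_def)
  have par: "\<exists>z\<in>K. (n2 (x - y))\<^sup>2 \<le> 2 * (q x + q y - 2 * q z)" if "x \<in> K" "y \<in> K" for x y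
  proof
    let ?z = "(1/2) *\<^sub>R (x + y)"
    have "norm ?z \<le> norm a"
      using that norm_triangle_ineq[of x y] by (simp add: K_def)
    then show "?z \<in> K"
      using that by (auto simp: K_def hermitian_closed)
    show "(n2 (x - y))\<^sup>2 \<le> 2 * (q x + q y - 2 * q ?z)"
      using KA[OF that(1)] KA[OF that(2)] a ip_commute[of x y] ip_commute[of a x] ip_commute[of a y]
      by (simp add: q_def n2_sq ip_simps) (simp add: field_simps)
  qed
  have ne: "K \<noteq> {}"
    using \<open>0 \<in> K\<close> by blast
  have low: "0 \<le> q x" for x
    by (simp add: q_def)
  obtain b :: "nat \<Rightarrow> 'h operator" and m where b: "\<And>n. b n \<in> K" and m: "\<And>x. x \<in> K \<Longrightarrow> m \<le> q x"
    and lim: "(\<lambda>n. q (b n)) \<longlonglongrightarrow> m"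
    and Cau: "\<And>e. e > 0 \<Longrightarrow> \<exists>M. \<forall>i\<ge>M. \<forall>j\<ge>M. (n2 (b i - b j))\<^sup>2 < e"
    by (rule minimizing_sequence[OF ne low par]) (assumption+, rule that)
  have Cau': "\<exists>M. \<forall>i\<ge>M. \<forall>j\<ge>M. n2 (b i - b j) < e" if e: "e > 0" for e
  proof -
    obtain M where "\<forall>i\<ge>M. \<forall>j\<ge>M. (n2 (b i - b j))\<^sup>2 < e\<^sup>2"
      using Cau[of "e\<^sup>2"] e by auto
    then show ?thesis
      using e by (meson less_imp_le power2_less_imp_less)
  qed
  have bN: "b k \<in> N" "norm (b k) \<le> norm a" "hermitian (b k)" for k
    using b[of k] by (auto simp: K_def)
  obtain b0 where b0: "b0 \<in> N" "norm b0 \<le> norm a" "hermitian b0" "(\<lambda>k. n2 (b k - b0)) \<longlonglongrightarrow> 0"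
    by (rule ball_complete[OF N bN Cau']) (assumption, rule that)
  have b0A: "b0 \<in> A"
    using b0(1) N(2) by auto
  have "(\<lambda>k. n2 (a - b k)) \<longlonglongrightarrow> n2 (a - b0)"
  proof (rule LIMSEQ_I)
    fix e :: real assume e: "e > 0"
    obtain M where M: "\<And>k. k \<ge> M \<Longrightarrow> norm (n2 (b k - b0)) < e"
      using LIMSEQ_D[OF b0(4) e] by auto
    have "norm (n2 (a - b k) - n2 (a - b0)) < e" if "k \<ge> M" for k
    proof -
      have "n2 (a - b k) \<le> n2 (a - b0) + n2 (b0 - b k)" "n2 (a - b0) \<le> n2 (a - b k) + n2 (b k - b0)"
        using a KA[OF b] b0A by (auto intro: n2_triangle_diff)
      moreover have "n2 (b0 - b k) = n2 (b k - b0)"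
        using KA[OF b] b0A by (intro n2_minus_commute)
      ultimately show ?thesis
        using M[OF that] by (simp add: abs_less_iff)
    qed
    then show "\<exists>M. \<forall>k\<ge>M. norm (n2 (a - b k) - n2 (a - b0)) < e"
      by blast
  qed
  then have "(\<lambda>k. q (b k)) \<longlonglongrightarrow> q b0"
    unfolding q_def by (rule tendsto_power)
  then have qb0: "q b0 = m"
    using lim LIMSEQ_unique by blast
  have min: "q b0 \<le> q x" if x: "x \<in> N" "hermitian x" for x
  proof -
    obtain x' where x': "x' \<in> K" "n2 (a - x') \<le> n2 (a - x)"
      using truncation_closer[OF N a x] by (auto simp: K_def)
    have "q b0 \<le> q x'"
      using m[OF x'(1)] qb0 by simp
    also have "\<dots> \<le> q x"
      unfolding q_def using x' a KA by (intro power_mono) auto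
    finally show ?thesis .
  qed
  let ?e = "a - b0"
  have eA: "?e \<in> A" and eh: "hermitian ?e"
    using a b0 b0A by (auto simp: hermitian_closed)
  have orth: "tau (?e o\<^sub>L c) = 0" if c: "c \<in> N" "hermitian c" for c
  proof -
    have cA: "c \<in> A"
      using c N(2) by auto
    have "(ip ?e c)\<^sup>2 \<le> 0 * ip c c"
    proof (rule quadratic_nonneg_discriminant)
      fix r
      have "q (b0 - r *\<^sub>R c) = q b0 + 2 * r * ip ?e c + r\<^sup>2 * ip c c"
      proof -
        have "a - (b0 - r *\<^sub>R c) = ?e + r *\<^sub>R c"
          by simp
        then show ?thesis
          unfolding q_def using eA cA ip_commute[of c ?e]
          by (simp only:) (simp add: n2_sq ip_simps(1,2,5,6), simp add: power2_eq_square algebra_simps)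
      qed
      then show "0 \<le> 0 + 2 * r * ip ?e c + r\<^sup>2 * ip c c"
        using min[of "b0 - r *\<^sub>R c"] c b0 by (simp add: hermitian_closed)
    qed (simp add: ip_nonneg cA)
    then show ?thesis
      using eh by (simp add: ip_def self_adjoints_def)
  qed
  have "tau (a o\<^sub>L c) = tau (b0 o\<^sub>L c)" if c: "c \<in> N" for c
  proof -
    note r = N.op_re_im_closed[OF c]
    have rA: "op_re c \<in> A" "op_im c \<in> A"
      using r N(2) by auto
    have "?e o\<^sub>L c = (?e o\<^sub>L op_re c) + scale_op \<i> (?e o\<^sub>L op_im c)"
      using arg_cong[OF r(5), of "\<lambda>x. ?e o\<^sub>L x"] bounded[OF eA] by (simp only: compose_simps(2) scale_op_compose(2))
    then have "tau (?e o\<^sub>L c) = tau (?e o\<^sub>L op_re c) + tau (scale_op \<i> (?e o\<^sub>L op_im c))"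
      using eA rA by (simp add: tau_add)
    also have "\<dots> = 0"
      using orth[OF r(1,2)] tau_scale_ii_hermitian_compose[OF eA rA(2) eh r(4)] by simp
    finally show ?thesis
      using c N(2) a b0A by (simp add: compose_simps tau_diff subset_iff)
  qed
  then show ?thesis
    using b0 by blast
qed

text \<open>
  As \<open>N\<close> will be closed under adjoints, this says that \<open>b\<close> is the orthogonal projection of \<open>a\<close>
  to \<open>N\<close> for the \<open>L\<^sup>2\<close> inner product.
\<close>

definition is_proj :: "'h operator set \<Rightarrow> 'h operator \<Rightarrow> 'h operator \<Rightarrow> bool" where
  "is_proj N a b \<longleftrightarrow> b \<in> N \<and> (\<forall>c\<in>N. tau (a o\<^sub>L c) = tau (b o\<^sub>L c))"

end

locale subalgebra = tracial A E + N: vn_algebra N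
  for A :: "'h::complex_hilbert operator set" and E N +
  assumes sub: "N \<subseteq> A"
begin

lemma N_A [simp]: "b \<in> N \<Longrightarrow> b \<in> A"
  using sub by auto

lemma is_proj_unique:
  assumes "is_proj N a b" "is_proj N a b'"
  shows "b = b'"
proof -
  let ?d = "b - b'"
  have mem: "b \<in> N" "b' \<in> N"
    using assms by (auto simp: is_proj_def)
  then have "tau (b o\<^sub>L adj ?d) = tau (b' o\<^sub>L adj ?d)"
    using assms by (auto simp: is_proj_def)
  then have "tau (adj ?d o\<^sub>L ?d) = 0"
    using mem tau_commute[of "adj ?d" ?d] by (simp add: compose_simps tau_diff)
  then have "n2 ?d = 0"
    by (simp add: n2_def)
  then show ?thesis
    using n2_eq_0[of ?d] mem by simp
qed

lemma is_proj_add: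
  assumes "is_proj N a b" "is_proj N a' b'" "a \<in> A" "a' \<in> A"
  shows "is_proj N (a + a') (b + b')"
  using assms by (auto simp: is_proj_def compose_simps tau_add)

lemma is_proj_scale:
  assumes "is_proj N a b" "a \<in> A"
  shows "is_proj N (scale_op z a) (scale_op z b)"
proof -
  have "tau (scale_op z a o\<^sub>L c) = tau (scale_op z b o\<^sub>L c)" if "c \<in> N" for c
  proof -
    have *: "scale_op z x o\<^sub>L c = x o\<^sub>L scale_op z c" if "x \<in> A" for x
      using scale_op_compose(2)[OF bounded[OF that]] by (simp add: scale_op_compose(1))
    show ?thesis
      using assms that by (simp add: * is_proj_def)
  qed
  then show ?thesis
    using assms by (simp add: is_proj_def)
qed

lemma is_proj_exists:
  assumes a: "a \<in> A"
  shows "\<exists>b. is_proj N a b"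
proof -
  note r = op_re_im_closed[OF a]
  obtain x where x: "is_proj N (op_re a) x"
    using hermitian_projection[OF N.vn_algebra_axioms sub r(1,2)] by (auto simp: is_proj_def)
  obtain y where y: "is_proj N (op_im a) y"
    using hermitian_projection[OF N.vn_algebra_axioms sub r(3,4)] by (auto simp: is_proj_def)
  have "is_proj N (op_re a + scale_op \<i> (op_im a)) (x + scale_op \<i> y)"
    using r by (intro is_proj_add is_proj_scale x y) simp_all
  then show ?thesis
    using r(5) by metis
qed

text \<open>
  Positivity comes from the contraction property on self-adjoint elements: if
  \<open>0 \<le> a \<le> M\<close> then \<open>\<parallel>M - a\<parallel> \<le> M\<close>, so the projection \<open>b\<close> of \<open>a\<close> satisfies \<open>\<parallel>M - b\<parallel> \<le> M\<close>.
\<close>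

lemma is_proj_nonneg:
  assumes a: "a \<in> A" "op_nonneg a" and b: "is_proj N a b"
  shows "op_nonneg b"
proof -
  let ?M = "norm a"
  let ?a = "?M *\<^sub>R id_blinfun - a"
  have ha: "hermitian a"
    using a by (simp add: op_nonneg_hermitian)
  have "norm ?a \<le> norm (?M *\<^sub>R id_blinfun :: 'h operator)"
    using op_nonneg_norm_mono[of ?a "?M *\<^sub>R id_blinfun"] op_nonneg_norm_minus(1)[OF ha order_refl] a by simp
  also have "\<dots> \<le> ?M"
    using mult_left_mono[OF norm_blinfun_id_le, of ?M] by simp
  finally have nM: "norm ?a \<le> ?M" .
  have "hermitian ?a"
    using ha by (simp add: hermitian_closed)
  then obtain x where x: "x \<in> N" "hermitian x" "norm x \<le> norm ?a" "is_proj N ?a x"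
    using hermitian_projection[OF N.vn_algebra_axioms sub, of ?a] a by (auto simp: is_proj_def)
  have "is_proj N ?a (?M *\<^sub>R id_blinfun - b)"
    using b a by (auto simp: is_proj_def compose_simps tau_diff)
  then have "x = ?M *\<^sub>R id_blinfun - b"
    using is_proj_unique x(4) by blast
  then have "b = ?M *\<^sub>R id_blinfun - x"
    by simp
  then show ?thesis
    using op_nonneg_norm_minus(1)[OF x(2), of ?M] x(3) nM by simp
qed

lemma is_proj_of_cond_exp:
  assumes C: "is_cond_exp A E N C" and a: "a \<in> A"
  shows "is_proj N a (C a)"
proof -
  have "E (C (id_blinfun o\<^sub>L a o\<^sub>L c)) = E (id_blinfun o\<^sub>L a o\<^sub>L c)" if "c \<in> N" for c
    using C a that unfolding is_cond_exp_def by simp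
  moreover have "C (id_blinfun o\<^sub>L a o\<^sub>L c) = id_blinfun o\<^sub>L C a o\<^sub>L c" if "c \<in> N" for c
    using C a that unfolding is_cond_exp_def by (metis N.id_closed)
  ultimately have "E (a o\<^sub>L c) = E (C a o\<^sub>L c)" if "c \<in> N" for c
    using that by (metis compose_id(2))
  then show ?thesis
    using C a by (auto simp: is_proj_def tau_def is_cond_exp_def)
qed

text \<open>
  The projections have all properties of a conditional expectation. Conversely any map with
  these properties consists of projections, which are unique because the trace is faithful, so
  the definite description denotes the map built here.
\<close>

lemma cond_exp_is_proj:
  assumes a: "a \<in> A"
  shows "is_proj N a (cond_exp A E N a)"
proof -
  define C where "C = (\<lambda>a\<in>A. SOME b. is_proj N a b)"
  have C: "is_proj N a (C a)" if "a \<in> A" for a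
    using someI_ex[OF is_proj_exists[OF that]] that by (simp add: C_def)
  have CN: "C a \<in> N" if "a \<in> A" for a
    using C[OF that] by (simp add: is_proj_def)
  have eq: "C a = b" if "a \<in> A" "is_proj N a b" for a b
    using is_proj_unique[OF C[OF that(1)] that(2)] .
  have trace: "E (C a) = E a" if a: "a \<in> A" for a
  proof -
    have "tau a = tau (C a)"
      using C[OF a] by (auto simp: is_proj_def dest: bspec[of _ _ id_blinfun])
    moreover have "tau (scale_op \<i> a) = tau (scale_op \<i> (C a))"
      using is_proj_scale[OF C[OF a] a, of \<i>] by (auto simp: is_proj_def dest: bspec[of _ _ id_blinfun])
    ultimately show ?thesis
      using a CN[OF a] by (simp add: E_eq_tau)
  qed
  have bimod: "C (b o\<^sub>L a o\<^sub>L c) = b o\<^sub>L C a o\<^sub>L c" if "a \<in> A" "b \<in> N" "c \<in> N" for a b c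
  proof (rule eq)
    have "tau ((b o\<^sub>L a o\<^sub>L c) o\<^sub>L x) = tau ((b o\<^sub>L C a o\<^sub>L c) o\<^sub>L x)" if x: "x \<in> N" for x
    proof -
      have "tau ((b o\<^sub>L y o\<^sub>L c) o\<^sub>L x) = tau (y o\<^sub>L (c o\<^sub>L x o\<^sub>L b))" if "y \<in> A" for y
        using tau_commute[of b "y o\<^sub>L (c o\<^sub>L x)"] that \<open>b \<in> N\<close> \<open>c \<in> N\<close> x by (simp add: compose_assoc)
      then show ?thesis
        using C[OF \<open>a \<in> A\<close>] CN[OF \<open>a \<in> A\<close>] that x \<open>a \<in> A\<close> \<open>b \<in> N\<close> \<open>c \<in> N\<close> by (simp add: is_proj_def)
    qed
    then show "is_proj N (b o\<^sub>L a o\<^sub>L c) (b o\<^sub>L C a o\<^sub>L c)"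
      using that CN by (simp add: is_proj_def)
  qed (use that in simp)
  have "is_cond_exp A E N C"
    unfolding is_cond_exp_def
  proof (intro conjI ballI allI impI)
    show "C \<in> A \<rightarrow> N"
      using CN by auto
    show "C (a + b) = C a + C b" if "a \<in> A" "b \<in> A" for a b
      using that by (intro eq is_proj_add C) simp_all
    show "C (scale_op z a) = scale_op z (C a)" if "a \<in> A" for z a
      using that by (intro eq is_proj_scale C) simp_all
    show "op_nonneg (C a)" if "a \<in> A" "op_nonneg a" for a
      by (rule is_proj_nonneg[OF that C[OF that(1)]])
    show "C b = b" if "b \<in> N" for b
      using that by (intro eq) (simp_all add: is_proj_def)
  qed (use bimod trace in auto)
  then have "C \<in> extensional A \<and> is_cond_exp A E N C"
    by (simp add: C_def)
  moreover have "C' = C" if "C' \<in> extensional A \<and> is_cond_exp A E N C'" for C'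
  proof (rule extensionalityI[of _ A])
    show "C' a = C a" if "a \<in> A" for a
      using eq[OF that is_proj_of_cond_exp[of C' a]] that \<open>C' \<in> extensional A \<and> is_cond_exp A E N C'\<close> by simp
  qed (use that in \<open>auto simp: C_def\<close>)
  ultimately have "cond_exp A E N = C"
    unfolding cond_exp_def by (rule the_equality)
  then show ?thesis
    using C[OF a] by simp
qed

lemma cond_exp_mem: "a \<in> A \<Longrightarrow> cond_exp A E N a \<in> N"
  using cond_exp_is_proj by (simp add: is_proj_def)

lemma cond_exp_ip: "a \<in> A \<Longrightarrow> c \<in> N \<Longrightarrow> ip c (cond_exp A E N a) = ip c a"
  using cond_exp_is_proj[of a] cond_exp_mem[of a] tau_commute[of "adj c"]
  by (simp add: is_proj_def ip_def)

lemma cond_exp_id: "b \<in> N \<Longrightarrow> cond_exp A E N b = b"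
  using is_proj_unique[OF cond_exp_is_proj[of b], of b] by (simp add: is_proj_def)

lemma cond_exp_diff:
  assumes "a \<in> A" "b \<in> A"
  shows "cond_exp A E N (a - b) = cond_exp A E N a - cond_exp A E N b"
proof (rule is_proj_unique[OF cond_exp_is_proj])
  show "is_proj N (a - b) (cond_exp A E N a - cond_exp A E N b)"
    using cond_exp_is_proj[OF assms(1)] cond_exp_is_proj[OF assms(2)] assms
    by (simp add: is_proj_def compose_simps tau_diff)
qed (use assms in simp)

end

section \<open>Completions\<close>

text \<open>
  The classes of Cauchy sequences are treated for any exponent at which the \<open>p\<close>-norm is known
  to be a seminorm on the algebra.
\<close>

locale Lp_seminorm = vn_algebra B
  for B :: "'k::complex_hilbert operator set" +
  fixes E :: "'k operator \<Rightarrow> complex" and p :: ennreal and nu :: "'k operator \<Rightarrow> real"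
  assumes Lp_norm_eq: "b \<in> B \<Longrightarrow> Lp_norm E p b = nu b"
    and nu_nonneg: "b \<in> B \<Longrightarrow> 0 \<le> nu b"
    and nu_triangle: "a \<in> B \<Longrightarrow> b \<in> B \<Longrightarrow> nu (a + b) \<le> nu a + nu b"
    and nu_scaleR: "b \<in> B \<Longrightarrow> nu (r *\<^sub>R b) = \<bar>r\<bar> * nu b"
begin

lemma nu_0 [simp]: "nu 0 = 0"
  using nu_scaleR[of 0 0] by simp

lemma nu_minus_commute: "a \<in> B \<Longrightarrow> b \<in> B \<Longrightarrow> nu (a - b) = nu (b - a)"
  using nu_scaleR[of "a - b" "-1"] by simp

lemma nu_diff_triangle: "a \<in> B \<Longrightarrow> b \<in> B \<Longrightarrow> c \<in> B \<Longrightarrow> nu (a - c) \<le> nu (a - b) + nu (b - c)"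
  using nu_triangle[of "a - b" "b - c"] by simp

lemma nu_sum: "(\<And>i. i \<in> I \<Longrightarrow> f i \<in> B) \<Longrightarrow> nu (sum f I) \<le> (\<Sum>i\<in>I. nu (f i))"
proof (induction I rule: infinite_finite_induct)
  case (insert i I)
  then have "nu (f i + sum f I) \<le> nu (f i) + nu (sum f I)"
    by (intro nu_triangle sum_closed) auto
  then show ?case
    using insert by force
qed simp_all

abbreviation Cauchy_seq :: "(nat \<Rightarrow> 'k operator) \<Rightarrow> bool" where
  "Cauchy_seq x \<equiv> x \<in> Lp_Cauchy B E p"

lemma Cauchy_seq_iff:
  "Cauchy_seq x \<longleftrightarrow> (\<forall>n. x n \<in> B) \<and> (\<forall>e>0. \<exists>N. \<forall>m\<ge>N. \<forall>n\<ge>N. nu (x m - x n) < e)"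
  unfolding Lp_Cauchy_def by (auto simp: Lp_norm_eq image_subset_iff)

lemma Cauchy_seq_mem: "Cauchy_seq x \<Longrightarrow> x n \<in> B"
  by (simp add: Cauchy_seq_iff)

lemma Lp_rel_iff: "(x, y) \<in> Lp_rel B E p \<longleftrightarrow> Cauchy_seq x \<and> Cauchy_seq y \<and> (\<lambda>n. nu (x n - y n)) \<longlonglongrightarrow> 0"
  unfolding Lp_rel_def by (auto simp: Lp_norm_eq Cauchy_seq_mem)

lemma nu_tendsto_le:
  assumes "\<And>n. f n \<in> B" "\<And>n. nu (f n) \<le> g n" "g \<longlonglongrightarrow> 0"
  shows "(\<lambda>n. nu (f n)) \<longlonglongrightarrow> 0"
  by (rule tendsto_sandwich[OF _ _ tendsto_const assms(3)]) (auto simp: assms nu_nonneg)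

lemma equiv_Lp_rel: "equiv (Lp_Cauchy B E p) (Lp_rel B E p)"
proof (rule equivI)
  show "Lp_rel B E p \<subseteq> Lp_Cauchy B E p \<times> Lp_Cauchy B E p"
    by (auto simp: Lp_rel_iff)
  show "refl_on (Lp_Cauchy B E p) (Lp_rel B E p)"
    by (auto simp: refl_on_def Lp_rel_iff)
  show "sym (Lp_rel B E p)"
    by (auto simp: sym_def Lp_rel_iff nu_minus_commute Cauchy_seq_mem)
  show "trans (Lp_rel B E p)"
  proof (rule transI)
    fix x y z assume "(x, y) \<in> Lp_rel B E p" "(y, z) \<in> Lp_rel B E p"
    then have c: "Cauchy_seq x" "Cauchy_seq y" "Cauchy_seq z"
      and l: "(\<lambda>n. nu (x n - y n)) \<longlonglongrightarrow> 0" "(\<lambda>n. nu (y n - z n)) \<longlonglongrightarrow> 0"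
      by (auto simp: Lp_rel_iff)
    have "(\<lambda>n. nu (x n - z n)) \<longlonglongrightarrow> 0"
      by (rule nu_tendsto_le[OF _ nu_diff_triangle tendsto_add_zero[OF l]]) (simp_all add: c Cauchy_seq_mem)
    then show "(x, z) \<in> Lp_rel B E p"
      by (simp add: Lp_rel_iff c)
  qed
qed

definition cls :: "(nat \<Rightarrow> 'k operator) \<Rightarrow> (nat \<Rightarrow> 'k operator) set" where
  "cls x = Lp_rel B E p `` {x}"

lemma cls_eq_iff: "Cauchy_seq x \<Longrightarrow> Cauchy_seq y \<Longrightarrow> cls x = cls y \<longleftrightarrow> (\<lambda>n. nu (x n - y n)) \<longlonglongrightarrow> 0"
  unfolding cls_def by (simp add: eq_equiv_class_iff[OF equiv_Lp_rel] Lp_rel_iff)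

lemma cls_self: "Cauchy_seq x \<Longrightarrow> x \<in> cls x"
  by (simp add: cls_def Lp_rel_iff)

lemma cls_mem: "y \<in> cls x \<Longrightarrow> Cauchy_seq x \<and> Cauchy_seq y \<and> (\<lambda>n. nu (x n - y n)) \<longlonglongrightarrow> 0"
  by (simp add: cls_def Lp_rel_iff)

lemma Lp_space_iff: "xi \<in> Lp_space B E p \<longleftrightarrow> (\<exists>x. Cauchy_seq x \<and> xi = cls x)"
  by (auto simp: Lp_space_def quotient_def cls_def)

lemma Cauchy_seq_const: "b \<in> B \<Longrightarrow> Cauchy_seq (\<lambda>n. b)"
  by (simp add: Cauchy_seq_iff)

lemma Cauchy_seq_scaleR:
  assumes x: "Cauchy_seq x"
  shows "Cauchy_seq (\<lambda>n. r *\<^sub>R x n)"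
  unfolding Cauchy_seq_iff
proof (intro conjI allI impI)
  fix e :: real assume "e > 0"
  then have "e / (\<bar>r\<bar> + 1) > 0"
    by (simp add: add_nonneg_pos)
  then obtain N where N: "\<And>m n. m \<ge> N \<Longrightarrow> n \<ge> N \<Longrightarrow> nu (x m - x n) < e / (\<bar>r\<bar> + 1)"
    using x[unfolded Cauchy_seq_iff, THEN conjunct2, rule_format] by blast
  have "nu (r *\<^sub>R x m - r *\<^sub>R x n) < e" if "m \<ge> N" "n \<ge> N" for m n
  proof -
    have "nu (r *\<^sub>R x m - r *\<^sub>R x n) = \<bar>r\<bar> * nu (x m - x n)"
      using nu_scaleR[of "x m - x n" r] Cauchy_seq_mem[OF x] by (simp add: scaleR_diff_right)
    also have "\<dots> \<le> (\<bar>r\<bar> + 1) * nu (x m - x n)"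
      by (intro mult_right_mono nu_nonneg) (simp_all add: Cauchy_seq_mem[OF x])
    also have "\<dots> < e"
      using N[OF that] by (simp add: pos_less_divide_eq mult.commute add_nonneg_pos)
    finally show ?thesis .
  qed
  then show "\<exists>N. \<forall>m\<ge>N. \<forall>n\<ge>N. nu (r *\<^sub>R x m - r *\<^sub>R x n) < e"
    by blast
qed (simp add: Cauchy_seq_mem[OF x])

lemma Cauchy_seq_add:
  assumes x: "Cauchy_seq x" and y: "Cauchy_seq y"
  shows "Cauchy_seq (\<lambda>n. x n + y n)"
  unfolding Cauchy_seq_iff
proof (intro conjI allI impI)
  fix e :: real assume "e > 0"
  then have "e / 2 > 0"
    by simp
  then obtain N where N: "\<And>m n. m \<ge> N \<Longrightarrow> n \<ge> N \<Longrightarrow> nu (x m - x n) < e / 2"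
    using x[unfolded Cauchy_seq_iff, THEN conjunct2, rule_format] by blast
  obtain N' where N': "\<And>m n. m \<ge> N' \<Longrightarrow> n \<ge> N' \<Longrightarrow> nu (y m - y n) < e / 2"
    using y[unfolded Cauchy_seq_iff, THEN conjunct2, rule_format, OF \<open>e / 2 > 0\<close>] by blast
  have "nu (x m + y m - (x n + y n)) < e" if "m \<ge> max N N'" "n \<ge> max N N'" for m n
    using N[of m n] N'[of m n] that nu_triangle[of "x m - x n" "y m - y n"] Cauchy_seq_mem[OF x] Cauchy_seq_mem[OF y]
    by (simp add: add_diff_add)
  then show "\<exists>N. \<forall>m\<ge>N. \<forall>n\<ge>N. nu (x m + y m - (x n + y n)) < e"
    by blast
qed (simp add: Cauchy_seq_mem[OF x] Cauchy_seq_mem[OF y])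

lemma Lp_add_cls:
  assumes x: "Cauchy_seq x" and y: "Cauchy_seq y"
  shows "Lp_add B E p (cls x) (cls y) = cls (\<lambda>n. x n + y n)"
proof -
  have eq: "Lp_rel B E p `` {\<lambda>n. x' n + y' n} = cls (\<lambda>n. x n + y n)" if x': "x' \<in> cls x" and y': "y' \<in> cls y" for x' y'
  proof -
    have c: "Cauchy_seq x'" "Cauchy_seq y'" and l: "(\<lambda>n. nu (x n - x' n)) \<longlonglongrightarrow> 0" "(\<lambda>n. nu (y n - y' n)) \<longlonglongrightarrow> 0"
      using cls_mem[OF x'] cls_mem[OF y'] by auto
    have "nu (x n + y n - (x' n + y' n)) \<le> nu (x n - x' n) + nu (y n - y' n)" for n
      using nu_triangle[of "x n - x' n" "y n - y' n"] c x y by (simp add: add_diff_add Cauchy_seq_mem)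
    then have "(\<lambda>n. nu (x n + y n - (x' n + y' n))) \<longlonglongrightarrow> 0"
      by (rule nu_tendsto_le[OF _ _ tendsto_add_zero[OF l], rotated]) (simp add: c x y Cauchy_seq_mem)
    then have "cls (\<lambda>n. x n + y n) = cls (\<lambda>n. x' n + y' n)"
      by (simp add: cls_eq_iff Cauchy_seq_add c x y)
    then show ?thesis
      by (simp add: cls_def)
  qed
  have "Lp_add B E p (cls x) (cls y) = (\<Union>x'\<in>cls x. \<Union>y'\<in>cls y. cls (\<lambda>n. x n + y n))"
    unfolding Lp_add_def by (intro SUP_cong refl eq)
  also have "\<dots> = cls (\<lambda>n. x n + y n)"
    using cls_self[OF x] cls_self[OF y] by auto
  finally show ?thesis .
qed

lemma Lp_scaleR_cls:
  assumes x: "Cauchy_seq x"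
  shows "Lp_scaleR B E p r (cls x) = cls (\<lambda>n. r *\<^sub>R x n)"
proof -
  have eq: "Lp_rel B E p `` {\<lambda>n. r *\<^sub>R x' n} = cls (\<lambda>n. r *\<^sub>R x n)" if x': "x' \<in> cls x" for x'
  proof -
    have c: "Cauchy_seq x'" and l: "(\<lambda>n. nu (x n - x' n)) \<longlonglongrightarrow> 0"
      using cls_mem[OF x'] by auto
    have "nu (r *\<^sub>R x n - r *\<^sub>R x' n) \<le> \<bar>r\<bar> * nu (x n - x' n)" for n
      using nu_scaleR[of "x n - x' n" r] c x by (simp add: scaleR_diff_right Cauchy_seq_mem)
    then have "(\<lambda>n. nu (r *\<^sub>R x n - r *\<^sub>R x' n)) \<longlonglongrightarrow> 0"
      by (rule nu_tendsto_le[OF _ _ tendsto_mult_right_zero[OF l], rotated]) (simp add: c x Cauchy_seq_mem)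
    then have "cls (\<lambda>n. r *\<^sub>R x n) = cls (\<lambda>n. r *\<^sub>R x' n)"
      by (simp add: cls_eq_iff Cauchy_seq_scaleR c x)
    then show ?thesis
      by (simp add: cls_def)
  qed
  have "Lp_scaleR B E p r (cls x) = (\<Union>x'\<in>cls x. cls (\<lambda>n. r *\<^sub>R x n))"
    unfolding Lp_scaleR_def by (intro SUP_cong refl eq)
  also have "\<dots> = cls (\<lambda>n. r *\<^sub>R x n)"
    using cls_self[OF x] by auto
  finally show ?thesis .
qed

lemma Lp_of_cls: "Lp_of B E p b = cls (\<lambda>n. b)"
  by (simp add: Lp_of_def cls_def)

lemma Lp_dist_tendsto:
  assumes b: "b \<in> B" and x: "Cauchy_seq x"
  shows "(\<lambda>n. nu (b - x n)) \<longlonglongrightarrow> Lp_dist E p b (cls x)"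
proof -
  have conv: "convergent (\<lambda>n. nu (b - y n))" if y: "Cauchy_seq y" for y
  proof -
    have "Cauchy (\<lambda>n. nu (b - y n))"
    proof (rule CauchyI)
      fix e :: real assume "e > 0"
      then obtain N where N: "\<And>m n. m \<ge> N \<Longrightarrow> n \<ge> N \<Longrightarrow> nu (y m - y n) < e"
        using y unfolding Cauchy_seq_iff by blast
      have "norm (nu (b - y m) - nu (b - y n)) < e" if "m \<ge> N" "n \<ge> N" for m n
        using N[OF that] N[OF that(2,1)] nu_diff_triangle[of b "y m" "y n"] nu_diff_triangle[of b "y n" "y m"]
          b Cauchy_seq_mem[OF y] by (simp add: abs_less_iff)
      then show "\<exists>N. \<forall>m\<ge>N. \<forall>n\<ge>N. norm (nu (b - y m) - nu (b - y n)) < e"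
        by blast
    qed
    then show ?thesis
      by (simp add: Cauchy_convergent_iff)
  qed
  have lim_eq: "lim (\<lambda>n. Lp_norm E p (b - y n)) = lim (\<lambda>n. nu (b - x n))" if y: "y \<in> cls x" for y
  proof -
    have c: "Cauchy_seq y" and l: "(\<lambda>n. nu (x n - y n)) \<longlonglongrightarrow> 0"
      using cls_mem[OF y] by auto
    have "(\<lambda>n. nu (b - y n) - nu (b - x n)) \<longlonglongrightarrow> 0"
    proof (rule Lim_null_comparison[OF _ l], rule always_eventually, rule allI)
      fix n
      show "norm (nu (b - y n) - nu (b - x n)) \<le> nu (x n - y n)"
        using nu_diff_triangle[of b "x n" "y n"] nu_diff_triangle[of b "y n" "x n"] nu_minus_commute[of "x n" "y n"]
          b Cauchy_seq_mem[OF c] Cauchy_seq_mem[OF x] by (simp add: abs_le_iff)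
    qed
    then have "(\<lambda>n. (nu (b - y n) - nu (b - x n)) + nu (b - x n)) \<longlonglongrightarrow> 0 + lim (\<lambda>n. nu (b - x n))"
      using conv[OF x] by (intro tendsto_add) (simp_all add: convergent_LIMSEQ_iff)
    then have "(\<lambda>n. nu (b - y n)) \<longlonglongrightarrow> lim (\<lambda>n. nu (b - x n))"
      by simp
    then show ?thesis
      using limI by (simp add: Lp_norm_eq b Cauchy_seq_mem[OF c])
  qed
  have "(\<lambda>y. lim (\<lambda>n. Lp_norm E p (b - y n))) ` cls x = {lim (\<lambda>n. nu (b - x n))}"
    using lim_eq cls_self[OF x] by (auto simp: image_iff)
  then have "Lp_dist E p b (cls x) = lim (\<lambda>n. nu (b - x n))"
    by (simp add: Lp_dist_def)
  then show ?thesis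
    using conv[OF x] by (simp add: convergent_LIMSEQ_iff)
qed

lemma has_Lp_limit_unique:
  assumes S: "\<And>i. S i \<in> B \<or> \<not> G i" "eventually G f" and f: "f \<noteq> bot"
    and l: "has_Lp_limit B E p S f xi" "has_Lp_limit B E p S f eta"
  shows "xi = eta"
proof -
  obtain x where x: "Cauchy_seq x" "xi = cls x"
    using l(1) by (auto simp: has_Lp_limit_def Lp_space_iff)
  obtain y where y: "Cauchy_seq y" "eta = cls y"
    using l(2) by (auto simp: has_Lp_limit_def Lp_space_iff)
  have "(\<lambda>n. nu (x n - y n)) \<longlonglongrightarrow> 0"
  proof (rule LIMSEQ_I)
    fix e :: real assume e: "e > 0"
    have d: "((\<lambda>i. Lp_dist E p (S i) (cls x)) \<longlongrightarrow> 0) f" "((\<lambda>i. Lp_dist E p (S i) (cls y)) \<longlongrightarrow> 0) f"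
      using l by (simp_all add: has_Lp_limit_def x y)
    have "\<forall>\<^sub>F i in f. Lp_dist E p (S i) (cls x) < e / 2" "\<forall>\<^sub>F i in f. Lp_dist E p (S i) (cls y) < e / 2"
      using order_tendstoD(2)[OF d(1), of "e / 2"] order_tendstoD(2)[OF d(2), of "e / 2"] e by simp_all
    then have "\<forall>\<^sub>F i in f. G i \<and> Lp_dist E p (S i) (cls x) < e / 2 \<and> Lp_dist E p (S i) (cls y) < e / 2"
      using S(2) by (auto intro: eventually_conj)
    then obtain i where i: "S i \<in> B" "Lp_dist E p (S i) (cls x) < e / 2" "Lp_dist E p (S i) (cls y) < e / 2"
      using eventually_happens'[OF f] S(1) by blast
    have "\<forall>\<^sub>F n in sequentially. nu (S i - x n) < e / 2" "\<forall>\<^sub>F n in sequentially. nu (S i - y n) < e / 2"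
      using order_tendstoD(2)[OF Lp_dist_tendsto[OF i(1) x(1)] i(2)]
        order_tendstoD(2)[OF Lp_dist_tendsto[OF i(1) y(1)] i(3)] by simp_all
    then have "\<forall>\<^sub>F n in sequentially. norm (nu (x n - y n) - 0) < e"
    proof eventually_elim
      case (elim n)
      then show ?case
        using nu_diff_triangle[of "x n" "S i" "y n"] nu_minus_commute[of "x n" "S i"] nu_nonneg[of "x n - y n"]
          i Cauchy_seq_mem[OF x(1)] Cauchy_seq_mem[OF y(1)] by simp
    qed
    then show "\<exists>N. \<forall>n\<ge>N. norm (nu (x n - y n) - 0) < e"
      by (simp add: eventually_sequentially)
  qed
  then show ?thesis
    using x y by (simp add: cls_eq_iff)
qed

end

lemma Lp_to_L1_cls:
  assumes L2: "Lp_seminorm B E 2 n2" and L1: "Lp_seminorm B E 1 n1" and le: "\<And>b. b \<in> B \<Longrightarrow> n1 b \<le> n2 b"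
    and x: "x \<in> Lp_Cauchy B E 2"
  shows "x \<in> Lp_Cauchy B E 1" "Lp_to_L1 B E (Lp_seminorm.cls B E 2 x) = Lp_seminorm.cls B E 1 x"
proof -
  interpret L2: Lp_seminorm B E 2 n2 by fact
  interpret L1: Lp_seminorm B E 1 n1 by fact
  have c1: "y \<in> Lp_Cauchy B E 1" if y: "y \<in> Lp_Cauchy B E 2" for y
    unfolding L1.Cauchy_seq_iff
  proof (intro conjI allI impI)
    fix e :: real assume "e > 0"
    then obtain N where N: "\<And>m n. m \<ge> N \<Longrightarrow> n \<ge> N \<Longrightarrow> n2 (y m - y n) < e"
      using y unfolding L2.Cauchy_seq_iff by blast
    have "n1 (y m - y n) < e" if "m \<ge> N" "n \<ge> N" for m n
      using N[OF that] le[of "y m - y n"] L2.Cauchy_seq_mem[OF y] by simp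
    then show "\<exists>N. \<forall>m\<ge>N. \<forall>n\<ge>N. n1 (y m - y n) < e"
      by blast
  qed (rule L2.Cauchy_seq_mem[OF y])
  show c: "x \<in> Lp_Cauchy B E 1"
    by (rule c1[OF x])
  have eq: "Lp_rel B E 1 `` {y} = L1.cls x" if y: "y \<in> L2.cls x" for y
  proof -
    have yc: "y \<in> Lp_Cauchy B E 2" and l: "(\<lambda>n. n2 (x n - y n)) \<longlonglongrightarrow> 0"
      using L2.cls_mem[OF y] by auto
    have "(\<lambda>n. n1 (x n - y n)) \<longlonglongrightarrow> 0"
      by (rule L1.nu_tendsto_le[OF _ le l]) (simp_all add: L2.Cauchy_seq_mem[OF x] L2.Cauchy_seq_mem[OF yc])
    then have "L1.cls x = L1.cls y"
      by (simp add: L1.cls_eq_iff c c1[OF yc])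
    then show ?thesis
      by (simp add: L1.cls_def)
  qed
  have "Lp_to_L1 B E (L2.cls x) = (\<Union>y\<in>L2.cls x. Lp_rel B E 1 `` {y})"
    unfolding Lp_to_L1_def by (rule Image_eq_UN)
  also have "\<dots> = (\<Union>y\<in>L2.cls x. L1.cls x)"
    by (intro SUP_cong refl eq)
  also have "\<dots> = L1.cls x"
    using L2.cls_self[OF x] by auto
  finally show "Lp_to_L1 B E (L2.cls x) = L1.cls x" .
qed

section \<open>Partitions\<close>

lemma partition_facts:
  assumes "is_partition t P"
  shows "finite P" "0 \<in> P" "t \<in> P" "s \<in> P \<Longrightarrow> 0 \<le> s" "s \<in> P \<Longrightarrow> s \<le> t" "0 \<le> t"
  using assms by (auto simp: is_partition_def)

lemma left_nb_0 [simp]: "left_nb P 0 = 0"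
  by (simp add: left_nb_def)

lemma left_nb_pos:
  assumes P: "is_partition t P" and s: "0 < s"
  shows "left_nb P s \<in> P" "left_nb P s < s" "\<And>r. r \<in> P \<Longrightarrow> r < s \<Longrightarrow> r \<le> left_nb P s"
proof -
  have f: "finite {r \<in> P. r < s}" and ne: "{r \<in> P. r < s} \<noteq> {}"
    using partition_facts[OF P] s by auto
  then show "left_nb P s \<in> P" "left_nb P s < s"
    using Max_in[OF f ne] s by (auto simp: left_nb_def)
  show "r \<le> left_nb P s" if "r \<in> P" "r < s" for r
    using that s Max_ge[OF f, of r] by (simp add: left_nb_def)
qed

lemma left_nb_bounds:
  assumes P: "is_partition t P" and s: "0 \<le> s"
  shows "left_nb P s \<in> P" "left_nb P s \<le> s" "0 \<le> left_nb P s"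
proof -
  show "left_nb P s \<in> P" "left_nb P s \<le> s"
    using left_nb_pos[OF P, of s] partition_facts(2)[OF P] s by (cases "s = 0"; auto)+
  then show "0 \<le> left_nb P s"
    using partition_facts(4)[OF P] by blast
qed

text \<open>This assigns to a point of a finer partition the interval of \<open>P\<close> that contains it.\<close>

lemma next_point:
  assumes P: "is_partition t P" and r: "0 < r" "r \<le> t"
  obtains s where "s \<in> P" "\<And>s'. s' \<in> P \<Longrightarrow> left_nb P s' < r \<and> r \<le> s' \<longleftrightarrow> s' = s"
    "left_nb P s = left_nb P r"
proof -
  define s where "s = Min {s \<in> P. r \<le> s}"
  have f: "finite {s \<in> P. r \<le> s}" and ne: "{s \<in> P. r \<le> s} \<noteq> {}"
    using partition_facts[OF P] r by auto
  have s: "s \<in> P" "r \<le> s"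
    using Min_in[OF f ne] by (auto simp: s_def)
  have least: "s \<le> s'" if "s' \<in> P" "r \<le> s'" for s'
    unfolding s_def using that by (intro Min_le f) simp
  have s0: "0 < s"
    using s r by simp
  note ls = left_nb_pos[OF P s0] and lr = left_nb_pos[OF P r(1)]
  have lt: "left_nb P s < r"
    using least[OF ls(1)] ls(2) by force
  show thesis
  proof (rule that[OF s(1)])
    show "left_nb P s = left_nb P r"
      using lr(3)[OF ls(1) lt] ls(3)[OF lr(1)] lr(2) s(2) by simp
    show "left_nb P s' < r \<and> r \<le> s' \<longleftrightarrow> s' = s" if s': "s' \<in> P" for s'
    proof
      assume *: "left_nb P s' < r \<and> r \<le> s'"
      then have "0 < s'"
        using r by simp
      from left_nb_pos(3)[OF P this s(1)] * s(2) have "s' \<le> s"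
        by force
      then show "s' = s"
        using least[OF s'] * by simp
    qed (use lt s in simp)
  qed
qed

lemma mesh_ge:
  assumes P: "is_partition t P" and r: "0 \<le> r" "r \<le> t"
  shows "r - left_nb P r \<le> mesh P"
proof -
  have ge: "s - left_nb P s \<le> mesh P" if "s \<in> P" for s
    unfolding mesh_def using that partition_facts(1)[OF P] by (intro Max_ge) auto
  show ?thesis
  proof (cases "r = 0")
    case True
    then show ?thesis
      using ge[OF partition_facts(2)[OF P]] by simp
  next
    case False
    then obtain s where s: "s \<in> P" "\<And>s'. s' \<in> P \<Longrightarrow> left_nb P s' < r \<and> r \<le> s' \<longleftrightarrow> s' = s" "left_nb P s = left_nb P r"
      using next_point[OF P, of r] r by (metis order_le_less)
    then show ?thesis
      using ge[OF s(1)] s(2)[OF s(1)] by simp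
  qed
qed

text \<open>
  Taking left neighbours is a bijection from \<open>P - {0}\<close> to \<open>P - {t}\<close>.
\<close>

lemma telescope_partition:
  fixes f :: "real \<Rightarrow> 'a::ab_group_add"
  assumes P: "is_partition t P"
  shows "(\<Sum>s\<in>P. f s - f (left_nb P s)) = f t - f 0"
proof -
  note pf = partition_facts[OF P]
  have inj: "inj_on (left_nb P) (P - {0})"
  proof (rule linorder_inj_onI)
    fix x y assume xy: "x < y" "x \<in> P - {0}" "y \<in> P - {0}"
    then have "0 < x" "0 < y"
      using pf(4)[of x] by auto
    then have "left_nb P x < x" "x \<le> left_nb P y"
      using left_nb_pos[OF P] xy by auto
    then show "left_nb P x \<noteq> left_nb P y"
      by simp
  qed auto
  have sub: "left_nb P ` (P - {0}) \<subseteq> P - {t}"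
  proof
    fix y assume "y \<in> left_nb P ` (P - {0})"
    then obtain x where x: "y = left_nb P x" "x \<in> P" "x \<noteq> 0"
      by auto
    then have "0 < x"
      using pf(4)[of x] by simp
    then show "y \<in> P - {t}"
      using left_nb_pos[OF P, of x] x pf(5)[of x] by auto
  qed
  have img: "left_nb P ` (P - {0}) = P - {t}"
    using pf(1-3) by (intro card_subset_eq sub) (simp_all add: card_image[OF inj])
  have "(\<Sum>s\<in>P. f s - f (left_nb P s)) = (\<Sum>s\<in>P - {0}. f s - f (left_nb P s))"
    using pf by (simp add: sum.remove)
  also have "\<dots> = (\<Sum>s\<in>P - {0}. f s) - (\<Sum>s\<in>left_nb P ` (P - {0}). f s)"
    by (simp add: sum_subtractf sum.reindex[OF inj])
  also have "\<dots> = f t - f 0"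
    unfolding img using pf by (simp add: sum_diff1)
  finally show ?thesis .
qed

text \<open>
  A sum over \<open>P\<close> of step-function type does not change under refinement, provided that the
  coefficients are kept: on a small interval of \<open>Q\<close> the coefficient is that of the interval
  of \<open>P\<close> around it.
\<close>

lemma refine_partition_sum:
  fixes X :: "real \<Rightarrow> 'a::ab_group_add" and L :: "real \<Rightarrow> 'a \<Rightarrow> 'b::ab_group_add"
  assumes P: "is_partition t P" and Q: "is_partition t Q" and PQ: "P \<subseteq> Q"
    and X: "\<And>s. 0 \<le> s \<Longrightarrow> s \<le> t \<Longrightarrow> X s \<in> V" and V: "\<And>a b. a \<in> V \<Longrightarrow> b \<in> V \<Longrightarrow> a - b \<in> V"
      "\<And>a b. a \<in> V \<Longrightarrow> b \<in> V \<Longrightarrow> a + b \<in> V" "0 \<in> V"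
    and L: "\<And>s a b. s \<in> P \<Longrightarrow> a \<in> V \<Longrightarrow> b \<in> V \<Longrightarrow> L s (a + b) = L s a + L s b"
  shows "(\<Sum>s\<in>P. L (left_nb P s) (increment X P s)) = (\<Sum>r\<in>Q. L (left_nb P r) (increment X Q r))"
proof -
  note pf = partition_facts[OF P] and qf = partition_facts[OF Q]
  have L0: "L s 0 = 0" if "s \<in> P" for s
    using L[OF that, of 0 0] V(3) by simp
  have Lsum: "L s (\<Sum>i\<in>I. f i) = (\<Sum>i\<in>I. L s (f i)) \<and> (\<Sum>i\<in>I. f i) \<in> V"
    if "s \<in> P" "finite I" "\<And>i. i \<in> I \<Longrightarrow> f i \<in> V" for s I and f :: "real \<Rightarrow> 'a"
    using that(2,3) by (induction I rule: finite_induct) (simp_all add: L0[OF that(1)] V L[OF that(1)])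
  define Z where "Z r = L (left_nb P r) (increment X Q r)" for r
  have Z0: "Z 0 = 0"
    using L0[OF pf(2)] by (simp add: Z_def increment_def)
  have "L (left_nb P s) (increment X P s) = (\<Sum>r\<in>Q. if left_nb P s < r \<and> r \<le> s then Z r else 0)" if s: "s \<in> P" for s
  proof -
    let ?l = "left_nb P s"
    note b = left_nb_bounds[OF P pf(4)[OF s]]
    define f where "f r = X (max ?l (min r s))" for r
    have "(\<Sum>r\<in>Q. f r - f (left_nb Q r)) = increment X P s"
      using telescope_partition[OF Q, of f] b pf(5)[OF s] by (simp add: f_def increment_def)
    moreover have fV: "f r - f (left_nb Q r) \<in> V" for r
      unfolding f_def using b pf(5)[OF s] by (intro V X) auto
    ultimately have "L ?l (increment X P s) = (\<Sum>r\<in>Q. L ?l (f r - f (left_nb Q r)))"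
      using Lsum[OF b(1) qf(1), of "\<lambda>r. f r - f (left_nb Q r)"] by simp
    also have "\<dots> = (\<Sum>r\<in>Q. if ?l < r \<and> r \<le> s then Z r else 0)"
    proof (rule sum.cong)
      fix r assume r: "r \<in> Q"
      note rb = left_nb_bounds[OF Q qf(4)[OF r]]
      show "L ?l (f r - f (left_nb Q r)) = (if ?l < r \<and> r \<le> s then Z r else 0)"
      proof (cases "?l < r \<and> r \<le> s")
        case True
        then have r0: "0 < r"
          using b(3) by simp
        have "?l \<le> left_nb Q r"
          using left_nb_pos(3)[OF Q r0] b(1) PQ True by blast
        then have "f r - f (left_nb Q r) = increment X Q r"
          using True rb by (simp add: f_def increment_def max_def min_def)
        moreover obtain s' where s': "\<And>s''. s'' \<in> P \<Longrightarrow> left_nb P s'' < r \<and> r \<le> s'' \<longleftrightarrow> s'' = s'" "left_nb P s' = left_nb P r"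
          using next_point[OF P r0 qf(5)[OF r]] by blast
        have "left_nb P r = ?l"
          using s'(1)[OF s] s'(2) True by simp
        ultimately show ?thesis
          unfolding if_P[OF True] by (simp add: Z_def)
      next
        case False
        have "f r = f (left_nb Q r)"
        proof (cases "r \<le> ?l")
          case True
          then have "max ?l (min r s) = ?l" "max ?l (min (left_nb Q r) s) = ?l"
            using rb b by (auto simp: max_def min_def)
          then show ?thesis
            by (simp add: f_def)
        next
          case rl: False
          then have "s < r"
            using False by simp
          moreover have "s \<le> left_nb Q r"
            using left_nb_pos(3)[OF Q, of r s] calculation s PQ pf(4)[OF s] by auto
          ultimately show ?thesis
            by (simp add: f_def)
        qed
        then show ?thesis
          unfolding if_not_P[OF False] using L0[OF b(1)] by simp
      qed
    qed simp
    finally show ?thesis .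
  qed
  then have "(\<Sum>s\<in>P. L (left_nb P s) (increment X P s)) = (\<Sum>s\<in>P. \<Sum>r\<in>Q. if left_nb P s < r \<and> r \<le> s then Z r else 0)"
    by simp
  also have "\<dots> = (\<Sum>r\<in>Q. \<Sum>s\<in>P. if left_nb P s < r \<and> r \<le> s then Z r else 0)"
    by (rule sum.swap)
  also have "\<dots> = (\<Sum>r\<in>Q. Z r)"
  proof (rule sum.cong)
    fix r assume r: "r \<in> Q"
    show "(\<Sum>s\<in>P. if left_nb P s < r \<and> r \<le> s then Z r else 0) = Z r"
    proof (cases "r = 0")
      case True
      have "\<not> left_nb P s < 0" if "s \<in> P" for s
        using left_nb_bounds(3)[OF P pf(4)[OF that]] by simp
      then show ?thesis
        by (simp add: True Z0)
    next
      case False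
      then have "0 < r"
        using qf(4)[OF r] by simp
      then obtain s where s: "s \<in> P" "\<And>s'. s' \<in> P \<Longrightarrow> left_nb P s' < r \<and> r \<le> s' \<longleftrightarrow> s' = s"
        using next_point[OF P _ qf(5)[OF r]] by metis
      have "(\<Sum>s'\<in>P. if left_nb P s' < r \<and> r \<le> s' then Z r else 0) = (\<Sum>s'\<in>P. if s' = s then Z r else 0)"
        by (intro sum.cong refl if_cong s)
      then show ?thesis
        using s(1) pf(1) by simp
    qed
  qed simp
  finally show ?thesis
    by (simp add: Z_def)
qed

lemma eventually_fine_partitions:
  "eventually G (fine_partitions t) \<longleftrightarrow> (\<exists>d>0. \<forall>P. is_partition t P \<and> mesh P < d \<longrightarrow> G P)"
  unfolding fine_partitions_def
proof (subst eventually_INF_base)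
  show "\<exists>x\<in>{0<..}. principal {P. is_partition t P \<and> mesh P < x}
      \<le> inf (principal {P. is_partition t P \<and> mesh P < a}) (principal {P. is_partition t P \<and> mesh P < b})"
    if "a \<in> {0<..}" "b \<in> {0<..}" for a b
    using that by (intro bexI[of _ "min a b"]) auto
qed (auto simp: eventually_principal)

lemma fine_partition_exists:
  assumes t: "0 \<le> t" and d: "0 < d"
  obtains P where "is_partition t P" "mesh P < d"
proof -
  obtain n :: nat where n: "t / d < real n"
    using reals_Archimedean2 by blast
  define P where "P = (\<lambda>k. t * real k / real (Suc n)) ` {..Suc n}"
  have P: "is_partition t P"
  proof -
    have "t * real k / real (Suc n) \<le> t" if "k \<le> Suc n" for k
      using that t mult_left_mono[of "real k" "real (Suc n)" t] by (simp add: divide_le_eq)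
    moreover have "0 \<in> P"
      unfolding P_def by (rule image_eqI[of _ _ 0]) simp_all
    moreover have "t \<in> P"
      unfolding P_def by (rule image_eqI[of _ _ "Suc n"]) simp_all
    ultimately show ?thesis
      using t by (auto simp: is_partition_def P_def)
  qed
  have "s - left_nb P s < d" if "s \<in> P" for s
  proof (cases "s = 0")
    case False
    then have s0: "0 < s"
      using partition_facts(4)[OF P that] by simp
    obtain k where "k \<in> {..Suc n}" and ks: "s = t * real k / real (Suc n)"
      using \<open>s \<in> P\<close> unfolding P_def by (rule imageE) (rule that)
    then have k: "k \<le> Suc n" "s = t * real k / real (Suc n)"
      by simp_all
    then obtain j where j: "k = Suc j"
      using False by (cases k) auto
    have t0: "0 < t"
      using s0 k t by (cases "t = 0") auto
    let ?r = "t * real j / real (Suc n)"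
    have "?r \<in> P"
      using k j by (auto simp: P_def)
    moreover have "?r < s"
      using t0 by (simp add: k j divide_strict_right_mono)
    ultimately have "?r \<le> left_nb P s"
      by (intro left_nb_pos(3)[OF P s0])
    moreover have "s - ?r = t / real (Suc n)"
      unfolding k j by (simp add: diff_divide_distrib[symmetric] algebra_simps)
    moreover have "t / real (Suc n) < d"
      using n d by (simp add: field_simps)
    ultimately show ?thesis
      by simp
  qed (use d in simp)
  then have "mesh P < d"
    unfolding mesh_def using partition_facts[OF P] by (subst Max_less_iff) auto
  then show thesis
    using that P by blast
qed

lemma fine_partitions_neq_bot: "0 \<le> t \<Longrightarrow> fine_partitions t \<noteq> bot"
  unfolding trivial_limit_def eventually_fine_partitions using fine_partition_exists[of t] by metis

lemma partition_sequence:
  assumes "0 \<le> t"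
  obtains P :: "nat \<Rightarrow> real set" where "\<And>n. is_partition t (P n)"
    "\<And>d. 0 < d \<Longrightarrow> \<forall>\<^sub>F n in sequentially. mesh (P n) < d"
proof -
  have "\<forall>n. \<exists>P. is_partition t P \<and> mesh P < inverse (real (Suc n))"
    using fine_partition_exists[OF assms] by (metis inverse_positive_iff_positive of_nat_0_less_iff zero_less_Suc)
  then obtain P where P: "\<And>n. is_partition t (P n)" "\<And>n. mesh (P n) < inverse (real (Suc n))"
    by metis
  have "0 \<le> mesh (P n)" for n
    using mesh_ge[OF P(1), of 0 n] assms by simp
  then have lim: "(\<lambda>n. mesh (P n)) \<longlonglongrightarrow> 0"
    using P(2) by (intro tendsto_sandwich[OF _ _ tendsto_const LIMSEQ_inverse_real_of_nat]) (auto intro!: always_eventually less_imp_le)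
  show thesis
    by (rule that[OF P(1)]) (rule order_tendstoD(2)[OF lim])
qed

text \<open>
  The limit along the filter of partitions is the class of the sums along any one sequence of
  partitions with mesh tending to 0. Classes in this form can be added.
\<close>

lemma (in Lp_seminorm) fine_Cauchy_limit:
  assumes t: "0 \<le> t" and S: "\<And>P. is_partition t P \<Longrightarrow> S P \<in> B"
    and C: "\<And>e. e > 0 \<Longrightarrow> \<exists>d>0. \<forall>P Q. is_partition t P \<and> mesh P < d \<and> is_partition t Q \<and> mesh Q < d \<longrightarrow> nu (S P - S Q) \<le> e"
    and P: "\<And>n. is_partition t (P n)" "\<And>d. 0 < d \<Longrightarrow> \<forall>\<^sub>F n in sequentially. mesh (P n) < d"
  shows "Cauchy_seq (\<lambda>n. S (P n))" "has_Lp_limit B E p S (fine_partitions t) (cls (\<lambda>n. S (P n)))"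
    "has_Lp_limit B E p S (fine_partitions t) xi \<Longrightarrow> xi = cls (\<lambda>n. S (P n))"
proof -
  show c: "Cauchy_seq (\<lambda>n. S (P n))"
    unfolding Cauchy_seq_iff
  proof (intro conjI allI impI)
    show "S (P n) \<in> B" for n
      by (rule S[OF P(1)])
    fix e :: real assume e: "e > 0"
    obtain d where d: "d > 0" "\<And>P Q. is_partition t P \<and> mesh P < d \<and> is_partition t Q \<and> mesh Q < d \<Longrightarrow> nu (S P - S Q) \<le> e / 2"
      using C[of "e / 2"] e by auto
    obtain N where N: "\<And>n. n \<ge> N \<Longrightarrow> mesh (P n) < d"
      using P(2)[OF d(1)] unfolding eventually_sequentially by blast
    have "nu (S (P m) - S (P n)) < e" if "m \<ge> N" "n \<ge> N" for m n
      using d(2)[of "P m" "P n"] N[OF that(1)] N[OF that(2)] P(1) e by force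
    then show "\<exists>N. \<forall>m\<ge>N. \<forall>n\<ge>N. nu (S (P m) - S (P n)) < e"
      by blast
  qed
  show l: "has_Lp_limit B E p S (fine_partitions t) (cls (\<lambda>n. S (P n)))"
    unfolding has_Lp_limit_def
  proof (intro conjI)
    show "cls (\<lambda>n. S (P n)) \<in> Lp_space B E p"
      using c by (auto simp: Lp_space_iff)
    show "((\<lambda>Q. Lp_dist E p (S Q) (cls (\<lambda>n. S (P n)))) \<longlongrightarrow> 0) (fine_partitions t)"
    proof (rule tendstoI)
      fix e :: real assume e: "e > 0"
      obtain d where d: "d > 0" "\<And>P Q. is_partition t P \<and> mesh P < d \<and> is_partition t Q \<and> mesh Q < d \<Longrightarrow> nu (S P - S Q) \<le> e / 2"
        using C[of "e / 2"] e by auto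
      have "dist (Lp_dist E p (S Q) (cls (\<lambda>n. S (P n)))) 0 < e" if Q: "is_partition t Q" "mesh Q < d" for Q
      proof -
        note lim = Lp_dist_tendsto[OF S[OF Q(1)] c]
        have "\<forall>\<^sub>F n in sequentially. nu (S Q - S (P n)) \<le> e / 2"
          using P(2)[OF d(1)] by eventually_elim (use d(2) P(1) Q in blast)
        then have "Lp_dist E p (S Q) (cls (\<lambda>n. S (P n))) \<le> e / 2"
          by (rule tendsto_upperbound[OF lim]) simp
        moreover have "0 \<le> Lp_dist E p (S Q) (cls (\<lambda>n. S (P n)))"
          by (rule tendsto_lowerbound[OF lim]) (simp_all add: nu_nonneg S[OF Q(1)] S[OF P(1)])
        ultimately show ?thesis
          using e by (simp add: dist_real_def)
      qed
      then show "\<forall>\<^sub>F Q in fine_partitions t. dist (Lp_dist E p (S Q) (cls (\<lambda>n. S (P n)))) 0 < e"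
        unfolding eventually_fine_partitions using d(1) by blast
    qed
  qed
  show "xi = cls (\<lambda>n. S (P n))" if "has_Lp_limit B E p S (fine_partitions t) xi"
  proof (rule has_Lp_limit_unique[OF _ _ fine_partitions_neq_bot[OF t] that l])
    show "S Q \<in> B \<or> \<not> is_partition t Q" for Q
      using S by blast
    show "eventually (is_partition t) (fine_partitions t)"
      unfolding eventually_fine_partitions by (intro exI[of _ 1]) simp
  qed
qed

section \<open>The derivatives of an adapted map\<close>

text \<open>
  A Lebesgue number argument. Two nearby points are compared through the centre \<open>z\<close> of a ball
  of the cover, so local estimates \<open>G\<close> at \<open>z\<close> combine to the uniform estimate \<open>H\<close>.
\<close>

lemma compact_uniform_modulus:
  fixes K :: "'a::metric_space set"
  assumes K: "compact K" "K \<subseteq> U"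
    and G: "\<And>x. x \<in> K \<Longrightarrow> \<exists>d>0. \<forall>y\<in>U. dist y x < d \<longrightarrow> G x y"
    and H: "\<And>x y z. z \<in> K \<Longrightarrow> x \<in> K \<Longrightarrow> y \<in> U \<Longrightarrow> G z x \<Longrightarrow> G z y \<Longrightarrow> H x y"
  shows "\<exists>d>0. \<forall>x\<in>K. \<forall>y\<in>U. dist y x < d \<longrightarrow> H x y"
proof -
  obtain d where d: "\<And>x. x \<in> K \<Longrightarrow> 0 < d x" "\<And>x y. x \<in> K \<Longrightarrow> y \<in> U \<Longrightarrow> dist y x < d x \<Longrightarrow> G x y"
    using G by metis
  have cover: "K \<subseteq> \<Union>((\<lambda>z. ball z (d z)) ` K)" and op: "\<And>b. b \<in> (\<lambda>z. ball z (d z)) ` K \<Longrightarrow> open b"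
    using d(1) by auto
  obtain e where e: "e > 0" "\<And>x. x \<in> K \<Longrightarrow> \<exists>b\<in>(\<lambda>z. ball z (d z)) ` K. ball x e \<subseteq> b"
    by (rule Heine_Borel_lemma[OF K(1) cover op]) (assumption, rule that)
  have "H x y" if x: "x \<in> K" and y: "y \<in> U" "dist y x < e" for x y
  proof -
    obtain z where z: "z \<in> K" "ball x e \<subseteq> ball z (d z)"
      using e(2)[OF x] by auto
    have "x \<in> ball z (d z)" "y \<in> ball z (d z)"
      using subsetD[OF z(2), of x] subsetD[OF z(2), of y] e(1) y(2) by (simp_all add: dist_commute)
    then show ?thesis
      using x y z K(2) by (intro H[OF z(1) x y(1)] d(2)) (auto simp: dist_commute)
  qed
  then show ?thesis
    using e(1) by blast
qed

lemma multilinear_on_1: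
  assumes "multilinear_on V 1 W \<Lambda>"
  shows "h \<in> V \<Longrightarrow> \<Lambda> [h] \<in> W" "h \<in> V \<Longrightarrow> k \<in> V \<Longrightarrow> \<Lambda> [h + k] = \<Lambda> [h] + \<Lambda> [k]"
    "h \<in> V \<Longrightarrow> \<Lambda> [r *\<^sub>R h] = r *\<^sub>R \<Lambda> [h]"
proof -
  have t: "[h] \<in> tuples V 1" if "h \<in> V" for h
    using that by (simp add: tuples_def)
  show "h \<in> V \<Longrightarrow> \<Lambda> [h] \<in> W"
    using assms t by (auto simp: multilinear_on_def)
  show "\<Lambda> [h + k] = \<Lambda> [h] + \<Lambda> [k]" if "h \<in> V" "k \<in> V"
    using assms t[OF that(1)] that unfolding multilinear_on_def
    by (metis less_one list_update_code(2))
  show "\<Lambda> [r *\<^sub>R h] = r *\<^sub>R \<Lambda> [h]" if "h \<in> V"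
    using assms t[OF that(1)] that unfolding multilinear_on_def
    by (metis less_one list_update_code(2))
qed

lemma multilinear_on_2:
  assumes L: "multilinear_on V 2 W \<Lambda>"
  shows "h \<in> V \<Longrightarrow> k \<in> V \<Longrightarrow> \<Lambda> [h, k] \<in> W" "h \<in> V \<Longrightarrow> k \<in> V \<Longrightarrow> \<Lambda> [r *\<^sub>R h, k] = r *\<^sub>R \<Lambda> [h, k]"
    "h \<in> V \<Longrightarrow> k \<in> V \<Longrightarrow> \<Lambda> [h, r *\<^sub>R k] = r *\<^sub>R \<Lambda> [h, k]"
proof -
  have t: "[h, k] \<in> tuples V 2" if "h \<in> V" "k \<in> V" for h k
    using that by (simp add: tuples_def)
  show "h \<in> V \<Longrightarrow> k \<in> V \<Longrightarrow> \<Lambda> [h, k] \<in> W"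
    using L t by (auto simp: multilinear_on_def)
  have sc: "\<Lambda> (hs[i := r *\<^sub>R a]) = r *\<^sub>R \<Lambda> (hs[i := a])" if "hs \<in> tuples V 2" "i < 2" "a \<in> V" for hs i a r
    using L that unfolding multilinear_on_def by blast
  show "\<Lambda> [r *\<^sub>R h, k] = r *\<^sub>R \<Lambda> [h, k]" if "h \<in> V" "k \<in> V"
    using sc[OF t[OF that], of 0 h r] that by simp
  show "\<Lambda> [h, r *\<^sub>R k] = r *\<^sub>R \<Lambda> [h, k]" if "h \<in> V" "k \<in> V"
    using sc[OF t[OF that], of 1 k r] that by simp
qed

context tracial
begin

lemma Lp_seminorm_2: "Lp_seminorm A E 2 n2"
  by unfold_locales (simp_all add: Lp_norm_2 n2_triangle n2_scaleR)

lemma Lp_seminorm_1: "Lp_seminorm A E 1 n1"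
  by unfold_locales (simp_all add: Lp_norm_1 n1_triangle n1_scaleR)

lemma abs_tau_compose_le: "b \<in> A \<Longrightarrow> norm b \<le> 1 \<Longrightarrow> x \<in> A \<Longrightarrow> \<bar>tau (b o\<^sub>L x)\<bar> \<le> norm x"
proof -
  assume b: "b \<in> A" "norm b \<le> 1" and x: "x \<in> A"
  have "norm (b o\<^sub>L x) \<le> norm x"
    using norm_blinfun_compose[of b x] mult_right_mono[OF b(2), of "norm x"] by simp
  moreover have "\<bar>tau (b o\<^sub>L x)\<bar> \<le> norm (b o\<^sub>L x)"
    using tau_le_norm[of "b o\<^sub>L x"] tau_le_norm[of "- (b o\<^sub>L x)"] b x by (simp add: tau_minus abs_le_iff)
  ultimately show ?thesis
    by simp
qed

lemma DERIV_tau: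
  assumes b: "b \<in> A" "norm b \<le> 1" and g: "g \<in> A" and c: "c > 0" "\<And>s. \<bar>s\<bar> < c \<Longrightarrow> G (u + s) \<in> A"
    and lim: "\<And>e. e > 0 \<Longrightarrow> \<exists>d>0. \<forall>s. \<bar>s\<bar> < d \<longrightarrow> norm (G (u + s) - G u - s *\<^sub>R g) \<le> e * \<bar>s\<bar>"
  shows "((\<lambda>r. tau (b o\<^sub>L G r)) has_real_derivative tau (b o\<^sub>L g)) (at u)"
  unfolding DERIV_def
proof (rule LIM_I)
  fix e :: real assume e: "e > 0"
  obtain d where d: "d > 0" "\<And>s. \<bar>s\<bar> < d \<Longrightarrow> norm (G (u + s) - G u - s *\<^sub>R g) \<le> e / 2 * \<bar>s\<bar>"
    using lim[of "e / 2"] e by auto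
  have Gu: "G u \<in> A"
    using c(2)[of 0] c(1) by simp
  have "norm ((tau (b o\<^sub>L G (u + s)) - tau (b o\<^sub>L G u)) / s - tau (b o\<^sub>L g)) < e"
    if s: "s \<noteq> 0" "\<bar>s\<bar> < min c d" for s
  proof -
    let ?x = "G (u + s) - G u - s *\<^sub>R g"
    have x: "?x \<in> A"
      using c(2)[of s] Gu g s by simp
    have "tau (b o\<^sub>L ?x) = tau (b o\<^sub>L G (u + s)) - tau (b o\<^sub>L G u) - s * tau (b o\<^sub>L g)"
      using c(2)[of s] Gu g s b by (simp add: compose_simps tau_diff tau_scaleR)
    then have "(tau (b o\<^sub>L G (u + s)) - tau (b o\<^sub>L G u)) / s - tau (b o\<^sub>L g) = tau (b o\<^sub>L ?x) / s"
      using s by (simp add: field_simps)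
    moreover have "\<bar>tau (b o\<^sub>L ?x)\<bar> \<le> e / 2 * \<bar>s\<bar>"
      using abs_tau_compose_le[OF b x] d(2)[of s] s by simp
    then have "\<bar>tau (b o\<^sub>L ?x)\<bar> / \<bar>s\<bar> \<le> e / 2"
      using s by (simp add: pos_divide_le_eq)
    then have "\<bar>tau (b o\<^sub>L ?x) / s\<bar> < e"
      unfolding abs_divide using e by linarith
    ultimately show ?thesis
      by (simp only: real_norm_def)
  qed
  then show "\<exists>d>0. \<forall>s. s \<noteq> 0 \<and> norm (s - 0) < d \<longrightarrow>
      norm ((tau (b o\<^sub>L G (u + s)) - tau (b o\<^sub>L G u)) / s - tau (b o\<^sub>L g)) < e"
    using c(1) d(1) by (intro exI[of _ "min c d"]) simp
qed

lemma pythagoras: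
  fixes d :: "real \<Rightarrow> 'h operator"
  assumes d: "\<And>r. r \<in> Q \<Longrightarrow> d r \<in> A" and orth: "\<And>r r'. r \<in> Q \<Longrightarrow> r' \<in> Q \<Longrightarrow> r < r' \<Longrightarrow> ip (d r) (d r') = 0"
    and Q: "finite Q"
  shows "(n2 (\<Sum>r\<in>Q. d r))\<^sup>2 = (\<Sum>r\<in>Q. (n2 (d r))\<^sup>2)"
proof -
  have sums: "ip a (sum d I) = (\<Sum>r\<in>I. ip a (d r))" if "a \<in> A" "I \<subseteq> Q" for a I
    using finite_subset[OF that(2) Q] that
  proof (induction I rule: finite_induct)
    case (insert x F)
    then show ?case
      by (simp add: ip_simps d sum_closed subset_iff)
  qed (simp add: ip_def compose_simps)
  have mem: "sum d Q \<in> A"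
    by (intro sum_closed d)
  have off: "ip (d r) (d r') = 0" if "r \<in> Q" "r' \<in> Q" "r \<noteq> r'" for r r'
    using that orth[of r r'] orth[of r' r] ip_commute[of "d r" "d r'"] d by (cases r r' rule: linorder_cases) auto
  have "ip (sum d Q) (d r) = ip (d r) (d r)" if r: "r \<in> Q" for r
  proof -
    have "ip (sum d Q) (d r) = (\<Sum>r'\<in>Q. ip (d r) (d r'))"
      using ip_commute[OF mem d[OF r]] sums[OF d[OF r]] by simp
    also have "\<dots> = (\<Sum>r'\<in>Q. if r' = r then ip (d r) (d r) else 0)"
      using off[OF r] by (intro sum.cong) auto
    finally show ?thesis
      using r Q by simp
  qed
  then show ?thesis
    using sums[OF mem order_refl] by (simp add: n2_sq mem d)
qed

end

text \<open>
  The exponents \<open>(2; 2)\<close> and \<open>(2, 2; 1)\<close> are the members of the family of norms that the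
  stochastic estimates use.
\<close>

lemma triple_norm_bounds:
  assumes tA: "tracial A EA" and tB: "tracial B EB"
  shows "triple_norm A EA EB 1 \<Lambda> < ennreal e \<Longrightarrow> multilinear_on A 1 B \<Lambda> \<Longrightarrow> h \<in> A \<Longrightarrow>
      tracial.n2 EB (\<Lambda> [h]) \<le> e * tracial.n2 EA h"
    "triple_norm A EA EB 2 \<Lambda> < ennreal e \<Longrightarrow> multilinear_on A 2 B \<Lambda> \<Longrightarrow> h \<in> A \<Longrightarrow>
      tracial.n1 EB (\<Lambda> [h, h]) \<le> e * (tracial.n2 EA h)\<^sup>2"
proof -
  interpret A: tracial A EA by fact
  interpret B: tracial B EB by fact
  have scale: "\<exists>k\<in>A. h = A.n2 h *\<^sub>R k \<and> A.n2 k \<le> 1" if h: "h \<in> A" for h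
  proof (cases "A.n2 h = 0")
    case True
    then show ?thesis
      using A.n2_eq_0[OF h] by (intro bexI[of _ 0]) auto
  next
    case False
    then show ?thesis
      using h by (intro bexI[of _ "(1 / A.n2 h) *\<^sub>R h"]) (auto simp: A.n2_scaleR)
  qed
  have lt: "x \<le> e" if "ennreal x \<le> T" "T < ennreal e" "0 \<le> x" for x e T
  proof -
    have "ennreal x < ennreal e"
      using that by (rule_tac le_less_trans)
    then show ?thesis
      using that(3) by (simp add: ennreal_less_iff)
  qed
  show "B.n2 (\<Lambda> [h]) \<le> e * A.n2 h"
    if T: "triple_norm A EA EB 1 \<Lambda> < ennreal e" and L: "multilinear_on A 1 B \<Lambda>" and h: "h \<in> A" for \<Lambda> e h
  proof -
    obtain k where k: "k \<in> A" "h = A.n2 h *\<^sub>R k" "A.n2 k \<le> 1"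
      using scale[OF h] by blast
    have "ennreal (Lp_norm EB 2 (\<Lambda> [k])) \<le> multi_norm A EA EB [2] 2 \<Lambda>"
      unfolding multi_norm_def using k by (intro SUP_upper) (simp add: tuples_def A.Lp_norm_2)
    also have "\<dots> \<le> triple_norm A EA EB 1 \<Lambda>"
    proof -
      have "([2], 2) \<in> {(ps, p). length ps = 1 \<and> (\<forall>q\<in>set ps. 1 \<le> q) \<and> 1 \<le> p \<and> (\<Sum>q\<leftarrow>ps. inverse q) = inverse (p::ennreal)}"
        by simp
      from SUP_upper[OF this, of "\<lambda>(ps, p). multi_norm A EA EB ps p \<Lambda>"] show ?thesis
        by (simp add: triple_norm_def)
    qed
    finally have "B.n2 (\<Lambda> [k]) \<le> e"
      using multilinear_on_1(1)[OF L k(1)] by (intro lt[OF _ T]) (simp_all add: B.Lp_norm_2)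
    moreover have "\<Lambda> [h] = A.n2 h *\<^sub>R \<Lambda> [k]"
      using multilinear_on_1(3)[OF L k(1), of "A.n2 h"] k(2) by simp
    ultimately show ?thesis
      using multilinear_on_1(1)[OF L k(1)] h mult_right_mono[of "B.n2 (\<Lambda> [k])" e "A.n2 h"]
      by (simp add: B.n2_scaleR mult.commute)
  qed
  show "B.n1 (\<Lambda> [h, h]) \<le> e * (A.n2 h)\<^sup>2"
    if T: "triple_norm A EA EB 2 \<Lambda> < ennreal e" and L: "multilinear_on A 2 B \<Lambda>" and h: "h \<in> A" for \<Lambda> e h
  proof -
    obtain k where k: "k \<in> A" "h = A.n2 h *\<^sub>R k" "A.n2 k \<le> 1"
      using scale[OF h] by blast
    have "ennreal (Lp_norm EB 1 (\<Lambda> [k, k])) \<le> multi_norm A EA EB [2, 2] 1 \<Lambda>"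
      unfolding multi_norm_def using k
      by (intro SUP_upper) (auto simp: tuples_def A.Lp_norm_2 less_Suc_eq nth_Cons')
    also have "\<dots> \<le> triple_norm A EA EB 2 \<Lambda>"
    proof -
      have "inverse (2::ennreal) + inverse 2 = inverse 1"
      proof -
        have "inverse (2::ennreal) = ennreal (1/2)"
          using inverse_ennreal[of 2] by simp
        then have "inverse (2::ennreal) + inverse 2 = ennreal (1/2) + ennreal (1/2)"
          by (simp only:)
        also have "\<dots> = ennreal (1/2 + 1/2)"
          by (rule ennreal_plus[symmetric]) simp_all
        finally show ?thesis
          by simp
      qed
      then have "([2, 2], 1) \<in> {(ps, p). length ps = 2 \<and> (\<forall>q\<in>set ps. 1 \<le> q) \<and> 1 \<le> p \<and> (\<Sum>q\<leftarrow>ps. inverse q) = inverse (p::ennreal)}"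
        by simp
      from SUP_upper[OF this, of "\<lambda>(ps, p). multi_norm A EA EB ps p \<Lambda>"] show ?thesis
        by (simp add: triple_norm_def)
    qed
    finally have "B.n1 (\<Lambda> [k, k]) \<le> e"
      using multilinear_on_2(1)[OF L k(1) k(1)] by (intro lt[OF _ T]) (simp_all add: B.Lp_norm_1)
    moreover have "\<Lambda> [h, h] = (A.n2 h)\<^sup>2 *\<^sub>R \<Lambda> [k, k]"
      using multilinear_on_2(2)[OF L k(1), of "A.n2 h *\<^sub>R k" "A.n2 h"] multilinear_on_2(3)[OF L k(1) k(1), of "A.n2 h"] k(1,2) h
      by (simp add: power2_eq_square)
    ultimately show ?thesis
      using multilinear_on_2(1)[OF L k(1) k(1)] h mult_right_mono[of "B.n1 (\<Lambda> [k, k])" e "(A.n2 h)\<^sup>2"]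
      by (simp add: B.n1_scaleR mult.commute)
  qed
qed

lemma multilinear_on_diff:
  assumes "vn_algebra B" "multilinear_on A k B \<Lambda>" "multilinear_on A k B \<Lambda>'"
  shows "multilinear_on A k B (\<lambda>hs. \<Lambda> hs - \<Lambda>' hs)"
  using assms(2,3) vn_algebra.closed(2)[OF assms(1)]
  by (simp add: multilinear_on_def scaleR_diff_right)

lemma scaleC_zero_right [simp]: "c *\<^sub>C (0::'x::complex_hilbert) = 0"
proof -
  have "\<i> *\<^sub>C 0 = (0::'x)"
    using scaleC_ii_scaleR[of 0 "0::'x"] by simp
  then show ?thesis
    using scaleC_eq[of c "0::'x"] by simp
qed

lemma scale_op_zero [simp]: "scale_op c 0 = 0"
  by (rule blinfun_eqI) simp

lemma op_re_im_hermitian: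
  assumes "adj h = h"
  shows "op_re h = h" "op_im h = 0"
proof -
  show "op_re h = h"
    by (rule blinfun_eqI)
      (simp add: op_re_def assms blinfun.bilinear_simps scaleR_2[symmetric])
  show "op_im h = 0"
    by (simp add: op_im_def assms)
qed

lemma complex_ext_hermitian:
  assumes h: "h \<in> self_adjoints A" and zero: "0 \<in> self_adjoints A"
  shows "multilinear_on (self_adjoints A) 1 B \<Lambda> \<Longrightarrow> complex_ext \<Lambda> [h] = \<Lambda> [h]"
    "multilinear_on (self_adjoints A) 2 B \<Lambda> \<Longrightarrow> complex_ext \<Lambda> [h, h] = \<Lambda> [h, h]"
proof -
  have r: "op_re h = h" "op_im h = 0"
    using h op_re_im_hermitian[of h] by (auto simp: self_adjoints_def)
  show "complex_ext \<Lambda> [h] = \<Lambda> [h]" if "multilinear_on (self_adjoints A) 1 B \<Lambda>"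
    using multilinear_on_1(3)[OF that zero, of 0] by (simp add: r)
  show "complex_ext \<Lambda> [h, h] = \<Lambda> [h, h]" if L: "multilinear_on (self_adjoints A) 2 B \<Lambda>"
    using multilinear_on_2(2)[OF L zero h, of 0] multilinear_on_2(3)[OF L h zero, of 0]
      multilinear_on_2(2)[OF L zero zero, of 0] by (simp add: r)
qed

section \<open>Riemann sums of an adapted map along a decomposable process\<close>

locale ito_setting = A: tracial A EA + B: tracial B EB
  for A :: "'h::complex_hilbert operator set" and EA
    and B :: "'k::complex_hilbert operator set" and EB +
  fixes \<A> :: "real \<Rightarrow> 'h operator set" and \<B> :: "real \<Rightarrow> 'k operator set"
    and \<beta> :: base and U :: "'h operator set" and F :: "'h operator \<Rightarrow> 'k operator"
    and X M Y :: "real \<Rightarrow> 'h operator" and t :: real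
  assumes filt_A: "filtered_wstar_prob_space A \<A> EA"
    and filt_B: "filtered_wstar_prob_space B \<B> EB"
    and open_U: "openin (top_of_set (base_set \<beta> A)) U"
    and adapted_F: "adapted_Ck A \<A> EA B \<B> EB \<beta> U 2 F"
    and adapted_X: "adapted_process \<A> X"
    and X_eq: "\<And>s. 0 \<le> s \<Longrightarrow> X s = X 0 + M s + Y s" and M_0: "M 0 = 0"
    and martingale_M: "martingale A \<A> EA M" and cont_M: "continuous_on {0..} M"
    and adapted_Y: "adapted_process \<A> Y" and cont_Y: "continuous_on {0..} Y"
    and variation_Y: "locally_bounded_variation Y"
    and X_U: "\<And>s. 0 \<le> s \<Longrightarrow> X s \<in> U"
    and t_nonneg: "0 \<le> t"
begin

abbreviation D :: "'h operator \<Rightarrow> 'h operator list \<Rightarrow> 'k operator" where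
  "D \<equiv> deriv_map \<beta> F"

lemma sub_A: "0 \<le> s \<Longrightarrow> subalgebra A EA (\<A> s)"
  using filt_A unfolding filtered_wstar_prob_space_def
  by (intro subalgebra.intro subalgebra_axioms.intro vn_algebra.intro A.tracial_axioms) simp_all

lemma sub_B: "0 \<le> s \<Longrightarrow> subalgebra B EB (\<B> s)"
  using filt_B unfolding filtered_wstar_prob_space_def
  by (intro subalgebra.intro subalgebra_axioms.intro vn_algebra.intro B.tracial_axioms) simp_all

lemma A_mono: "0 \<le> s \<Longrightarrow> s \<le> u \<Longrightarrow> \<A> s \<subseteq> \<A> u" and B_mono: "0 \<le> s \<Longrightarrow> s \<le> u \<Longrightarrow> \<B> s \<subseteq> \<B> u"
  using filt_A filt_B unfolding filtered_wstar_prob_space_def by auto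

lemma A_sub: "0 \<le> s \<Longrightarrow> \<A> s \<subseteq> A"
  using filt_A unfolding filtered_wstar_prob_space_def by auto

lemma M_mem: "0 \<le> s \<Longrightarrow> M s \<in> \<A> s" and Y_mem: "0 \<le> s \<Longrightarrow> Y s \<in> \<A> s" and X_mem: "0 \<le> s \<Longrightarrow> X s \<in> \<A> s"
  using martingale_M adapted_Y adapted_X unfolding martingale_def adapted_process_def by auto

lemma process_A: "0 \<le> s \<Longrightarrow> M s \<in> A" "0 \<le> s \<Longrightarrow> Y s \<in> A" "0 \<le> s \<Longrightarrow> X s \<in> A"
  using M_mem Y_mem X_mem A_sub by blast+

lemma base_closed:
  "x \<in> base_set \<beta> A \<Longrightarrow> y \<in> base_set \<beta> A \<Longrightarrow> x + y \<in> base_set \<beta> A"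
  "x \<in> base_set \<beta> A \<Longrightarrow> y \<in> base_set \<beta> A \<Longrightarrow> x - y \<in> base_set \<beta> A"
  "x \<in> base_set \<beta> A \<Longrightarrow> r *\<^sub>R x \<in> base_set \<beta> A"
  by (cases \<beta>; simp add: self_adjoints_def adj_simps A.bounded)+

lemma base_A: "x \<in> base_set \<beta> A \<Longrightarrow> x \<in> A"
  by (cases \<beta>) (simp_all add: self_adjoints_def)

lemma U_base: "x \<in> U \<Longrightarrow> x \<in> base_set \<beta> A"
  using openin_subset[OF open_U] by auto

lemma D_multilinear: "x \<in> U \<Longrightarrow> i \<le> 2 \<Longrightarrow> multilinear_on A i B (D x)"
  using adapted_F unfolding adapted_Ck_def bounded_multi_def by blast

lemma D_multilinear_1: "x \<in> U \<Longrightarrow> multilinear_on A 1 B (D x)"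
  and D_multilinear_2: "x \<in> U \<Longrightarrow> multilinear_on A 2 B (D x)"
  by (rule D_multilinear; simp)+

lemmas D1_mem = multilinear_on_1(1)[OF D_multilinear_1]
  and D1_add = multilinear_on_1(2)[OF D_multilinear_1]
  and D1_scaleR = multilinear_on_1(3)[OF D_multilinear_1]
  and D2_mem = multilinear_on_2(1)[OF D_multilinear_2]

lemma frechet: "frechet_Ck_on (base_set \<beta> A) U B 2 F"
  using adapted_F unfolding adapted_Ck_def by blast

lemma iter_multilinear: "x \<in> U \<Longrightarrow> i \<le> 2 \<Longrightarrow> multilinear_on (base_set \<beta> A) i B (iter_deriv F x)"
  using frechet unfolding frechet_Ck_on_def by blast

lemma F_mem: "x \<in> U \<Longrightarrow> F x \<in> B"
  using iter_multilinear[of x 0] by (simp add: multilinear_on_def tuples_def iter_deriv_def)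

lemma D_eq_iter:
  assumes x: "x \<in> U" and h: "h \<in> base_set \<beta> A"
  shows "D x [h] = iter_deriv F x [h]" "D x [h, h] = iter_deriv F x [h, h]"
proof -
  have "D x [h] = iter_deriv F x [h] \<and> D x [h, h] = iter_deriv F x [h, h]"
  proof (cases \<beta>)
    case All_Elements
    then show ?thesis
      by (simp add: deriv_map_def)
  next
    case Self_Adjoint_Elements
    have z: "0 \<in> self_adjoints A"
      by (simp add: self_adjoints_def)
    show ?thesis
      using iter_multilinear[OF x, of 1] iter_multilinear[OF x, of 2] h Self_Adjoint_Elements
        complex_ext_hermitian[OF _ z, of h B "iter_deriv F x"] by (simp add: deriv_map_def)
  qed
  then show "D x [h] = iter_deriv F x [h]" "D x [h, h] = iter_deriv F x [h, h]"
    by blast+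
qed

lemma D_cond_exp:
  assumes s: "0 \<le> s" "s \<le> u" and b: "b \<in> A"
  shows "cond_exp B EB (\<B> u) (D (X s) [b]) = D (X s) [cond_exp A EA (\<A> u) b]"
proof -
  have "D (X s) \<in> adapted_multi A \<A> EA B \<B> EB 1 s"
    using adapted_F s(1) X_U[OF s(1)] X_mem[OF s(1)] unfolding adapted_Ck_def by force
  moreover have "[0] \<in> tuples (\<A> u) 1"
    using subalgebra.axioms(2)[OF sub_A[of u]] s by (simp add: tuples_def vn_algebra.zero_closed)
  ultimately have "cond_exp B EB (\<B> u) (D (X s) ([0][0 := b])) = D (X s) ([0][0 := cond_exp A EA (\<A> u) b])"
    using s(2) b unfolding adapted_multi_def by fastforce
  then show ?thesis
    by simp
qed

definition path :: "'h operator set" where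
  "path = X ` {0..t}"

lemma cont_X: "continuous_on {0..} X"
proof -
  have "continuous_on {0..} (\<lambda>s. X 0 + M s + Y s)"
    by (intro continuous_intros cont_M cont_Y)
  then show ?thesis
    by (rule continuous_on_eq) (simp add: X_eq[symmetric])
qed

lemma compact_path: "compact path" and path_U: "path \<subseteq> U"
  unfolding path_def using X_U
  by (auto intro!: compact_continuous_image continuous_on_subset[OF cont_X])

lemma X_uniformly_continuous:
  assumes "0 < e"
  shows "\<exists>d>0. \<forall>s\<in>{0..t}. \<forall>u\<in>{0..t}. \<bar>s - u\<bar> < d \<longrightarrow> dist (X s) (X u) < e"
proof -
  have "uniformly_continuous_on {0..t} X"
    by (intro compact_uniformly_continuous continuous_on_subset[OF cont_X]) auto
  then obtain d where "0 < d" "\<And>u s. u \<in> {0..t} \<Longrightarrow> s \<in> {0..t} \<Longrightarrow> dist s u < d \<Longrightarrow> dist (X s) (X u) < e"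
    using assms unfolding uniformly_continuous_on_def by meson
  then show ?thesis
    by (intro exI[of _ d]) (simp add: dist_real_def)
qed

lemma D_modulus:
  assumes "x \<in> U" "i \<le> 2" "0 < e"
  shows "\<exists>d>0. \<forall>y\<in>U. dist y x < d \<longrightarrow> triple_norm A EA EB i (\<lambda>hs. D y hs - D x hs) < ennreal e"
  using adapted_F assms unfolding adapted_Ck_def by blast

lemma D1_modulus:
  assumes e: "0 < e"
  shows "\<exists>d>0. \<forall>x\<in>path. \<forall>y\<in>U. dist y x < d \<longrightarrow> (\<forall>h\<in>A. B.n2 (D y [h] - D x [h]) \<le> e * A.n2 h)"
proof (rule compact_uniform_modulus[OF compact_path path_U,
      where G = "\<lambda>x y. \<forall>h\<in>A. B.n2 (D y [h] - D x [h]) \<le> e / 2 * A.n2 h"])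
  fix x assume "x \<in> path"
  then have x: "x \<in> U"
    using path_U by blast
  have e2: "0 < e / 2"
    using e by simp
  obtain d where d: "d > 0" "\<And>y. y \<in> U \<Longrightarrow> dist y x < d \<Longrightarrow>
      triple_norm A EA EB 1 (\<lambda>hs. D y hs - D x hs) < ennreal (e / 2)"
    using D_modulus[OF x _ e2, of 1] by auto
  have "B.n2 (D y [h] - D x [h]) \<le> e / 2 * A.n2 h" if "y \<in> U" "dist y x < d" "h \<in> A" for y h
    by (rule triple_norm_bounds(1)[OF A.tracial_axioms B.tracial_axioms d(2)[OF that(1,2)]
        multilinear_on_diff[OF B.vn_algebra_axioms D_multilinear_1[OF that(1)] D_multilinear_1[OF x]] that(3)])
  then show "\<exists>d>0. \<forall>y\<in>U. dist y x < d \<longrightarrow> (\<forall>h\<in>A. B.n2 (D y [h] - D x [h]) \<le> e / 2 * A.n2 h)"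
    using d(1) by blast
next
  fix x y z assume U: "z \<in> path" "x \<in> path" "y \<in> U"
    and G: "\<forall>h\<in>A. B.n2 (D x [h] - D z [h]) \<le> e / 2 * A.n2 h" "\<forall>h\<in>A. B.n2 (D y [h] - D z [h]) \<le> e / 2 * A.n2 h"
  show "\<forall>h\<in>A. B.n2 (D y [h] - D x [h]) \<le> e * A.n2 h"
  proof
    fix h assume h: "h \<in> A"
    have m: "D x [h] \<in> B" "D y [h] \<in> B" "D z [h] \<in> B"
      using U path_U h by (auto intro: D1_mem)
    have "B.n2 (D y [h] - D x [h]) \<le> B.n2 (D y [h] - D z [h]) + B.n2 (D x [h] - D z [h])"
      using B.n2_triangle_diff[OF m(2,3,1)] B.n2_minus_commute[OF m(1,3)] by simp
    also have "\<dots> \<le> e / 2 * A.n2 h + e / 2 * A.n2 h"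
      using G h by (intro add_mono) auto
    finally show "B.n2 (D y [h] - D x [h]) \<le> e * A.n2 h"
      by (simp add: field_simps)
  qed
qed

lemma D2_modulus:
  assumes e: "0 < e"
  shows "\<exists>d>0. \<forall>x\<in>path. \<forall>y\<in>U. dist y x < d \<longrightarrow> (\<forall>h\<in>A. B.n1 (D y [h, h] - D x [h, h]) \<le> e * (A.n2 h)\<^sup>2)"
proof (rule compact_uniform_modulus[OF compact_path path_U,
      where G = "\<lambda>x y. \<forall>h\<in>A. B.n1 (D y [h, h] - D x [h, h]) \<le> e / 2 * (A.n2 h)\<^sup>2"])
  interpret L1: Lp_seminorm B EB 1 B.n1
    by (rule B.Lp_seminorm_1)
  fix x assume "x \<in> path"
  then have x: "x \<in> U"
    using path_U by blast
  have e2: "0 < e / 2"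
    using e by simp
  obtain d where d: "d > 0" "\<And>y. y \<in> U \<Longrightarrow> dist y x < d \<Longrightarrow>
      triple_norm A EA EB 2 (\<lambda>hs. D y hs - D x hs) < ennreal (e / 2)"
    using D_modulus[OF x _ e2, of 2] by auto
  have "B.n1 (D y [h, h] - D x [h, h]) \<le> e / 2 * (A.n2 h)\<^sup>2" if "y \<in> U" "dist y x < d" "h \<in> A" for y h
    by (rule triple_norm_bounds(2)[OF A.tracial_axioms B.tracial_axioms d(2)[OF that(1,2)]
        multilinear_on_diff[OF B.vn_algebra_axioms D_multilinear_2[OF that(1)] D_multilinear_2[OF x]] that(3)])
  then show "\<exists>d>0. \<forall>y\<in>U. dist y x < d \<longrightarrow> (\<forall>h\<in>A. B.n1 (D y [h, h] - D x [h, h]) \<le> e / 2 * (A.n2 h)\<^sup>2)"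
    using d(1) by blast
next
  interpret L1: Lp_seminorm B EB 1 B.n1
    by (rule B.Lp_seminorm_1)
  fix x y z assume U: "z \<in> path" "x \<in> path" "y \<in> U"
    and G: "\<forall>h\<in>A. B.n1 (D x [h, h] - D z [h, h]) \<le> e / 2 * (A.n2 h)\<^sup>2"
      "\<forall>h\<in>A. B.n1 (D y [h, h] - D z [h, h]) \<le> e / 2 * (A.n2 h)\<^sup>2"
  show "\<forall>h\<in>A. B.n1 (D y [h, h] - D x [h, h]) \<le> e * (A.n2 h)\<^sup>2"
  proof
    fix h assume h: "h \<in> A"
    have m: "D x [h, h] \<in> B" "D y [h, h] \<in> B" "D z [h, h] \<in> B"
      using U path_U h by (auto intro: D2_mem)
    have "B.n1 (D y [h, h] - D x [h, h]) \<le> B.n1 (D y [h, h] - D z [h, h]) + B.n1 (D x [h, h] - D z [h, h])"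
      using L1.nu_diff_triangle[OF m(2,3,1)] L1.nu_minus_commute[OF m(1,3)] by simp
    also have "\<dots> \<le> e / 2 * (A.n2 h)\<^sup>2 + e / 2 * (A.n2 h)\<^sup>2"
      using G h by (intro add_mono) auto
    finally show "B.n1 (D y [h, h] - D x [h, h]) \<le> e * (A.n2 h)\<^sup>2"
      by (simp add: field_simps)
  qed
qed

lemma path_neighbourhood: "\<exists>d>0. \<forall>x\<in>path. \<forall>y\<in>base_set \<beta> A. dist y x < d \<longrightarrow> y \<in> U"
proof -
  obtain O' where O': "open O'" "U = base_set \<beta> A \<inter> O'"
    using open_U unfolding openin_open by blast
  have cover: "path \<subseteq> \<Union>{O'}" and op: "\<And>b. b \<in> {O'} \<Longrightarrow> open b"
    using path_U O' by auto
  obtain e where e: "e > 0" "\<And>x. x \<in> path \<Longrightarrow> \<exists>b\<in>{O'}. ball x e \<subseteq> b"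
    by (rule Heine_Borel_lemma[OF compact_path cover op]) (assumption, rule that)
  then show ?thesis
    using O' by (intro exI[of _ e]) (auto simp: subset_iff dist_commute)
qed

subsection \<open>Martingale increments\<close>

lemma increment_mem:
  assumes Q: "is_partition t Q" and r: "r \<in> Q"
  shows "increment M Q r \<in> \<A> r" "increment Y Q r \<in> A" "increment X Q r \<in> base_set \<beta> A"
    "increment M Q r \<in> A" "increment X Q r = increment M Q r + increment Y Q r"
proof -
  have r0: "0 \<le> r"
    by (rule partition_facts(4)[OF Q r])
  note b = left_nb_bounds[OF Q r0]
  interpret S: subalgebra A EA "\<A> r"
    by (rule sub_A[OF r0])
  have "M (left_nb Q r) \<in> \<A> r"
    using M_mem[OF b(3)] A_mono[OF b(3,2)] by blast
  then show m: "increment M Q r \<in> \<A> r"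
    using M_mem[OF r0] by (simp add: increment_def)
  then show "increment M Q r \<in> A"
    by simp
  show "increment Y Q r \<in> A"
    using process_A(2)[OF r0] process_A(2)[OF b(3)] by (simp add: increment_def)
  show "increment X Q r \<in> base_set \<beta> A"
    unfolding increment_def using X_U[OF r0] X_U[OF b(3)] by (intro base_closed U_base)
  show "increment X Q r = increment M Q r + increment Y Q r"
    using X_eq[OF r0] X_eq[OF b(3)] by (simp add: increment_def)
qed

lemma increment_cond_exp:
  assumes Q: "is_partition t Q" and r: "r \<in> Q"
  shows "cond_exp A EA (\<A> (left_nb Q r)) (increment M Q r) = 0"
proof -
  have r0: "0 \<le> r"
    by (rule partition_facts(4)[OF Q r])
  note b = left_nb_bounds[OF Q r0]
  interpret S: subalgebra A EA "\<A> (left_nb Q r)"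
    by (rule sub_A[OF b(3)])
  have "cond_exp A EA (\<A> (left_nb Q r)) (M r) = M (left_nb Q r)"
    using martingale_M b unfolding martingale_def by blast
  then show ?thesis
    using S.cond_exp_diff[OF process_A(1)[OF r0] process_A(1)[OF b(3)]] S.cond_exp_id[OF M_mem[OF b(3)]]
    by (simp add: increment_def)
qed

text \<open>
  Integrating adapted coefficients against martingale increments gives terms that are
  orthogonal in \<open>L\<^sup>2\<close>: the earlier one is measurable at the left end point of the later
  interval, and the conditional expectation of the later one there vanishes.
\<close>

lemma orthogonal_sum:
  fixes lam :: "real \<Rightarrow> 'h operator \<Rightarrow> 'k operator"
  assumes Q: "is_partition t Q" and e: "0 \<le> e"
    and mem: "\<And>r h. r \<in> Q \<Longrightarrow> h \<in> A \<Longrightarrow> lam r h \<in> B" and zero: "\<And>r. r \<in> Q \<Longrightarrow> lam r 0 = 0"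
    and ce: "\<And>r v h. r \<in> Q \<Longrightarrow> left_nb Q r \<le> v \<Longrightarrow> h \<in> A \<Longrightarrow>
        cond_exp B EB (\<B> v) (lam r h) = lam r (cond_exp A EA (\<A> v) h)"
    and bnd: "\<And>r h. r \<in> Q \<Longrightarrow> h \<in> A \<Longrightarrow> B.n2 (lam r h) \<le> e * A.n2 h"
  shows "(B.n2 (\<Sum>r\<in>Q. lam r (increment M Q r)))\<^sup>2 \<le> e\<^sup>2 * (\<Sum>r\<in>Q. (A.n2 (increment M Q r))\<^sup>2)"
proof -
  define d where "d r = lam r (increment M Q r)" for r
  have dB: "d r \<in> B" if "r \<in> Q" for r
    unfolding d_def by (intro mem that increment_mem(4)[OF Q that])
  have d_adapted: "d r \<in> \<B> r" if r: "r \<in> Q" for r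
  proof -
    have r0: "0 \<le> r"
      by (rule partition_facts(4)[OF Q r])
    interpret SA: subalgebra A EA "\<A> r"
      by (rule sub_A[OF r0])
    interpret SB: subalgebra B EB "\<B> r"
      by (rule sub_B[OF r0])
    have "cond_exp B EB (\<B> r) (d r) = d r"
      unfolding d_def ce[OF r left_nb_bounds(2)[OF Q r0] increment_mem(4)[OF Q r]]
      by (simp add: SA.cond_exp_id increment_mem(1)[OF Q r])
    then show ?thesis
      using SB.cond_exp_mem[OF dB[OF r]] by simp
  qed
  have orth: "B.ip (d r) (d r') = 0" if r: "r \<in> Q" "r' \<in> Q" "r < r'" for r r'
  proof -
    let ?l = "left_nb Q r'"
    have r0: "0 \<le> r" "0 < r'"
      using partition_facts(4)[OF Q r(1)] r(3) by auto
    have rl: "r \<le> ?l"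
      by (rule left_nb_pos(3)[OF Q r0(2) r(1,3)])
    then have l0: "0 \<le> ?l"
      using r0(1) by simp
    interpret SB: subalgebra B EB "\<B> ?l"
      by (rule sub_B[OF l0])
    have "d r \<in> \<B> ?l"
      using d_adapted[OF r(1)] B_mono[OF r0(1) rl] by blast
    then have "B.ip (d r) (d r') = B.ip (d r) (cond_exp B EB (\<B> ?l) (d r'))"
      by (rule SB.cond_exp_ip[OF dB[OF r(2)], symmetric])
    also have "cond_exp B EB (\<B> ?l) (d r') = 0"
      unfolding d_def ce[OF r(2) order_refl increment_mem(4)[OF Q r(2)]]
      by (simp add: increment_cond_exp[OF Q r(2)] zero[OF r(2)])
    finally show ?thesis
      by (simp add: B.ip_def compose_simps)
  qed
  have "(B.n2 (\<Sum>r\<in>Q. d r))\<^sup>2 = (\<Sum>r\<in>Q. (B.n2 (d r))\<^sup>2)"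
    by (rule B.pythagoras[OF dB orth partition_facts(1)[OF Q]])
  also have "\<dots> \<le> (\<Sum>r\<in>Q. e\<^sup>2 * (A.n2 (increment M Q r))\<^sup>2)"
  proof (rule sum_mono)
    fix r assume r: "r \<in> Q"
    have "(B.n2 (d r))\<^sup>2 \<le> (e * A.n2 (increment M Q r))\<^sup>2"
      unfolding d_def by (intro power_mono bnd B.n2_nonneg mem r increment_mem(4)[OF Q r])
    then show "(B.n2 (d r))\<^sup>2 \<le> e\<^sup>2 * (A.n2 (increment M Q r))\<^sup>2"
      by (simp only: power_mult_distrib)
  qed
  finally show ?thesis
    by (simp add: d_def sum_distrib_left)
qed

lemma sum_increment_M_sq:
  assumes Q: "is_partition t Q"
  shows "(\<Sum>r\<in>Q. (A.n2 (increment M Q r))\<^sup>2) = (A.n2 (M t))\<^sup>2"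
proof -
  have orth: "A.ip (increment M Q r) (increment M Q r') = 0" if r: "r \<in> Q" "r' \<in> Q" "r < r'" for r r'
  proof -
    let ?l = "left_nb Q r'"
    have r0: "0 \<le> r" "0 < r'"
      using partition_facts(4)[OF Q r(1)] r(3) by auto
    have rl: "r \<le> ?l"
      by (rule left_nb_pos(3)[OF Q r0(2) r(1,3)])
    then have l0: "0 \<le> ?l"
      using r0(1) by simp
    interpret S: subalgebra A EA "\<A> ?l"
      by (rule sub_A[OF l0])
    have "increment M Q r \<in> \<A> ?l"
      using increment_mem(1)[OF Q r(1)] A_mono[OF r0(1) rl] by blast
    then have "A.ip (increment M Q r) (increment M Q r') =
        A.ip (increment M Q r) (cond_exp A EA (\<A> ?l) (increment M Q r'))"
      by (rule S.cond_exp_ip[OF increment_mem(4)[OF Q r(2)], symmetric])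
    then show ?thesis
      by (simp add: increment_cond_exp[OF Q r(2)] A.ip_def compose_simps)
  qed
  have "(\<Sum>r\<in>Q. increment M Q r) = M t"
    using telescope_partition[OF Q, of M] by (simp add: increment_def M_0)
  then show ?thesis
    using A.pythagoras[where d = "increment M Q" and Q = Q, OF increment_mem(4)[OF Q] orth partition_facts(1)[OF Q]]
    by simp
qed

lemma variation_bound:
  obtains C where "0 \<le> C" "\<And>Q. is_partition t Q \<Longrightarrow> (\<Sum>r\<in>Q. norm (increment Y Q r)) \<le> C"
proof -
  obtain K where K: "\<And>Q. is_partition t Q \<Longrightarrow> (\<Sum>r\<in>Q. norm (increment Y Q r)) \<le> K"
    using variation_Y t_nonneg unfolding locally_bounded_variation_def by blast
  show thesis
    by (rule that[of "max 0 K"]) (auto intro: order_trans[OF K])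
qed

definition sum1 :: "real set \<Rightarrow> 'k operator" where
  "sum1 P = (\<Sum>s\<in>P. D (X (left_nb P s)) [increment X P s])"

definition sum2 :: "real set \<Rightarrow> 'k operator" where
  "sum2 P = (\<Sum>s\<in>P. D (X (left_nb P s)) [increment X P s, increment X P s])"

lemma X_left_U: "is_partition t P \<Longrightarrow> 0 \<le> s \<Longrightarrow> X (left_nb P s) \<in> U"
  by (rule X_U[OF left_nb_bounds(3)])

lemma sums_mem:
  assumes P: "is_partition t P"
  shows "sum1 P \<in> B" "sum2 P \<in> B"
  unfolding sum1_def sum2_def
  using X_left_U[OF P partition_facts(4)[OF P]] base_A[OF increment_mem(3)[OF P]]
  by (auto intro!: B.sum_closed D1_mem D2_mem)

text \<open>
  On the common refinement the two sums have the same increments, and their difference is the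
  sum for the differences of the coefficients. These are adapted, since both left neighbours
  lie at or before the left end point of the refined interval.
\<close>

lemma sum1_diff_le:
  assumes P: "is_partition t P" and P': "is_partition t P'" and e: "0 \<le> e"
    and close: "\<And>r h. r \<in> P \<union> P' \<Longrightarrow> h \<in> A \<Longrightarrow>
        B.n2 (D (X (left_nb P r)) [h] - D (X (left_nb P' r)) [h]) \<le> e * A.n2 h"
    and C: "(\<Sum>r\<in>P \<union> P'. norm (increment Y (P \<union> P') r)) \<le> C"
  shows "B.n2 (sum1 P - sum1 P') \<le> e * (A.n2 (M t) + C)"
proof -
  interpret L2: Lp_seminorm B EB 2 B.n2
    by (rule B.Lp_seminorm_2)
  let ?Q = "P \<union> P'"
  have Q: "is_partition t ?Q"
    using P P' by (auto simp: is_partition_def)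
  have Q0: "0 \<le> r" if "r \<in> ?Q" for r
    by (rule partition_facts(4)[OF Q that])
  have rep: "sum1 R = (\<Sum>r\<in>?Q. D (X (left_nb R r)) [increment X ?Q r])"
    if R: "is_partition t R" "R \<subseteq> ?Q" for R
    unfolding sum1_def
    by (rule refine_partition_sum[OF R(1) Q R(2), of X A "\<lambda>s h. D (X s) [h]"])
      (auto intro: process_A D1_add X_U partition_facts(4)[OF R(1)])
  define lam where "lam r h = D (X (left_nb P r)) [h] - D (X (left_nb P' r)) [h]" for r h
  have lamB: "lam r h \<in> B" if "r \<in> ?Q" "h \<in> A" for r h
    unfolding lam_def by (intro B.closed D1_mem X_left_U P P' Q0 that)
  have lam_add: "lam r (h + k) = lam r h + lam r k" if "r \<in> ?Q" "h \<in> A" "k \<in> A" for r h k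
    unfolding lam_def using X_left_U[OF P Q0[OF that(1)]] X_left_U[OF P' Q0[OF that(1)]] that
    by (simp add: D1_add)
  have lam0: "lam r 0 = 0" if "r \<in> ?Q" for r
    using lam_add[OF that, of 0 0] by simp
  have bnd: "B.n2 (lam r h) \<le> e * A.n2 h" if "r \<in> ?Q" "h \<in> A" for r h
    unfolding lam_def by (rule close[OF that])
  have left_le: "left_nb R r \<le> left_nb ?Q r" if R: "is_partition t R" "R \<subseteq> ?Q" and r: "r \<in> ?Q" for R r
  proof (cases "r = 0")
    case False
    then have "0 < r"
      using Q0[OF r] by simp
    then show ?thesis
      using left_nb_pos[OF R(1)] left_nb_pos(3)[OF Q] R(2) by blast
  qed simp
  have ce: "cond_exp B EB (\<B> v) (lam r h) = lam r (cond_exp A EA (\<A> v) h)"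
    if r: "r \<in> ?Q" and v: "left_nb ?Q r \<le> v" and h: "h \<in> A" for r v h
  proof -
    have v0: "0 \<le> v"
      using left_nb_bounds(3)[OF Q Q0[OF r]] v by simp
    interpret SB: subalgebra B EB "\<B> v"
      by (rule sub_B[OF v0])
    have le: "left_nb P r \<le> v" "left_nb P' r \<le> v"
      using left_le[OF P _ r] left_le[OF P' _ r] v by auto
    show ?thesis
      unfolding lam_def
      using D_cond_exp[OF left_nb_bounds(3)[OF P Q0[OF r]] le(1) h]
        D_cond_exp[OF left_nb_bounds(3)[OF P' Q0[OF r]] le(2) h]
        D1_mem[OF X_left_U[OF P Q0[OF r]] h] D1_mem[OF X_left_U[OF P' Q0[OF r]] h]
      by (simp add: SB.cond_exp_diff)
  qed
  let ?SM = "\<Sum>r\<in>?Q. lam r (increment M ?Q r)" and ?SY = "\<Sum>r\<in>?Q. lam r (increment Y ?Q r)"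
  have mem: "?SM \<in> B" "?SY \<in> B"
    using increment_mem[OF Q] by (auto intro!: B.sum_closed lamB)
  have "sum1 P - sum1 P' = (\<Sum>r\<in>?Q. lam r (increment X ?Q r))"
    unfolding rep[OF P Un_upper1] rep[OF P' Un_upper2] lam_def by (simp add: sum_subtractf)
  also have "\<dots> = ?SM + ?SY"
    unfolding sum.distrib[symmetric]
    by (intro sum.cong refl) (simp only: increment_mem(5)[OF Q] lam_add[OF _ increment_mem(4)[OF Q] increment_mem(2)[OF Q]])
  finally have "B.n2 (sum1 P - sum1 P') \<le> B.n2 ?SM + B.n2 ?SY"
    using B.n2_triangle[OF mem] by simp
  also have "B.n2 ?SM \<le> e * A.n2 (M t)"
  proof (rule power2_le_imp_le)
    show "(B.n2 ?SM)\<^sup>2 \<le> (e * A.n2 (M t))\<^sup>2"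
      using orthogonal_sum[where lam = lam, OF Q e lamB lam0 ce bnd] by (simp add: sum_increment_M_sq[OF Q] power_mult_distrib)
    show "0 \<le> e * A.n2 (M t)"
      using e A.n2_nonneg[OF process_A(1)[OF t_nonneg]] by simp
  qed
  also have "B.n2 ?SY \<le> (\<Sum>r\<in>?Q. B.n2 (lam r (increment Y ?Q r)))"
    by (rule L2.nu_sum) (intro lamB increment_mem(2)[OF Q])
  also have "\<dots> \<le> (\<Sum>r\<in>?Q. e * norm (increment Y ?Q r))"
  proof (rule sum_mono)
    fix r assume r: "r \<in> ?Q"
    show "B.n2 (lam r (increment Y ?Q r)) \<le> e * norm (increment Y ?Q r)"
      using bnd[OF r increment_mem(2)[OF Q r]] mult_left_mono[OF A.n2_le_norm[OF increment_mem(2)[OF Q r]] e] by simp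
  qed
  also have "\<dots> \<le> e * C"
    unfolding sum_distrib_left[symmetric] by (rule mult_left_mono[OF C e])
  finally show ?thesis
    by (simp add: distrib_left)
qed

lemma sum1_Cauchy:
  assumes e: "0 < e"
  shows "\<exists>d>0. \<forall>P P'. is_partition t P \<and> mesh P < d \<and> is_partition t P' \<and> mesh P' < d \<longrightarrow>
      B.n2 (sum1 P - sum1 P') \<le> e"
proof -
  obtain C where C: "0 \<le> C" "\<And>Q. is_partition t Q \<Longrightarrow> (\<Sum>r\<in>Q. norm (increment Y Q r)) \<le> C"
    using variation_bound by blast
  let ?W = "A.n2 (M t) + C"
  have W: "0 \<le> ?W"
    using C(1) A.n2_nonneg[OF process_A(1)[OF t_nonneg]] by simp
  define e' where "e' = e / (?W + 1)"
  have e': "0 < e'" "e' * ?W \<le> e"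
  proof -
    show "0 < e'"
      using e W by (simp add: e'_def add_nonneg_pos)
    then have "e' * ?W \<le> e' * (?W + 1)"
      by (intro mult_left_mono) auto
    also have "\<dots> = e"
      using W by (simp add: e'_def)
    finally show "e' * ?W \<le> e" .
  qed
  obtain \<eta> where \<eta>: "0 < \<eta>" "\<And>x y h. x \<in> path \<Longrightarrow> y \<in> U \<Longrightarrow> dist y x < \<eta> \<Longrightarrow> h \<in> A \<Longrightarrow> B.n2 (D y [h] - D x [h]) \<le> e' * A.n2 h"
    using D1_modulus[OF e'(1)] by blast
  obtain d where d: "0 < d" "\<And>s u. s \<in> {0..t} \<Longrightarrow> u \<in> {0..t} \<Longrightarrow> \<bar>s - u\<bar> < d \<Longrightarrow> dist (X s) (X u) < \<eta>"
    using X_uniformly_continuous[OF \<eta>(1)] by blast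
  have "B.n2 (sum1 P - sum1 P') \<le> e"
    if P: "is_partition t P" "mesh P < d" and P': "is_partition t P'" "mesh P' < d" for P P'
  proof -
    have Q: "is_partition t (P \<union> P')"
      using P P' by (auto simp: is_partition_def)
    have "B.n2 (sum1 P - sum1 P') \<le> e' * ?W"
    proof (rule sum1_diff_le[OF P(1) P'(1) less_imp_le[OF e'(1)] _ C(2)[OF Q]])
      fix r h assume r: "r \<in> P \<union> P'" and h: "h \<in> A"
      have rt: "0 \<le> r" "r \<le> t"
        using partition_facts[OF Q] r by auto
      note b = left_nb_bounds[OF P(1) rt(1)] and b' = left_nb_bounds[OF P'(1) rt(1)]
      have "\<bar>left_nb P r - left_nb P' r\<bar> < d"
        using mesh_ge[OF P(1) rt] mesh_ge[OF P'(1) rt] b b' P(2) P'(2) by linarith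
      then have "dist (X (left_nb P r)) (X (left_nb P' r)) < \<eta>"
        using b b' rt by (intro d(2)) auto
      then show "B.n2 (D (X (left_nb P r)) [h] - D (X (left_nb P' r)) [h]) \<le> e' * A.n2 h"
        using b b' rt h by (intro \<eta>(2) X_left_U P) (auto simp: path_def)
    qed
    then show ?thesis
      using e'(2) by simp
  qed
  then show ?thesis
    using d(1) by blast
qed

subsection \<open>The Taylor remainder\<close>

lemma directional_derivative:
  assumes a: "a \<in> U" and h: "h \<in> base_set \<beta> A" and i: "i < 2" and hs: "hs \<in> tuples (base_set \<beta> A) i"
    and c: "0 < c" "\<And>s. \<bar>s\<bar> < c \<Longrightarrow> a + s *\<^sub>R h \<in> U" and e: "0 < e"
  shows "\<exists>d>0. \<forall>s. \<bar>s\<bar> < d \<longrightarrow>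
      norm (iter_deriv F (a + s *\<^sub>R h) hs - iter_deriv F a hs - iter_deriv F a (hs @ [s *\<^sub>R h])) \<le> e * \<bar>s\<bar>"
proof -
  define N where "N = (\<Prod>h'\<leftarrow>hs. norm h')"
  have N: "0 \<le> N"
    unfolding N_def by (induction hs) auto
  define e' where "e' = e / ((norm h + 1) * (N + 1))"
  have pos: "0 < norm h + 1" "0 < N + 1"
    using N by (simp_all add: add_nonneg_pos)
  then have e': "0 < e'"
    using e by (simp add: e'_def)
  obtain d where d: "0 < d" "\<And>k. k \<in> base_set \<beta> A \<Longrightarrow> norm k < d \<Longrightarrow> a + k \<in> U \<Longrightarrow>
      norm (iter_deriv F (a + k) hs - iter_deriv F a hs - iter_deriv F a (hs @ [k])) \<le> e' * norm k * N"
  proof -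
    have "\<exists>d>0. \<forall>k\<in>base_set \<beta> A. norm k < d \<and> a + k \<in> U \<longrightarrow>
        (\<forall>hs\<in>tuples (base_set \<beta> A) i.
           norm (iter_deriv F (a + k) hs - iter_deriv F a hs - iter_deriv F a (hs @ [k]))
             \<le> e' * norm k * (\<Prod>h'\<leftarrow>hs. norm h'))"
      using frechet a i e' unfolding frechet_Ck_on_def by blast
    then show thesis
      using that hs unfolding N_def by blast
  qed
  have "norm (iter_deriv F (a + s *\<^sub>R h) hs - iter_deriv F a hs - iter_deriv F a (hs @ [s *\<^sub>R h])) \<le> e * \<bar>s\<bar>"
    if s: "\<bar>s\<bar> < min c (d / (norm h + 1))" for s
  proof -
    have "norm (s *\<^sub>R h) \<le> \<bar>s\<bar> * (norm h + 1)"
      by (simp add: distrib_left)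
    also have "\<dots> < d"
      using s pos(1) by (simp add: pos_less_divide_eq)
    finally have "norm (iter_deriv F (a + s *\<^sub>R h) hs - iter_deriv F a hs - iter_deriv F a (hs @ [s *\<^sub>R h]))
        \<le> e' * norm (s *\<^sub>R h) * N"
      using s h by (intro d(2) base_closed c(2)) simp_all
    also have "\<dots> = (e' * \<bar>s\<bar>) * (norm h * N)"
      by simp
    also have "\<dots> \<le> (e' * \<bar>s\<bar>) * ((norm h + 1) * (N + 1))"
      using N e' by (intro mult_left_mono mult_mono) auto
    also have "\<dots> = e * \<bar>s\<bar>"
      using pos by (simp add: e'_def)
    finally show ?thesis .
  qed
  then show ?thesis
    using c(1) d(1) pos(1) by (intro exI[of _ "min c (d / (norm h + 1))"]) simp
qed

text \<open>
  By the duality between the \<open>L\<^sup>1\<close> norm and the operator norm, it suffices to bound \<open>\<tau>(b R)\<close> for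
  the remainder \<open>R\<close> and contractions \<open>b\<close>, which is the classical Lagrange remainder of the
  real function \<open>r \<mapsto> \<tau>(b F(x + r h))\<close>.
\<close>

lemma taylor_L1:
  assumes h: "h \<in> base_set \<beta> A" and seg: "\<And>r. \<bar>r\<bar> < 2 \<Longrightarrow> x + r *\<^sub>R h \<in> U"
    and bound: "\<And>r. 0 \<le> r \<Longrightarrow> r \<le> 1 \<Longrightarrow> B.n1 (D (x + r *\<^sub>R h) [h, h] - D x [h, h]) \<le> 2 * k"
  shows "B.n1 (F (x + h) - F x - D x [h] - (1/2) *\<^sub>R D x [h, h]) \<le> k"
proof -
  have x: "x \<in> U" and xh: "x + h \<in> U"
    using seg[of 0] seg[of 1] by simp_all
  have hA: "h \<in> A"
    by (rule base_A[OF h])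
  have mem: "F (x + h) \<in> B" "F x \<in> B" "D x [h] \<in> B" "D x [h, h] \<in> B"
    using x xh hA by (auto intro: F_mem D1_mem D2_mem)
  show ?thesis
  proof (rule B.n1_leI)
    show "F (x + h) - F x - D x [h] - (1/2) *\<^sub>R D x [h, h] \<in> B"
      using mem by simp
    fix b assume b: "b \<in> B" "norm b \<le> 1"
    define f0 where "f0 r = B.tau (b o\<^sub>L F (x + r *\<^sub>R h))" for r
    define f1 where "f1 r = B.tau (b o\<^sub>L D (x + r *\<^sub>R h) [h])" for r
    define f2 where "f2 r = B.tau (b o\<^sub>L D (x + r *\<^sub>R h) [h, h])" for r
    have shift: "x + (u + s) *\<^sub>R h = (x + u *\<^sub>R h) + s *\<^sub>R h" for u s
      by (simp add: scaleR_add_left)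
    have seg': "x + u *\<^sub>R h + s *\<^sub>R h \<in> U" if "\<bar>u\<bar> \<le> 1" "\<bar>s\<bar> < 1" for u s
      using seg[of "u + s"] that unfolding shift by linarith
    \<comment> \<open>The segment extends beyond both end points, so these derivatives are two-sided.\<close>
    have d0: "(f0 has_real_derivative f1 u) (at u)" if u: "\<bar>u\<bar> \<le> 1" for u
      unfolding f0_def f1_def
    proof (rule B.DERIV_tau[OF b _ zero_less_one])
      let ?a = "x + u *\<^sub>R h"
      have a: "?a \<in> U"
        using seg[of u] u by simp
      show "D ?a [h] \<in> B"
        by (rule D1_mem[OF a hA])
      show "F (x + (u + s) *\<^sub>R h) \<in> B" if "\<bar>s\<bar> < 1" for s
        unfolding shift by (rule F_mem[OF seg'[OF u that]])
      fix e :: real assume e: "0 < e"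
      have "iter_deriv F ?a [s *\<^sub>R h] = s *\<^sub>R D ?a [h]" for s
        using D_eq_iter(1)[OF a h] multilinear_on_1(3)[OF iter_multilinear[OF a, of 1] h] by simp
      then show "\<exists>d>0. \<forall>s. \<bar>s\<bar> < d \<longrightarrow>
          norm (F (x + (u + s) *\<^sub>R h) - F ?a - s *\<^sub>R D ?a [h]) \<le> e * \<bar>s\<bar>"
        using directional_derivative[OF a h, of 0 "[]" 1 e] seg'[OF u] e unfolding shift
        by (simp add: tuples_def iter_deriv_def)
    qed
    have d1: "(f1 has_real_derivative f2 u) (at u)" if u: "\<bar>u\<bar> \<le> 1" for u
      unfolding f1_def f2_def
    proof (rule B.DERIV_tau[OF b _ zero_less_one])
      let ?a = "x + u *\<^sub>R h"
      have a: "?a \<in> U"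
        using seg[of u] u by simp
      show "D ?a [h, h] \<in> B"
        by (rule D2_mem[OF a hA hA])
      show "D (x + (u + s) *\<^sub>R h) [h] \<in> B" if "\<bar>s\<bar> < 1" for s
        unfolding shift by (rule D1_mem[OF seg'[OF u that] hA])
      fix e :: real assume e: "0 < e"
      have e2: "iter_deriv F ?a [h, s *\<^sub>R h] = s *\<^sub>R D ?a [h, h]" for s
        using D_eq_iter(2)[OF a h] multilinear_on_2(3)[OF iter_multilinear[OF a order_refl] h h] by simp
      have "[h] \<in> tuples (base_set \<beta> A) 1"
        using h by (simp add: tuples_def)
      then obtain d where d: "d > 0" "\<And>s. \<bar>s\<bar> < d \<Longrightarrow>
          norm (iter_deriv F (?a + s *\<^sub>R h) [h] - iter_deriv F ?a [h] - iter_deriv F ?a ([h] @ [s *\<^sub>R h])) \<le> e * \<bar>s\<bar>"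
        using directional_derivative[OF a h, of 1 "[h]" 1 e] seg'[OF u] e by auto
      have "norm (D (x + (u + s) *\<^sub>R h) [h] - D ?a [h] - s *\<^sub>R D ?a [h, h]) \<le> e * \<bar>s\<bar>" if s: "\<bar>s\<bar> < min 1 d" for s
        using d(2)[of s] s D_eq_iter(1)[OF a h] D_eq_iter(1)[OF seg'[OF u, of s] h] unfolding shift by (simp add: e2)
      then show "\<exists>d>0. \<forall>s. \<bar>s\<bar> < d \<longrightarrow>
          norm (D (x + (u + s) *\<^sub>R h) [h] - D ?a [h] - s *\<^sub>R D ?a [h, h]) \<le> e * \<bar>s\<bar>"
        using d(1) by (intro exI[of _ "min 1 d"]) simp
    qed
    define diff where "diff m = (if m = 0 then f0 else if m = 1 then f1 else f2)" for m :: nat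
    have "\<exists>r. 0 < r \<and> r < 1 \<and> f0 1 = (\<Sum>m<2. diff m 0 / fact m * 1 ^ m) + diff 2 r / fact 2 * 1 ^ 2"
      by (rule Maclaurin) (auto simp: diff_def less_2_cases_iff intro: d0 d1)
    then obtain r where r: "0 < r" "r < 1" "f0 1 = f0 0 + f1 0 + f2 r / 2"
      by (auto simp: diff_def numeral_2_eq_2)
    have rU: "x + r *\<^sub>R h \<in> U"
      using seg[of r] r by simp
    have Dr: "D (x + r *\<^sub>R h) [h, h] \<in> B"
      by (rule D2_mem[OF rU hA hA])
    have "B.tau (b o\<^sub>L (F (x + h) - F x - D x [h] - (1/2) *\<^sub>R D x [h, h])) = f0 1 - f0 0 - f1 0 - (1/2) * f2 0"
      using mem b by (simp add: f0_def f1_def f2_def compose_simps B.tau_diff B.tau_scaleR)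
    also have "\<dots> = (1/2) * (f2 r - f2 0)"
      using r(3) by simp
    also have "f2 r - f2 0 = B.tau (b o\<^sub>L (D (x + r *\<^sub>R h) [h, h] - D x [h, h]))"
      using mem Dr b by (simp add: f2_def compose_simps B.tau_diff)
    also have "\<dots> \<le> B.n1 (D (x + r *\<^sub>R h) [h, h] - D x [h, h])"
      using mem Dr b by (intro B.tau_compose_le_n1') simp_all
    also have "\<dots> \<le> 2 * k"
      using bound[of r] r by simp
    finally show "B.tau (b o\<^sub>L (F (x + h) - F x - D x [h] - (1/2) *\<^sub>R D x [h, h])) \<le> k"
      by simp
  qed
qed

definition remainder :: "real set \<Rightarrow> 'k operator" where
  "remainder P = F (X t) - F (X 0) - sum1 P - (1/2) *\<^sub>R sum2 P"

lemma remainder_mem: "is_partition t P \<Longrightarrow> remainder P \<in> B"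
  unfolding remainder_def using F_mem[OF X_U] t_nonneg sums_mem by simp

lemma sum_increment_X_sq:
  assumes P: "is_partition t P" and C: "(\<Sum>r\<in>P. norm (increment Y P r)) \<le> C" "0 \<le> C"
  shows "(\<Sum>r\<in>P. (A.n2 (increment X P r))\<^sup>2) \<le> 2 * (A.n2 (M t))\<^sup>2 + 2 * C\<^sup>2"
proof -
  have "(\<Sum>r\<in>P. (A.n2 (increment X P r))\<^sup>2) \<le>
      (\<Sum>r\<in>P. 2 * (A.n2 (increment M P r))\<^sup>2 + 2 * (C * norm (increment Y P r)))"
  proof (rule sum_mono)
    fix r assume r: "r \<in> P"
    let ?m = "increment M P r" and ?y = "increment Y P r"
    have mem: "?m \<in> A" "?y \<in> A"
      using increment_mem[OF P r] by auto
    have "(A.n2 (?m + ?y))\<^sup>2 \<le> (A.n2 ?m + A.n2 ?y)\<^sup>2"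
      using mem by (intro power_mono A.n2_triangle) auto
    also have "\<dots> \<le> 2 * (A.n2 ?m)\<^sup>2 + 2 * (A.n2 ?y)\<^sup>2"
      using sum_squares_bound[of "A.n2 ?m" "A.n2 ?y"] by (simp add: power2_sum)
    also have "(A.n2 ?y)\<^sup>2 \<le> C * norm ?y"
    proof -
      have yC: "norm ?y \<le> C"
        using member_le_sum[OF r, of "\<lambda>r. norm (increment Y P r)"] partition_facts(1)[OF P] C(1) by simp
      have "(A.n2 ?y)\<^sup>2 \<le> (norm ?y)\<^sup>2"
        using mem by (intro power_mono A.n2_le_norm) auto
      also have "\<dots> \<le> C * norm ?y"
        unfolding power2_eq_square by (rule mult_right_mono[OF yC]) simp
      finally show ?thesis .
    qed
    finally show "(A.n2 (increment X P r))\<^sup>2 \<le> 2 * (A.n2 ?m)\<^sup>2 + 2 * (C * norm ?y)"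
      by (simp add: increment_mem(5)[OF P r])
  qed
  also have "\<dots> = 2 * (A.n2 (M t))\<^sup>2 + 2 * (C * (\<Sum>r\<in>P. norm (increment Y P r)))"
    by (simp add: sum.distrib sum_distrib_left[symmetric] sum_increment_M_sq[OF P])
  also have "C * (\<Sum>r\<in>P. norm (increment Y P r)) \<le> C\<^sup>2"
    unfolding power2_eq_square by (rule mult_left_mono[OF C])
  finally show ?thesis
    by simp
qed

text \<open>
  The remainder is at most the modulus of continuity of the second derivative along the path
  times the sum of squares of \<open>sum_increment_X_sq\<close>.
\<close>

lemma remainder_small:
  assumes e: "0 < e"
  shows "\<exists>d>0. \<forall>P. is_partition t P \<and> mesh P < d \<longrightarrow> B.n1 (remainder P) \<le> e"
proof -
  interpret L1: Lp_seminorm B EB 1 B.n1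
    by (rule B.Lp_seminorm_1)
  obtain C where C: "0 \<le> C" "\<And>Q. is_partition t Q \<Longrightarrow> (\<Sum>r\<in>Q. norm (increment Y Q r)) \<le> C"
    using variation_bound by blast
  let ?W = "(A.n2 (M t))\<^sup>2 + C\<^sup>2"
  have W: "0 \<le> ?W"
    by simp
  define e' where "e' = e / (?W + 1)"
  have e': "0 < e'" "e' * ?W \<le> e"
  proof -
    show "0 < e'"
      using e W by (simp add: e'_def add_nonneg_pos)
    then have "e' * ?W \<le> e' * (?W + 1)"
      by (intro mult_left_mono) auto
    also have "\<dots> = e"
      using add_nonneg_pos[OF W zero_less_one] by (simp add: e'_def)
    finally show "e' * ?W \<le> e" .
  qed
  obtain \<eta>1 where \<eta>1: "0 < \<eta>1" "\<And>x y h. x \<in> path \<Longrightarrow> y \<in> U \<Longrightarrow> dist y x < \<eta>1 \<Longrightarrow> h \<in> A \<Longrightarrow>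
      B.n1 (D y [h, h] - D x [h, h]) \<le> e' * (A.n2 h)\<^sup>2"
    using D2_modulus[OF e'(1)] by blast
  obtain \<eta>2 where \<eta>2: "0 < \<eta>2" "\<And>x y. x \<in> path \<Longrightarrow> y \<in> base_set \<beta> A \<Longrightarrow> dist y x < \<eta>2 \<Longrightarrow> y \<in> U"
    using path_neighbourhood by blast
  define \<eta> where "\<eta> = min \<eta>1 \<eta>2 / 2"
  have \<eta>: "0 < \<eta>"
    using \<eta>1(1) \<eta>2(1) by (simp add: \<eta>_def)
  obtain d where d: "0 < d" "\<And>s u. s \<in> {0..t} \<Longrightarrow> u \<in> {0..t} \<Longrightarrow> \<bar>s - u\<bar> < d \<Longrightarrow> dist (X s) (X u) < \<eta>"
    using X_uniformly_continuous[OF \<eta>] by blast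
  have "B.n1 (remainder P) \<le> e" if P: "is_partition t P" "mesh P < d" for P
  proof -
    note pf = partition_facts[OF P(1)]
    define R where "R s = F (X s) - F (X (left_nb P s)) - D (X (left_nb P s)) [increment X P s]
        - (1/2) *\<^sub>R D (X (left_nb P s)) [increment X P s, increment X P s]" for s
    have R: "R s \<in> B \<and> B.n1 (R s) \<le> e' / 2 * (A.n2 (increment X P s))\<^sup>2" if s: "s \<in> P" for s
    proof -
      note b = left_nb_bounds[OF P(1) pf(4)[OF s]]
      let ?x = "X (left_nb P s)" and ?h = "increment X P s"
      have h: "?h \<in> base_set \<beta> A"
        by (rule increment_mem(3)[OF P(1) s])
      have xU: "?x \<in> U"
        by (rule X_U[OF b(3)])
      have xp: "?x \<in> path"
        using b pf(5)[OF s] by (auto simp: path_def)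
      have xh: "?x + ?h = X s"
        by (simp add: increment_def)
      have "\<bar>s - left_nb P s\<bar> < d"
        using mesh_ge[OF P(1) pf(4)[OF s] pf(5)[OF s]] b P(2) by simp
      then have "dist (X s) ?x < \<eta>"
        using b pf(4,5)[OF s] by (intro d(2)) auto
      then have nh: "norm ?h < \<eta>"
        by (simp add: increment_def dist_norm)
      have dist: "dist (?x + r *\<^sub>R ?h) ?x < 2 * \<eta>" if "\<bar>r\<bar> < 2" for r
      proof -
        have "\<bar>r\<bar> * norm ?h \<le> 2 * norm ?h"
          using that by (intro mult_right_mono) auto
        then show ?thesis
          using nh by (simp add: dist_norm)
      qed
      have seg: "?x + r *\<^sub>R ?h \<in> U" if "\<bar>r\<bar> < 2" for r
        using dist[OF that] h U_base[OF xU] by (intro \<eta>2(2)[OF xp] base_closed) (simp_all add: \<eta>_def)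
      have bound: "B.n1 (D (?x + r *\<^sub>R ?h) [?h, ?h] - D ?x [?h, ?h]) \<le> 2 * (e' / 2 * (A.n2 ?h)\<^sup>2)"
        if "0 \<le> r" "r \<le> 1" for r
      proof -
        have r2: "\<bar>r\<bar> < 2"
          using that by simp
        have "dist (?x + r *\<^sub>R ?h) ?x < \<eta>1"
          using dist[OF r2] by (simp add: \<eta>_def)
        from \<eta>1(2)[OF xp seg[OF r2] this base_A[OF h]] show ?thesis
          by simp
      qed
      have "R s \<in> B"
        unfolding R_def using xU X_U[OF pf(4)[OF s]] base_A[OF h] by (simp add: F_mem D1_mem D2_mem)
      then show ?thesis
        using taylor_L1[OF h seg bound] by (simp add: R_def xh)
    qed
    have "(\<Sum>s\<in>P. R s) = (\<Sum>s\<in>P. F (X s) - F (X (left_nb P s))) - sum1 P - (1/2) *\<^sub>R sum2 P"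
      by (simp add: R_def sum_subtractf sum1_def sum2_def scaleR_sum_right)
    then have "remainder P = (\<Sum>s\<in>P. R s)"
      using telescope_partition[OF P(1), of "\<lambda>s. F (X s)"] by (simp add: remainder_def)
    then have "B.n1 (remainder P) \<le> (\<Sum>s\<in>P. B.n1 (R s))"
      using L1.nu_sum[of P R] R by simp
    also have "\<dots> \<le> (\<Sum>s\<in>P. e' / 2 * (A.n2 (increment X P s))\<^sup>2)"
      using R by (intro sum_mono) simp
    also have "\<dots> = e' / 2 * (\<Sum>s\<in>P. (A.n2 (increment X P s))\<^sup>2)"
      by (simp add: sum_distrib_left)
    also have "\<dots> \<le> e' / 2 * (2 * (A.n2 (M t))\<^sup>2 + 2 * C\<^sup>2)"
      using sum_increment_X_sq[OF P(1) C(2)[OF P(1)] C(1)] e'(1) by (intro mult_left_mono) auto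
    also have "\<dots> = e' * ?W"
      by (simp add: field_simps)
    also have "\<dots> \<le> e"
      by (rule e'(2))
    finally show ?thesis .
  qed
  then show ?thesis
    using d(1) by blast
qed

text \<open>
  Solving the Taylor expansion for the second-order sums shows that these converge as well:
  every other term does.
\<close>

lemma sum2_Cauchy:
  assumes e: "0 < e"
  shows "\<exists>d>0. \<forall>P P'. is_partition t P \<and> mesh P < d \<and> is_partition t P' \<and> mesh P' < d \<longrightarrow>
      B.n1 (sum2 P - sum2 P') \<le> e"
proof -
  interpret L1: Lp_seminorm B EB 1 B.n1
    by (rule B.Lp_seminorm_1)
  have e6: "0 < e / 6"
    using e by simp
  obtain d1 where d1: "0 < d1" "\<And>P P'. is_partition t P \<and> mesh P < d1 \<and> is_partition t P' \<and> mesh P' < d1 \<Longrightarrow>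
      B.n2 (sum1 P - sum1 P') \<le> e / 6"
    using sum1_Cauchy[OF e6] by blast
  obtain d2 where d2: "0 < d2" "\<And>P. is_partition t P \<and> mesh P < d2 \<Longrightarrow> B.n1 (remainder P) \<le> e / 6"
    using remainder_small[OF e6] by blast
  have "B.n1 (sum2 P - sum2 P') \<le> e"
    if P: "is_partition t P" "mesh P < min d1 d2" and P': "is_partition t P'" "mesh P' < min d1 d2" for P P'
  proof -
    note m = sums_mem[OF P(1)] sums_mem[OF P'(1)] remainder_mem[OF P(1)] remainder_mem[OF P'(1)]
    let ?s = "sum1 P' - sum1 P" and ?r = "remainder P' - remainder P"
    have "sum2 P - sum2 P' = 2 *\<^sub>R (?s + ?r)"
      by (simp add: remainder_def scaleR_add_right scaleR_diff_right scaleR_2)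
    then have "B.n1 (sum2 P - sum2 P') = 2 * B.n1 (?s + ?r)"
      using m by (simp add: B.n1_scaleR)
    also have "\<dots> \<le> 2 * (B.n1 ?s + B.n1 ?r)"
      using B.n1_triangle[of ?s ?r] m by simp
    also have "B.n1 ?s \<le> e / 6"
      using B.n1_le_n2[of ?s] d1(2)[of P' P] P P' m by simp
    also have "B.n1 ?r \<le> B.n1 (remainder P') + B.n1 (remainder P)"
      using L1.nu_diff_triangle[of "remainder P'" 0 "remainder P"] L1.nu_minus_commute[of 0 "remainder P"] m by simp
    also have "\<dots> \<le> e / 6 + e / 6"
      using d2(2)[of P] d2(2)[of P'] P P' by simp
    finally show ?thesis
      by simp
  qed
  then show ?thesis
    using d1(1) d2(1) by (intro exI[of _ "min d1 d2"]) auto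
qed

subsection \<open>The Ito formula\<close>

lemma ito_formula:
  "(\<exists>I. has_first_integral B EB \<beta> F X t I) \<and> (\<exists>J. has_second_integral B EB \<beta> F X t J) \<and>
    Lp_of B EB 1 (F (X t)) =
      Lp_add B EB 1
        (Lp_add B EB 1 (Lp_of B EB 1 (F (X 0))) (Lp_to_L1 B EB (first_integral B EB \<beta> F X t)))
        (Lp_scaleR B EB 1 (1/2) (second_integral B EB \<beta> F X t))"
proof -
  interpret L2: Lp_seminorm B EB 2 B.n2
    by (rule B.Lp_seminorm_2)
  interpret L1: Lp_seminorm B EB 1 B.n1
    by (rule B.Lp_seminorm_1)
  obtain P where P: "\<And>n::nat. is_partition t (P n)" "\<And>d. 0 < d \<Longrightarrow> \<forall>\<^sub>F n in sequentially. mesh (P n) < d"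
    by (rule partition_sequence[OF t_nonneg]) (rule that)
  define I where "I = L2.cls (\<lambda>n. sum1 (P n))"
  define J where "J = L1.cls (\<lambda>n. sum2 (P n))"
  have l1: "L2.Cauchy_seq (\<lambda>n. sum1 (P n))" "has_Lp_limit B EB 2 sum1 (fine_partitions t) I"
      "\<And>xi. has_Lp_limit B EB 2 sum1 (fine_partitions t) xi \<Longrightarrow> xi = I"
    unfolding I_def
    by (rule L2.fine_Cauchy_limit[where S = sum1 and P = P, OF t_nonneg sums_mem(1) sum1_Cauchy P]; assumption)+
  have l2: "L1.Cauchy_seq (\<lambda>n. sum2 (P n))" "has_Lp_limit B EB 1 sum2 (fine_partitions t) J"
      "\<And>xi. has_Lp_limit B EB 1 sum2 (fine_partitions t) xi \<Longrightarrow> xi = J"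
    unfolding J_def
    by (rule L1.fine_Cauchy_limit[where S = sum2 and P = P, OF t_nonneg sums_mem(2) sum2_Cauchy P]; assumption)+
  have s1: "has_first_integral B EB \<beta> F X t xi \<longleftrightarrow> has_Lp_limit B EB 2 sum1 (fine_partitions t) xi" for xi
    unfolding has_first_integral_def sum1_def by (rule refl)
  have s2: "has_second_integral B EB \<beta> F X t xi \<longleftrightarrow> has_Lp_limit B EB 1 sum2 (fine_partitions t) xi" for xi
    unfolding has_second_integral_def sum2_def by (rule refl)
  have I: "has_first_integral B EB \<beta> F X t I" and J: "has_second_integral B EB \<beta> F X t J"
    unfolding s1 s2 by (rule l1(2), rule l2(2))
  have "first_integral B EB \<beta> F X t = I"
    unfolding first_integral_def by (rule the_equality) (rule I, simp add: s1 l1(3))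
  moreover have "second_integral B EB \<beta> F X t = J"
    unfolding second_integral_def by (rule the_equality) (rule J, simp add: s2 l2(3))
  moreover have "Lp_to_L1 B EB I = L1.cls (\<lambda>n. sum1 (P n))" and c1: "L1.Cauchy_seq (\<lambda>n. sum1 (P n))"
    using Lp_to_L1_cls[OF B.Lp_seminorm_2 B.Lp_seminorm_1 B.n1_le_n2 l1(1)] by (simp_all add: I_def)
  moreover have FB: "F (X t) \<in> B" "F (X 0) \<in> B"
    using F_mem X_U t_nonneg by auto
  note c = L1.Cauchy_seq_const[OF FB(1)] L1.Cauchy_seq_const[OF FB(2)] c1 l2(1)
  have "L1.cls (\<lambda>n. F (X t)) = L1.cls (\<lambda>n. F (X 0) + sum1 (P n) + (1/2) *\<^sub>R sum2 (P n))"
  proof (subst L1.cls_eq_iff)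
    have "(\<lambda>n. B.n1 (remainder (P n))) \<longlonglongrightarrow> 0"
    proof (rule LIMSEQ_I)
      fix e :: real assume e: "0 < e"
      have e2: "0 < e / 2"
        using e by simp
      obtain d where d: "0 < d" "\<And>P. is_partition t P \<and> mesh P < d \<Longrightarrow> B.n1 (remainder P) \<le> e / 2"
        using remainder_small[OF e2] by blast
      obtain N where N: "\<And>n. n \<ge> N \<Longrightarrow> mesh (P n) < d"
        using P(2)[OF d(1)] unfolding eventually_sequentially by blast
      have "norm (B.n1 (remainder (P n)) - 0) < e" if "n \<ge> N" for n
        using d(2)[of "P n"] N[OF that] P(1)[of n] B.n1_nonneg[OF remainder_mem[OF P(1)[of n]]] e by simp
      then show "\<exists>N. \<forall>n\<ge>N. norm (B.n1 (remainder (P n)) - 0) < e"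
        by blast
    qed
    then show "(\<lambda>n. B.n1 (F (X t) - (F (X 0) + sum1 (P n) + (1/2) *\<^sub>R sum2 (P n)))) \<longlonglongrightarrow> 0"
      by (simp add: remainder_def diff_diff_eq)
  qed (intro L1.Cauchy_seq_add L1.Cauchy_seq_scaleR c)+
  ultimately show ?thesis
    using I J by (auto simp: L1.Lp_of_cls J_def L1.Lp_scaleR_cls L1.Lp_add_cls L1.Cauchy_seq_add L1.Cauchy_seq_scaleR c)
qed

end

theorem theorem1p13:
  fixes A :: "'h::complex_hilbert operator set" and \<A> :: "real \<Rightarrow> 'h operator set"
    and EA :: "'h operator \<Rightarrow> complex"
    and B :: "'k::complex_hilbert operator set" and \<B> :: "real \<Rightarrow> 'k operator set"
    and EB :: "'k operator \<Rightarrow> complex"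
    and \<beta> :: base and U :: "'h operator set"
    and F :: "'h operator \<Rightarrow> 'k operator" and X :: "real \<Rightarrow> 'h operator" and t :: real
  assumes "filtered_wstar_prob_space A \<A> EA"
    and "filtered_wstar_prob_space B \<B> EB"
    and "openin (top_of_set (base_set \<beta> A)) U"
    and "adapted_Ck A \<A> EA B \<B> EB \<beta> U 2 F"
    and "Linf_decomposable A \<A> EA X"
    and "\<forall>s\<ge>0. X s \<in> U"
    and "t \<ge> 0"
  shows "(\<exists>I. has_first_integral B EB \<beta> F X t I) \<and> (\<exists>J. has_second_integral B EB \<beta> F X t J) \<and>
    Lp_of B EB 1 (F (X t)) =
      Lp_add B EB 1
        (Lp_add B EB 1 (Lp_of B EB 1 (F (X 0))) (Lp_to_L1 B EB (first_integral B EB \<beta> F X t)))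
        (Lp_scaleR B EB 1 (1/2) (second_integral B EB \<beta> F X t))"
proof -
  obtain M Y where X: "\<And>s. 0 \<le> s \<Longrightarrow> X s = X 0 + M s + Y s" "M 0 = 0"
      "martingale A \<A> EA M" "continuous_on {0..} M"
      "adapted_process \<A> Y" "continuous_on {0..} Y" "locally_bounded_variation Y"
    and adX: "adapted_process \<A> X"
    using assms(5) unfolding Linf_decomposable_def by blast
  have W: "wstar_prob_space A EA" "wstar_prob_space B EB"
    using assms(1,2) by (auto simp: filtered_wstar_prob_space_def)
  then have vn: "von_neumann_algebra A" "von_neumann_algebra B"
    by (auto simp: wstar_prob_space_def)
  have tr: "tracial A EA" "tracial B EB"
    by (intro tracial.intro vn_algebra.intro tracial_axioms.intro W vn)+
  have XU: "\<And>s. 0 \<le> s \<Longrightarrow> X s \<in> U"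
    using assms(6) by blast
  interpret ito_setting A EA B EB \<A> \<B> \<beta> U F X M Y t
    by (intro ito_setting.intro ito_setting_axioms.intro) (fact assms X XU adX tr)+
  show ?thesis
    by (rule ito_formula)
qed

end
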